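(* Let $n\ge 2$, let $M=S^n$ be the round unit sphere, and let $0<\gamma<\gamma_{\mathrm{crit}}$. Then, as $\varepsilon\to 0$, the functionals $E_{\gamma,\varepsilon}$ $\Gamma$-converge in the $L^1$-topology to the functional $$E_{\gamma,0}(\Omega)=\begin{cases}\left(1-\frac{\gamma}{\gamma_{\mathrm{crit}}}\right)\operatorname{Per}(\Omega) & \text{if }\Omega\text{ has finite perimeter},\\ +\infty & \text{otherwise.}\end{cases}$$
   Context: $M=S^n$ carries the round metric $g$, geodesic distance $d$, Riemannian volume $dx$, and Laplace–Beltrami operator $\Delta$. For $f\in L^1(M)$, $V[f]=\sup\{\int_M f\operatorname{div}(X)\,dx: X$ a smooth vector field with $\|X(x)\|_{g_x}\le1$ for all $x\in M\}\in[0,\infty]$. For measurable $\Omega\subset M$ with characteristic function $\chi_\Omega$, $\operatorname{Per}(\Omega)=V[\chi_\Omega]\in[0,\infty]$, and $\Omega$ has finite perimeter if this is finite. For $\varepsilon>0$, $K_\varepsilon:M\times M\to\mathbb{R}$ is the Helmholtz kernel, i.e. the unique fundamental solution (in the distributional sense) of $K_\varepsilon(\cdot,y)-\varepsilon^2\Delta K_\varepsilon(\cdot,y)=\delta_y$ in $M$, for every $y\in M$; it is smooth outside the diagonal. For $\gamma,\varepsilon>0$ and measurable $\Omega\subset M$, $$E_{\gamma,\varepsilon}(\Omega)=\operatorname{Per}(\Omega)-\frac{\gamma}{\varepsilon}\int_{M\times M}K_\varepsilon(x,y)\,|\chi_\Omega(x)-\chi_\Omega(y)|\,dx\,dy ,$$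 which equals $+\infty$ if $\Omega$ does not have finite perimeter. Let $\sigma_k$ be the $k$-dimensional volume of the Euclidean unit sphere $S^k$ and $k_n=\frac{2}{n-1}\frac{\sigma_{n-2}}{\sigma_{n-1}}$. Set $\frac1{\gamma_\varepsilon}=k_n\int_M\frac{d(x,y)}{\varepsilon}K_\varepsilon(x,y)\,dx$ (for some $y\in M$; the value does not depend on $y$) and $\gamma_{\mathrm{crit}}=\lim_{\varepsilon\to0}\gamma_\varepsilon$ (this limit exists and lies in $(0,\infty)$). $\Gamma$-convergence in the $L^1$-topology means: (liminf inequality) for every measurable $\Omega\subset M$ and every sequence of measurable sets $\Omega_\varepsilon\subset M$ with $|\Omega\bigtriangleup\Omega_\varepsilon|\to0$ as $\varepsilon\to0$ one has $E_{\gamma,0}(\Omega)\le\liminf_{\varepsilon\to0}E_{\gamma,\varepsilon}(\Omega_\varepsilon)$; (limsup inequality) for every measurable $\Omega\subset M$ there is a sequence of measurable sets $\Omega_\varepsilon\subset M$ with $|\Omega\bigtriangleup\Omega_\varepsilon|\to0$ and $E_{\gamma,0}(\Omega)\ge\limsup_{\varepsilon\to0}E_{\gamma,\varepsilon}(\Omega_\varepsilon)$. Here $|\cdot|$ is the Riemannian volume and $\bigtriangleup$ the symmetric difference. *)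

theory Defs
  imports "HOL-Analysis.Analysis"
begin

text \<open>
  The round sphere of dimension n is the set \<open>sphere 0 1\<close> in a Euclidean space of
  dimension n + 1, with the metric induced from the ambient inner product. Functions and
  vector fields on it are functions on the ambient space of which only the values on
  \<open>sphere 0 1\<close> matter. The map \<open>sgn z = z /\<^sub>R norm z\<close> is the radial
  projection onto the sphere.
\<close>

section \<open>Volume\<close>

text \<open>
  Riemannian volume in polar coordinates: the part of the unit ball lying over
  a set \<open>A\<close> of directions has Lebesgue measure
  \<open>|A| * (integral of r ^ n over 0 < r < 1) = |A| / (n + 1)\<close>.
  The origin, where \<open>sgn\<close> leaves the sphere, is removed.
\<close>

definition sphere_measure :: "'a::euclidean_space measure" where
  "sphere_measure =
     completion
       (scale_measure (of_nat DIM('a))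
         (distr (restrict_space lborel (ball 0 1 - {0}))
                (restrict_space borel (sphere 0 1)) sgn))"

text \<open>The k-dimensional volume of the unit sphere of dimension k.\<close>

definition unit_sphere_area :: "nat \<Rightarrow> real" where
  "unit_sphere_area k = real (k + 1) * unit_ball_vol (real (k + 1))"

lemma space_sphere_measure [simp]: "space sphere_measure = sphere 0 1"
  by (simp add: sphere_measure_def space_restrict_space space_scale_measure)

lemma measurable_sgn_sphere:
  "sgn \<in> measurable (restrict_space lborel (ball 0 1 - {0})) (restrict_space borel (sphere (0::'a::euclidean_space) 1))"
proof (rule measurable_restrict_space2)
  show "sgn \<in> space (restrict_space lborel (ball 0 1 - {0})) \<rightarrow> sphere (0::'a) 1"
    by (auto simp: space_restrict_space norm_sgn)
  have "continuous_on (ball 0 1 - {0}) (sgn :: 'a \<Rightarrow> 'a)"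
    by (auto simp: sgn_div_norm[abs_def] intro!: continuous_intros)
  then have "sgn \<in> borel_measurable (restrict_space borel (ball 0 1 - {0 :: 'a}))"
    by (rule borel_measurable_continuous_on_restrict)
  then show "sgn \<in> borel_measurable (restrict_space lborel (ball 0 1 - {0 :: 'a}))"
    by (simp cong: measurable_cong_sets add: sets_restrict_space)
qed

lemma emeasure_sphere_measure:
  fixes A :: "'a::euclidean_space set"
  assumes "A \<in> sets borel" "A \<subseteq> sphere 0 1"
  shows "emeasure sphere_measure A =
           of_nat DIM('a) * emeasure lborel {z \<in> ball 0 1 - {0}. sgn z \<in> A}"
proof -
  have A: "A \<in> sets (restrict_space borel (sphere 0 1))"
    using assms by (subst sets_restrict_space_iff) auto
  have eq: "sgn -` A \<inter> space (restrict_space lborel (ball 0 1 - {0})) = {z \<in> ball 0 1 - {0}. sgn z \<in> A}"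
    by (auto simp: space_restrict_space)
  have "emeasure sphere_measure A =
      of_nat DIM('a) * emeasure (restrict_space lborel (ball 0 1 - {0}))
        (sgn -` A \<inter> space (restrict_space lborel (ball 0 1 - {0})))"
    unfolding sphere_measure_def using A
    by (simp add: emeasure_distr[OF measurable_sgn_sphere A] del: vimage_Int)
  also note eq
  also have "emeasure (restrict_space lborel (ball 0 1 - {0})) {z \<in> ball 0 1 - {0}. sgn z \<in> A} =
      emeasure lborel {z \<in> ball 0 1 - {0}. sgn z \<in> A}"
    by (subst emeasure_restrict_space) auto
  finally show ?thesis .
qed

lemma measure_sphere_measure_sphere:
  "measure (sphere_measure :: 'a measure) (sphere (0::'a::euclidean_space) 1) =
     unit_sphere_area (DIM('a) - 1)"
proof -
  have "{z \<in> ball 0 1 - {0}. sgn z \<in> sphere (0::'a) 1} = ball 0 1 - {0}"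
    by (auto simp: norm_sgn)
  then have "emeasure sphere_measure (sphere (0::'a) 1) =
      of_nat DIM('a) * emeasure lborel (ball (0::'a) 1 - {0})"
    by (simp add: emeasure_sphere_measure)
  also have "emeasure lborel (ball (0::'a) 1 - {0}) = emeasure lborel (ball (0::'a) 1)"
    by (rule emeasure_Diff_null_set) auto
  also have "\<dots> = ennreal (unit_ball_vol DIM('a))"
    by (simp add: emeasure_ball)
  finally have "emeasure sphere_measure (sphere (0::'a) 1) =
      ennreal (DIM('a) * unit_ball_vol DIM('a))"
    by (simp add: ennreal_of_nat_eq_real_of_nat ennreal_mult)
  then show ?thesis
    by (simp add: measure_def unit_sphere_area_def)
qed

section \<open>Geodesic distance\<close>

text \<open>
  Infimum of the lengths of piecewise C1 curves in the sphere. Since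
  \<open>valid_path\<close> admits curves of infinite length, the length is introduced with
  \<open>has_integral\<close> instead of the total function \<open>integral\<close>.
\<close>

definition geodesic_dist :: "'a::euclidean_space \<Rightarrow> 'a \<Rightarrow> real" where
  "geodesic_dist x y = Inf {L. \<exists>g. valid_path g \<and> path_image g \<subseteq> sphere 0 1 \<and>
      pathstart g = x \<and> pathfinish g = y \<and>
      ((\<lambda>t. norm (vector_derivative g (at t))) has_integral L) {0..1}}"

lemma arccos_le_curve_length:
  fixes x y :: "'a::euclidean_space"
  assumes g: "valid_path g" "path_image g \<subseteq> sphere 0 1" "pathstart g = x" "pathfinish g = y"
    and L: "((\<lambda>t. norm (vector_derivative g (at t))) has_integral L) {0..1}"
  shows "arccos (x \<bullet> y) \<le> L"
proof -
  obtain S where S: "finite S" "g C1_differentiable_on ({0..1} - S)" and cg: "continuous_on {0..1} g"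
    using g(1) by (auto simp: valid_path_def piecewise_C1_differentiable_on_def)
  have ng: "norm (g t) = 1" if "t \<in> {0..1}" for t
    using g(2) that by (auto simp: path_image_def image_subset_iff)
  have x: "g 0 = x" and y: "g 1 = y"
    using g by (auto simp: pathstart_def pathfinish_def)
  have nx: "norm x = 1" using ng[of 0] x by simp
  let ?h = "\<lambda>t. x \<bullet> g t"
  have h1: "\<bar>?h t\<bar> \<le> 1" if "t \<in> {0..1}" for t
    using Cauchy_Schwarz_ineq2[of x "g t"] ng[OF that] nx by simp
  have lt: "arccos (l * (x \<bullet> y)) - arccos l \<le> L" if l: "0 < l" "l < 1" for l
  proof -
    let ?v = "\<lambda>t. vector_derivative g (at t)"
    define d where "d = (\<lambda>t. - (l * (x \<bullet> ?v t)) / sqrt (1 - (l * ?h t)\<^sup>2))"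
    define D where "D = (\<lambda>t. if t \<in> {0<..<1} - S then d t else 0)"
    have lh: "\<bar>l * ?h t\<bar> < 1" if "t \<in> {0..1}" for t
    proof -
      have "\<bar>l * ?h t\<bar> \<le> l * 1"
        unfolding abs_mult using h1[OF that] l by (intro mult_mono) auto
      then show ?thesis using l by simp
    qed
    have gd: "(g has_vector_derivative ?v t) (at t)" if "t \<in> {0<..<1} - S" for t
      using S(2) that by (auto simp: C1_differentiable_on_eq vector_derivative_works)
    have der: "((\<lambda>t. arccos (l * ?h t)) has_vector_derivative D t) (at t)"
      if t: "t \<in> {0<..<1} - S" for t
    proof -
      have "((\<lambda>t. l * ?h t) has_vector_derivative (l * (x \<bullet> ?v t))) (at t)"
        by (intro bounded_linear.has_vector_derivative[OF _ gd[OF t]]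
              bounded_linear_const_mult bounded_linear_inner_right)
      then have "((\<lambda>t. l * ?h t) has_real_derivative (l * (x \<bullet> ?v t))) (at t)"
        by (simp add: has_real_derivative_iff_has_vector_derivative)
      moreover have "-1 < l * ?h t" "l * ?h t < 1"
        using lh[of t] t by auto
      ultimately have "((\<lambda>t. arccos (l * ?h t)) has_real_derivative
          inverse (- sqrt (1 - (l * ?h t)\<^sup>2)) * (l * (x \<bullet> ?v t))) (at t)"
        by (intro DERIV_chain2[OF DERIV_arccos])
      then show ?thesis
        using t by (simp add: has_real_derivative_iff_has_vector_derivative D_def d_def field_simps)
    qed
    have "continuous_on {0..1} (\<lambda>t. arccos (l * ?h t))"
    proof (intro continuous_on_arccos continuous_intros cg)
      show "\<forall>t\<in>{0..1}. - 1 \<le> l * ?h t \<and> l * ?h t \<le> 1"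
        using lh by (force simp: abs_less_iff)
    qed
    then have "(D has_integral (arccos (l * ?h 1) - arccos (l * ?h 0))) {0..1}"
      using fundamental_theorem_of_calculus_interior_strong[OF S(1), of 0 1 "\<lambda>t. arccos (l * ?h t)" D] der
      by auto
    then have I: "(D has_integral (arccos (l * (x \<bullet> y)) - arccos l)) {0..1}"
      using nx by (simp add: x y dot_square_norm)
    have "D t \<le> norm (?v t)" if "t \<in> {0..1}" for t
    proof (cases "t \<in> {0<..<1} - S")
      case True
      have "((\<lambda>s. g s \<bullet> g s) has_vector_derivative (g t \<bullet> ?v t + ?v t \<bullet> g t)) (at t)"
        using bounded_bilinear.has_vector_derivative[OF bounded_bilinear_inner gd[OF True] gd[OF True]] .
      moreover have "((\<lambda>s. g s \<bullet> g s) has_vector_derivative 0) (at t)"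
      proof (rule has_vector_derivative_transform_within_open[of "\<lambda>_. 1" _ _ "{0<..<1}"])
        show "1 = g s \<bullet> g s" if "s \<in> {0<..<1}" for s
          using ng[of s] that by (simp add: dot_square_norm)
      qed (use True in auto)
      ultimately have "g t \<bullet> ?v t + ?v t \<bullet> g t = 0"
        by (rule vector_derivative_unique_at)
      then have perp: "g t \<bullet> ?v t = 0" by (simp add: inner_commute)
      let ?w = "x - ?h t *\<^sub>R g t"
      have "?w \<bullet> ?w = 1 - (?h t)\<^sup>2"
      proof -
        have "x \<bullet> x = 1" "g t \<bullet> g t = 1"
          using nx ng[of t] True by (simp_all add: dot_square_norm)
        then show ?thesis
          by (simp add: inner_diff inner_commute power2_eq_square)
      qed
      then have nw: "norm ?w = sqrt (1 - (?h t)\<^sup>2)" by (simp add: norm_eq_sqrt_inner)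
      have "\<bar>x \<bullet> ?v t\<bar> = \<bar>?w \<bullet> ?v t\<bar>" by (simp add: inner_diff perp)
      also have "\<dots> \<le> sqrt (1 - (?h t)\<^sup>2) * norm (?v t)"
        using Cauchy_Schwarz_ineq2[of ?w "?v t"] nw by simp
      also have "\<dots> \<le> sqrt (1 - (l * ?h t)\<^sup>2) * norm (?v t)"
      proof -
        have "(l * ?h t)\<^sup>2 \<le> (?h t)\<^sup>2"
          using l by (simp add: power_mult_distrib mult_left_le_one_le power_le_one)
        then show ?thesis by (intro mult_right_mono) auto
      qed
      finally have b: "\<bar>x \<bullet> ?v t\<bar> \<le> sqrt (1 - (l * ?h t)\<^sup>2) * norm (?v t)" .
      have "(l * ?h t)\<^sup>2 < 1"
        using lh[of t] True by (simp add: abs_square_less_1)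
      then have pos: "sqrt (1 - (l * ?h t)\<^sup>2) > 0" by simp
      have "- (l * (x \<bullet> ?v t)) \<le> l * \<bar>x \<bullet> ?v t\<bar>"
        using l by (simp add: abs_if)
      also have "\<dots> \<le> 1 * \<bar>x \<bullet> ?v t\<bar>"
        using l by (intro mult_right_mono) auto
      also have "\<dots> \<le> norm (?v t) * sqrt (1 - (l * ?h t)\<^sup>2)"
        using b by (simp add: mult.commute)
      finally have "d t \<le> norm (?v t)"
        unfolding d_def by (subst pos_divide_le_eq[OF pos])
      then show ?thesis using True by (simp add: D_def)
    qed (auto simp: D_def)
    then show ?thesis
      by (rule has_integral_le[OF I L])
  qed
  have c: "\<bar>x \<bullet> y\<bar> \<le> 1" using h1[of 1] y by simp
  have "continuous_on {0..1} (\<lambda>l. arccos (l * (x \<bullet> y)) - arccos l)"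
  proof (intro continuous_intros continuous_on_arccos ballI)
    fix l :: real assume l: "l \<in> {0..1}"
    have "\<bar>l * (x \<bullet> y)\<bar> \<le> 1 * 1"
      unfolding abs_mult using l c by (intro mult_mono) auto
    then show "- 1 \<le> l * (x \<bullet> y) \<and> l * (x \<bullet> y) \<le> 1" by (simp add: abs_le_iff)
  qed auto
  then have "((\<lambda>l. arccos (l * (x \<bullet> y)) - arccos l) \<longlongrightarrow> arccos (1 * (x \<bullet> y)) - arccos 1) (at 1 within {0..1})"
    unfolding continuous_on by (rule bspec) simp
  then have "((\<lambda>l. arccos (l * (x \<bullet> y)) - arccos l) \<longlongrightarrow> arccos (x \<bullet> y)) (at_left 1)"
    by (simp add: at_within_Icc_at_left)
  moreover have "eventually (\<lambda>l. arccos (l * (x \<bullet> y)) - arccos l \<le> L) (at_left 1)"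
    using eventually_at_left_real[of 0 "1::real"] lt by (auto elim: eventually_mono)
  ultimately show ?thesis
    by (rule tendsto_upperbound) simp
qed

lemma great_circle_arc:
  fixes x y :: "'a::euclidean_space"
  assumes x: "norm x = 1" and y: "norm y = 1" and dim: "DIM('a) \<ge> 2"
  shows "\<exists>g. valid_path g \<and> path_image g \<subseteq> sphere 0 1 \<and> pathstart g = x \<and> pathfinish g = y \<and>
      ((\<lambda>t. norm (vector_derivative g (at t))) has_integral arccos (x \<bullet> y)) {0..1}"
proof -
  define c where "c = x \<bullet> y"
  define T where "T = arccos c"
  have c: "-1 \<le> c" "c \<le> 1"
    using Cauchy_Schwarz_ineq2[of x y] x y by (auto simp: c_def abs_le_iff)
  have cosT: "cos T = c" and sinT: "sin T = sqrt (1 - c\<^sup>2)" and T: "0 \<le> T"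
    using c by (auto simp: T_def cos_arccos sin_arccos arccos_lbound)
  have xx: "x \<bullet> x = 1" and yy: "y \<bullet> y = 1" using x y by (simp_all add: dot_square_norm)
  have c2: "c\<^sup>2 \<le> 1" using c by (simp add: abs_square_le_1 abs_le_iff)
  have ww: "(y - c *\<^sub>R x) \<bullet> (y - c *\<^sub>R x) = 1 - c\<^sup>2"
    by (simp add: inner_diff xx yy inner_commute c_def power2_eq_square)
  obtain u where u: "u \<bullet> u = 1" "u \<bullet> x = 0" "y = c *\<^sub>R x + sin T *\<^sub>R u"
  proof (cases "c\<^sup>2 = 1")
    case True
    obtain v where v: "v \<noteq> 0" "orthogonal x v"
      using orthogonal_to_vector_exists[OF dim, of x] by blast
    show ?thesis
    proof (rule that)
      show "(v /\<^sub>R norm v) \<bullet> (v /\<^sub>R norm v) = 1"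
        using v by (simp add: dot_square_norm power2_eq_square)
      show "(v /\<^sub>R norm v) \<bullet> x = 0"
        using v by (simp add: orthogonal_def inner_commute)
      show "y = c *\<^sub>R x + sin T *\<^sub>R (v /\<^sub>R norm v)"
        using ww True by (simp add: sinT)
    qed
  next
    case False
    then have s: "sin T > 0" "(sin T)\<^sup>2 = 1 - c\<^sup>2" using c2 by (auto simp: sinT)
    show ?thesis
    proof (rule that)
      show "((y - c *\<^sub>R x) /\<^sub>R sin T) \<bullet> ((y - c *\<^sub>R x) /\<^sub>R sin T) = 1"
      proof -
        have "((y - c *\<^sub>R x) /\<^sub>R sin T) \<bullet> ((y - c *\<^sub>R x) /\<^sub>R sin T) = (1 - c\<^sup>2) / (sin T)\<^sup>2"
          unfolding ww[symmetric] by (simp add: power2_eq_square divide_inverse)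
        then show ?thesis using s False by simp
      qed
      show "((y - c *\<^sub>R x) /\<^sub>R sin T) \<bullet> x = 0"
        by (simp add: inner_diff xx inner_commute c_def)
      show "y = c *\<^sub>R x + sin T *\<^sub>R ((y - c *\<^sub>R x) /\<^sub>R sin T)"
        using s by simp
    qed
  qed
  define g where "g = (\<lambda>t::real. cos (t * T) *\<^sub>R x + sin (t * T) *\<^sub>R u)"
  define g' where "g' = (\<lambda>t::real. (- sin (t * T) * T) *\<^sub>R x + (cos (t * T) * T) *\<^sub>R u)"
  have der: "(g has_vector_derivative g' t) (at t)" for t
    unfolding g_def g'_def
    by (auto intro!: derivative_eq_intros simp: has_real_derivative_iff_has_vector_derivative[symmetric])
  have ng: "norm (g t) = 1" for t
  proof -
    have "g t \<bullet> g t = (cos (t * T))\<^sup>2 + (sin (t * T))\<^sup>2"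
      using u by (simp add: g_def inner_add inner_commute xx power2_eq_square)
    then show ?thesis by (simp add: norm_eq_sqrt_inner)
  qed
  have ng': "norm (vector_derivative g (at t)) = T" for t
  proof -
    have "g' t \<bullet> g' t = T\<^sup>2 * ((sin (t * T))\<^sup>2 + (cos (t * T))\<^sup>2)"
      using u by (simp add: g'_def inner_add inner_commute inner_diff xx power2_eq_square distrib_left mult_ac
          del: sin_cos_squared_add sin_cos_squared_add2 sin_cos_squared_add3)
    then have "norm (g' t) = T" using T by (simp add: norm_eq_sqrt_inner)
    then show ?thesis using vector_derivative_at[OF der[of t]] by simp
  qed
  have "continuous_on {0..1} g'"
    unfolding g'_def by (intro continuous_intros)
  then have "g C1_differentiable_on {0..1}"
    unfolding C1_differentiable_on_def using der by blast
  then have "valid_path g"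
    by (simp add: valid_path_def C1_differentiable_imp_piecewise)
  moreover have "path_image g \<subseteq> sphere 0 1"
    using ng by (auto simp: path_image_def)
  moreover have "pathstart g = x" "pathfinish g = y"
    using u by (auto simp: pathstart_def pathfinish_def g_def cosT)
  moreover have "((\<lambda>t. norm (vector_derivative g (at t))) has_integral T) {0..1}"
    using has_integral_const_real[of T 0 1] by (simp add: ng')
  ultimately show ?thesis unfolding T_def c_def by blast
qed

lemma geodesic_dist_eq_arccos:
  fixes x y :: "'a::euclidean_space"
  assumes "x \<in> sphere 0 1" "y \<in> sphere 0 1" "DIM('a) \<ge> 2"
  shows "geodesic_dist x y = arccos (x \<bullet> y)"
  unfolding geodesic_dist_def
proof (rule cInf_eq_minimum)
  show "arccos (x \<bullet> y) \<in> {L. \<exists>g. valid_path g \<and> path_image g \<subseteq> sphere 0 1 \<and>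
      pathstart g = x \<and> pathfinish g = y \<and>
      ((\<lambda>t. norm (vector_derivative g (at t))) has_integral L) {0..1}}"
    using great_circle_arc[of x y] assms by simp
qed (auto intro: arccos_le_curve_length)

section \<open>Smoothness\<close>

fun Ck_on :: "nat \<Rightarrow> 'a::real_normed_vector set \<Rightarrow> ('a \<Rightarrow> 'b::real_normed_vector) \<Rightarrow> bool" where
  "Ck_on 0 U f \<longleftrightarrow> continuous_on U f"
| "Ck_on (Suc k) U f \<longleftrightarrow> (\<forall>x\<in>U. f differentiable (at x)) \<and>
     (\<forall>v. Ck_on k U (\<lambda>x. frechet_derivative f (at x) v))"

text \<open>Smoothness on a subset of a Euclidean space by local smooth extensions.\<close>

definition smooth_fun_on :: "'a::real_normed_vector set \<Rightarrow> ('a \<Rightarrow> 'b::real_normed_vector) \<Rightarrow> bool" where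
  "smooth_fun_on S f \<longleftrightarrow> (\<forall>x\<in>S. \<exists>U g. open U \<and> x \<in> U \<and> (\<forall>k. Ck_on k U g) \<and>
     (\<forall>z\<in>S \<inter> U. g z = f z))"

definition smooth_vector_field :: "('a::euclidean_space \<Rightarrow> 'a) \<Rightarrow> bool" where
  "smooth_vector_field X \<longleftrightarrow> smooth_fun_on (sphere 0 1) X \<and> (\<forall>x\<in>sphere 0 1. X x \<bullet> x = 0)"

section \<open>Gradient, divergence and Laplace--Beltrami operator\<close>

text \<open>
  At a point \<open>x\<close> of the sphere, \<open>f \<circ> sgn\<close> has the differential of \<open>f\<close>
  on the tangent space and vanishing derivative in the normal direction \<open>x\<close>.
  So the Euclidean gradient of \<open>f \<circ> sgn\<close> at \<open>x\<close> is the Riemannian gradient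
  of \<open>f\<close>. Likewise the covariant derivative of \<open>X\<close> is the tangential part of
  the derivative of \<open>X \<circ> sgn\<close>, and its trace over the tangent space, the Riemannian
  divergence, is the Euclidean divergence of \<open>X \<circ> sgn\<close> at \<open>x\<close>.
\<close>

definition sphere_grad :: "('a::euclidean_space \<Rightarrow> real) \<Rightarrow> 'a \<Rightarrow> 'a" where
  "sphere_grad f x = (\<Sum>b\<in>Basis. frechet_derivative (f \<circ> sgn) (at x) b *\<^sub>R b)"

definition sphere_div :: "('a::euclidean_space \<Rightarrow> 'a) \<Rightarrow> 'a \<Rightarrow> real" where
  "sphere_div X x = (\<Sum>b\<in>Basis. frechet_derivative (X \<circ> sgn) (at x) b \<bullet> b)"

definition laplace_beltrami :: "('a::euclidean_space \<Rightarrow> real) \<Rightarrow> 'a \<Rightarrow> real" where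
  "laplace_beltrami f = sphere_div (sphere_grad f)"

section \<open>Perimeter\<close>

definition total_variation :: "('a::euclidean_space \<Rightarrow> real) \<Rightarrow> ereal" where
  "total_variation f =
     (SUP X \<in> {X. smooth_vector_field X \<and> (\<forall>x\<in>sphere 0 1. norm (X x) \<le> 1)}.
        ereal (LINT x|sphere_measure. f x * sphere_div X x))"

definition Per :: "'a::euclidean_space set \<Rightarrow> ereal" where
  "Per \<Omega> = total_variation (indicat_real \<Omega>)"

definition finite_perimeter :: "'a::euclidean_space set \<Rightarrow> bool" where
  "finite_perimeter \<Omega> \<longleftrightarrow> Per \<Omega> < \<infinity>"

section \<open>Helmholtz kernel and nonlocal energy\<close>

text \<open>
  The distributional equation determines \<open>K x y\<close>, for fixed \<open>y\<close>, up to null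
  sets of \<open>x\<close>; smoothness off the diagonal selects the representative. The values on
  the diagonal stay free, and nothing below depends on them.
\<close>

definition helmholtz_kernel :: "real \<Rightarrow> ('a::euclidean_space \<Rightarrow> 'a \<Rightarrow> real) \<Rightarrow> bool" where
  "helmholtz_kernel \<epsilon> K \<longleftrightarrow>
     smooth_fun_on {(x, y). x \<in> sphere 0 1 \<and> y \<in> sphere 0 1 \<and> x \<noteq> y} (\<lambda>(x, y). K x y) \<and>
     (\<forall>y\<in>sphere 0 1. integrable sphere_measure (\<lambda>x. K x y) \<and>
        (\<forall>\<phi>. smooth_fun_on (sphere 0 1) \<phi> \<longrightarrow>
           (LINT x|sphere_measure. K x y * (\<phi> x - \<epsilon>\<^sup>2 * laplace_beltrami \<phi> x)) = \<phi> y))"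

definition energy ::
  "real \<Rightarrow> real \<Rightarrow> ('a::euclidean_space \<Rightarrow> 'a \<Rightarrow> real) \<Rightarrow> 'a set \<Rightarrow> ereal" where
  "energy \<gamma> \<epsilon> K \<Omega> = Per \<Omega> -
     ereal (\<gamma> / \<epsilon> * (LINT (x, y)|(sphere_measure \<Otimes>\<^sub>M sphere_measure).
        K x y * \<bar>indicat_real \<Omega> x - indicat_real \<Omega> y\<bar>))"

definition k_const :: "nat \<Rightarrow> real" where
  "k_const n = 2 / (real n - 1) * (unit_sphere_area (n - 2) / unit_sphere_area (n - 1))"

definition gamma_eps :: "nat \<Rightarrow> real \<Rightarrow> ('a::euclidean_space \<Rightarrow> 'a \<Rightarrow> real) \<Rightarrow> 'a \<Rightarrow> real" where
  "gamma_eps n \<epsilon> K y =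
     1 / (k_const n * (LINT x|sphere_measure. geodesic_dist x y / \<epsilon> * K x y))"

definition gamma_crit :: "nat \<Rightarrow> (real \<Rightarrow> 'a::euclidean_space \<Rightarrow> 'a \<Rightarrow> real) \<Rightarrow> 'a \<Rightarrow> real" where
  "gamma_crit n K y = Lim (at_right 0) (\<lambda>\<epsilon>. gamma_eps n \<epsilon> (K \<epsilon>) y)"

definition limit_energy :: "real \<Rightarrow> real \<Rightarrow> 'a::euclidean_space set \<Rightarrow> ereal" where
  "limit_energy \<gamma> \<gamma>\<^sub>c \<Omega> =
     (if finite_perimeter \<Omega> then ereal (1 - \<gamma> / \<gamma>\<^sub>c) * Per \<Omega> else \<infinity>)"

section \<open>Gamma-convergence\<close>

definition L1_converges :: "(real \<Rightarrow> 'a::euclidean_space set) \<Rightarrow> 'a set \<Rightarrow> bool" where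
  "L1_converges W \<Omega> \<longleftrightarrow>
     ((\<lambda>\<epsilon>. measure sphere_measure (sym_diff \<Omega> (W \<epsilon>))) \<longlongrightarrow> 0) (at_right 0)"

definition Gamma_converges_L1 ::
  "(real \<Rightarrow> 'a::euclidean_space set \<Rightarrow> ereal) \<Rightarrow> ('a set \<Rightarrow> ereal) \<Rightarrow> bool" where
  "Gamma_converges_L1 F F0 \<longleftrightarrow>
     (\<forall>\<Omega>\<in>sets sphere_measure. \<forall>W.
        (\<forall>\<epsilon>>0. W \<epsilon> \<in> sets sphere_measure) \<and> L1_converges W \<Omega> \<longrightarrow>
        F0 \<Omega> \<le> Liminf (at_right 0) (\<lambda>\<epsilon>. F \<epsilon> (W \<epsilon>))) \<and>
     (\<forall>\<Omega>\<in>sets sphere_measure. \<exists>W.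
        (\<forall>\<epsilon>>0. W \<epsilon> \<in> sets sphere_measure) \<and> L1_converges W \<Omega> \<and>
        F0 \<Omega> \<ge> Limsup (at_right 0) (\<lambda>\<epsilon>. F \<epsilon> (W \<epsilon>)))"

end

theory Submission
  imports Defs "HOL-Computational_Algebra.Polynomial"
begin

text \<open>
  Let \<open>T f y = \<integral> K\<^sub>\<epsilon>(x, y) f x dx\<close>, the inverse of \<open>1 - \<epsilon>\<^sup>2 \<Delta>\<close>. For the characteristic function
  \<open>\<chi>\<close> of a set \<open>\<Omega>\<close> the nonlocal term is
  \<open>N\<^sub>\<epsilon>(\<Omega>) = (2 / \<epsilon>) \<integral> \<chi> (\<chi> - T \<chi>) = - 2 \<epsilon> \<integral> \<chi> \<Delta> T \<chi>\<close>.

  Upper bound: the solution \<open>u\<close> of \<open>u - \<epsilon>\<^sup>2 \<Delta> u = f\<close> with \<open>0 \<le> f \<le> 1\<close> satisfies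
  \<open>|\<nabla> u| \<le> 1 / (2 \<epsilon>)\<close> by a two-point maximum principle. So \<open>- 2 \<epsilon> \<nabla> u\<close> is an admissible
  vector field, and \<open>N\<^sub>\<epsilon>(\<Omega>) \<le> Per(\<Omega>)\<close> for every \<open>\<epsilon>\<close>.

  Lower bound: by the energy identity, \<open>N\<^sub>\<epsilon>(\<Omega>) = (2 / \<epsilon>) \<integral> (\<chi> - u)\<^sup>2 + \<epsilon>\<^sup>2 |\<nabla> u|\<^sup>2\<close>
  with \<open>u = T \<chi>\<close>. Since \<open>|\<chi> - u| \<ge> min u (1 - u)\<close>, the Modica--Mortola argument bounds the total
  variation of \<open>\<Phi>(u)\<close> by \<open>N\<^sub>\<epsilon>(\<Omega>)\<close>, where \<open>\<Phi>' s = 4 min s (1 - s)\<close>. Moreover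
  \<open>\<integral> |\<chi> - u| = \<epsilon> N\<^sub>\<epsilon>(\<Omega>) \<le> \<epsilon> Per(\<Omega>)\<close>, so \<open>\<Phi>(u)\<close> tends to \<open>\<chi>\<close>, and
  \<open>N\<^sub>\<epsilon>(\<Omega>)\<close> tends to \<open>Per(\<Omega>)\<close> if the perimeter is finite.

  Testing the equation for \<open>K\<^sub>\<epsilon>\<close> with \<open>|s| + \<epsilon> exp (- |s| / \<epsilon>)\<close>, where \<open>s = e \<bullet> x\<close> and
  \<open>e\<close> is orthogonal to the pole, and averaging over \<open>e\<close> gives \<open>\<gamma>\<^sub>c\<^sub>r\<^sub>i\<^sub>t = 1\<close>. The upper bound
  with the lower semicontinuity of the perimeter now yields the liminf inequality, and the constant sequence is a
  recovery sequence. All equations are solved within sums of zonal polynomials, which are dense, and on which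
  \<open>1 - \<epsilon>\<^sup>2 \<Delta>\<close> is triangular.
\<close>

section \<open>Rotation invariance\<close>

text \<open>Both bounds are sharp on one and the same profile, which fixes the constants. Across a
  flat interface the kernel integrates to exp (- |s| / eps) / (2 eps). The smoothed indicator u of
  {s > 0} is exp (s / eps) / 2 for s < 0 and 1 - exp (- s / eps) / 2 for s > 0. Its slope at the
  interface is 1 / (2 eps), the gradient bound. It satisfies |chi - u| = min u (1 - u) = eps |u'|,
  which is equality in the Modica--Mortola step. The nonlocal term is 1 per unit area, hence the
  critical constant 1. The obstacle is that the kernel is known only through its effect on smooth
  test functions. Its sign and mass, and gradient bounds for \<open>T f\<close>, are read off by
  testing with functions u for which f = u - eps^2 Delta u is explicit. Zonal sums provide enough of
  them, because the equation is solved among them by algebra for a dense class of f. Indicators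
  enter only in the limit, by dominated convergence against the integrable kernel.\<close>

lemma nn_integral_lborel_translate:
  fixes f :: "'a::euclidean_space \<Rightarrow> ennreal"
  assumes [measurable]: "f \<in> borel_measurable borel"
  shows "(\<integral>\<^sup>+x. f (c + x) \<partial>lborel) = (\<integral>\<^sup>+x. f x \<partial>lborel)"
proof -
  have "(\<integral>\<^sup>+x. f x \<partial>lborel) = (\<integral>\<^sup>+x. f x \<partial>distr lborel borel ((+) c))"
    by (simp add: lborel_distr_plus)
  also have "\<dots> = (\<integral>\<^sup>+x. f (c + x) \<partial>lborel)"
    by (subst nn_integral_distr) simp_all
  finally show ?thesis ..
qed

text \<open>
  The push-forward \<open>\<nu>\<close> of Lebesgue measure \<open>\<mu>\<close> under \<open>T\<close> is translation
  invariant and agrees with \<open>\<mu>\<close> on balls. Evaluating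
  \<open>\<mu> A * \<nu> B = \<integral>\<integral> 1_A (x + y) 1_B y d\<mu> d\<nu>\<close> for a ball \<open>B\<close> in
  both orders gives \<open>\<mu> A * \<nu> B = \<nu> A * \<mu> B\<close>.
\<close>

lemma lborel_distr_orthogonal:
  fixes T :: "'a::euclidean_space \<Rightarrow> 'a"
  assumes T: "orthogonal_transformation T"
  shows "distr lborel borel T = lborel"
proof (rule measure_eqI)
  fix A :: "'a set" assume "A \<in> sets (distr lborel borel T)"
  then have A[measurable]: "A \<in> sets borel" by simp
  have T_lin: "linear T" and T_norm: "\<And>x. norm (T x) = norm x"
    using T by (auto simp: orthogonal_transformation)
  have T_meas[measurable]: "T \<in> borel_measurable borel"
    using T_lin by (intro borel_measurable_continuous_onI linear_continuous_on linear_conv_bounded_linear[THEN iffD1])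
  \<comment> \<open>A right inverse of \<open>T\<close> turns a translation in the image into a
    translation of the argument, so the push-forward inherits translation invariance.\<close>
  obtain S where S: "\<And>x. T (S x) = x"
    using orthogonal_transformation_surj[OF T] by (metis surj_f_inv_f)
  define B where "B = cball (0::'a) 1"
  have B[measurable]: "B \<in> sets borel" by (simp add: B_def)
  define \<nu> where "\<nu> = distr lborel borel T"
  have sets_\<nu>[measurable_cong]: "sets \<nu> = sets borel" by (simp add: \<nu>_def)
  have \<nu>_trans: "(\<integral>\<^sup>+y. f (x + y) \<partial>\<nu>) = (\<integral>\<^sup>+y. f y \<partial>\<nu>)"
    if [measurable]: "f \<in> borel_measurable borel" for f :: "'a \<Rightarrow> ennreal" and x
  proof -
    have "(\<integral>\<^sup>+y. f (x + y) \<partial>\<nu>) = (\<integral>\<^sup>+y. f (T (S x + y)) \<partial>lborel)"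
      unfolding \<nu>_def by (subst nn_integral_distr) (simp_all add: linear_add[OF T_lin] S)
    also have "\<dots> = (\<integral>\<^sup>+y. f (T y) \<partial>lborel)"
      by (rule nn_integral_lborel_translate) simp
    also have "\<dots> = (\<integral>\<^sup>+y. f y \<partial>\<nu>)"
      unfolding \<nu>_def by (subst nn_integral_distr) simp_all
    finally show ?thesis .
  qed
  have \<nu>B: "emeasure \<nu> B = emeasure lborel B"
  proof -
    have "T -` B = B" by (auto simp: B_def T_norm)
    then show ?thesis by (simp add: \<nu>_def emeasure_distr)
  qed
  have "sigma_finite_measure \<nu>"
  proof
    show "\<exists>F. countable F \<and> F \<subseteq> sets \<nu> \<and> \<Union>F = space \<nu> \<and> (\<forall>a\<in>F. emeasure \<nu> a \<noteq> \<infinity>)"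
    proof (intro exI[of _ "range (\<lambda>n::nat. cball (0::'a) (real n))"] conjI ballI)
      show "\<Union>(range (\<lambda>n::nat. cball (0::'a) (real n))) = space \<nu>"
        by (auto simp: \<nu>_def real_arch_simple)
      fix a assume "a \<in> range (\<lambda>n::nat. cball (0::'a) (real n))"
      then obtain n :: nat where a: "a = cball 0 (real n)" by auto
      have "T -` a = a" by (auto simp: a T_norm)
      then have "emeasure \<nu> a = emeasure lborel a"
        by (simp add: \<nu>_def emeasure_distr a)
      then show "emeasure \<nu> a \<noteq> \<infinity>"
        using emeasure_lborel_cball_finite[of "0::'a" "real n"] by (simp add: a)
    qed (auto simp: sets_\<nu>)
  qed
  then interpret \<nu>: sigma_finite_measure \<nu> .
  interpret L: sigma_finite_measure "lborel :: 'a measure" by (rule sigma_finite_lborel)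
  interpret P: pair_sigma_finite "lborel :: 'a measure" \<nu> ..
  have "emeasure lborel A * emeasure \<nu> B = (\<integral>\<^sup>+y. (\<integral>\<^sup>+x. indicator A x * indicator B y \<partial>lborel) \<partial>\<nu>)"
    by (simp add: nn_integral_multc nn_integral_cmult)
  also have "\<dots> = (\<integral>\<^sup>+y. (\<integral>\<^sup>+x. indicator A (y + x) * indicator B y \<partial>lborel) \<partial>\<nu>)"
  proof (rule nn_integral_cong)
    fix y
    show "(\<integral>\<^sup>+x. indicator A x * indicator B y \<partial>lborel) = (\<integral>\<^sup>+x. indicator A (y + x) * indicator B y \<partial>lborel)"
      by (rule nn_integral_lborel_translate[symmetric]) simp
  qed
  also have "\<dots> = (\<integral>\<^sup>+x. (\<integral>\<^sup>+y. indicator A (y + x) * indicator B y \<partial>\<nu>) \<partial>lborel)"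
    by (rule P.Fubini') simp
  also have "\<dots> = (\<integral>\<^sup>+x. (\<integral>\<^sup>+y. indicator A y * indicator B (y - x) \<partial>\<nu>) \<partial>lborel)"
  proof (rule nn_integral_cong)
    fix x
    show "(\<integral>\<^sup>+y. indicator A (y + x) * indicator B y \<partial>\<nu>) = (\<integral>\<^sup>+y. indicator A y * indicator B (y - x) \<partial>\<nu>)"
      using \<nu>_trans[of "\<lambda>y. indicator A y * indicator B (y - x)" x] by (simp add: add.commute)
  qed
  also have "\<dots> = (\<integral>\<^sup>+y. (\<integral>\<^sup>+x. indicator A y * indicator B (y - x) \<partial>lborel) \<partial>\<nu>)"
    by (rule P.Fubini'[symmetric]) simp
  also have "\<dots> = (\<integral>\<^sup>+y. indicator A y * emeasure lborel B \<partial>\<nu>)"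
  proof (rule nn_integral_cong)
    fix y
    \<comment> \<open>The ball is symmetric about 0, so its reflected translate is again a
      translate.\<close>
    have "(\<integral>\<^sup>+x. indicator B (y - x) \<partial>lborel) = (\<integral>\<^sup>+x. indicator B (- y + x) \<partial>lborel)"
      by (intro nn_integral_cong) (auto simp: B_def indicator_def norm_minus_commute)
    also have "\<dots> = (\<integral>\<^sup>+x. indicator B x \<partial>lborel)"
      by (rule nn_integral_lborel_translate) simp
    finally show "(\<integral>\<^sup>+x. indicator A y * indicator B (y - x) \<partial>lborel) = indicator A y * emeasure lborel B"
      by (simp add: nn_integral_cmult)
  qed
  also have "\<dots> = emeasure \<nu> A * emeasure lborel B"
    by (simp add: nn_integral_multc)
  finally have "emeasure lborel A * emeasure lborel B = emeasure \<nu> A * emeasure lborel B"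
    by (simp add: \<nu>B)
  moreover have "emeasure lborel B \<noteq> 0" "emeasure lborel B \<noteq> \<infinity>"
    using emeasure_lborel_cball_finite[of "0::'a" 1] by (auto simp: B_def emeasure_cball unit_ball_vol_pos less_imp_neq[symmetric])
  ultimately show "emeasure (distr lborel borel T) A = emeasure lborel A"
    by (simp add: \<nu>_def[symmetric] mult.commute[of _ "emeasure lborel B"] ennreal_mult_cancel_left)
qed simp

section \<open>Integrals over the sphere\<close>

lemma sphere_measure_borel:
  fixes f :: "'a::euclidean_space \<Rightarrow> 'b::topological_space"
  assumes "f \<in> borel_measurable borel"
  shows "f \<in> borel_measurable sphere_measure"
proof -
  have "f \<in> borel_measurable (restrict_space borel (sphere 0 1))"
    using assms by (rule measurable_restrict_space1)
  then show ?thesis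
    unfolding sphere_measure_def by (intro measurable_completion) (simp cong: measurable_cong_sets)
qed

lemma finite_measure_sphere: "finite_measure (sphere_measure :: 'a::euclidean_space measure)"
proof
  have "emeasure sphere_measure (sphere (0::'a) 1) = of_nat DIM('a) * emeasure lborel {z \<in> ball 0 1 - {0}. sgn z \<in> sphere (0::'a) 1}"
    by (rule emeasure_sphere_measure) auto
  also have "\<dots> \<le> of_nat DIM('a) * emeasure lborel (ball (0::'a) 1)"
    by (intro mult_left_mono emeasure_mono) auto
  also have "\<dots> < \<infinity>"
    using emeasure_lborel_ball_finite[of "0::'a" 1] by (auto simp: ennreal_mult_less_top of_nat_less_top)
  finally show "emeasure sphere_measure (space (sphere_measure :: 'a measure)) \<noteq> \<infinity>"
    by simp
qed

lemma integral_sphere_measure: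
  fixes f :: "'a::euclidean_space \<Rightarrow> real"
  assumes f: "f \<in> borel_measurable borel"
  shows "(LINT x|sphere_measure. f x) = DIM('a) * (LINT z|lborel. indicator (ball 0 1 - {0}) z * f (sgn z))"
proof -
  let ?B = "ball (0::'a) 1 - {0}"
  let ?D = "distr (restrict_space lborel ?B) (restrict_space borel (sphere 0 1)) sgn"
  have f': "f \<in> borel_measurable ?D"
    using f by (simp add: measurable_restrict_space1 cong: measurable_cong_sets)
  have "(LINT x|sphere_measure. f x) = (LINT x|scale_measure (of_nat DIM('a)) ?D. f x)"
    unfolding sphere_measure_def using f' by (intro integral_completion) simp
  also have "scale_measure (of_nat DIM('a)) ?D = density ?D (\<lambda>_. ennreal (real DIM('a)))"
    by (rule measure_eqI) (auto simp: emeasure_density_const ennreal_of_nat_eq_real_of_nat)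
  also have "(LINT x|density ?D (\<lambda>_. ennreal (real DIM('a))). f x) = (LINT x|?D. DIM('a) * f x)"
    using f' by (subst integral_real_density) auto
  also have "\<dots> = DIM('a) * (LINT x|?D. f x)" by simp
  also have "(LINT x|?D. f x) = (LINT z|restrict_space lborel ?B. f (sgn z))"
    using f' by (intro integral_distr measurable_sgn_sphere) simp
  also have "\<dots> = (LINT z|lborel. indicator ?B z * f (sgn z))"
    by (subst integral_restrict_space) auto
  finally show ?thesis .
qed


lemma integrable_sphere_continuous:
  fixes f :: "'a::euclidean_space \<Rightarrow> real"
  assumes "continuous_on (sphere 0 1) f"
  shows "f \<in> borel_measurable sphere_measure" "integrable sphere_measure f"
proof -
  interpret finite_measure "sphere_measure :: 'a measure" by (rule finite_measure_sphere)
  have "(\<lambda>x. indicator (sphere 0 1) x *\<^sub>R f x) \<in> borel_measurable borel"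
    using assms by (intro borel_measurable_continuous_on_indicator) auto
  then have "(\<lambda>x. indicator (sphere 0 1) x *\<^sub>R f x) \<in> borel_measurable sphere_measure"
    by (rule sphere_measure_borel)
  then show m: "f \<in> borel_measurable sphere_measure"
    by (subst (asm) measurable_cong[of _ _ f]) auto
  have "compact (f ` sphere 0 1)"
    using assms by (intro compact_continuous_image) auto
  then obtain B where "\<And>x. x \<in> sphere 0 1 \<Longrightarrow> norm (f x) \<le> B"
    by (meson bounded_iff compact_imp_bounded imageI)
  then show "integrable sphere_measure f"
    using m by (intro integrable_const_bound[of _ B]) auto
qed

text \<open>In polar coordinates \<open>sgn\<close> commutes with \<open>T\<close>, so the
  invariance of Lebesgue measure carries over.\<close>

lemma integral_sphere_orthogonal:
  fixes f :: "'a::euclidean_space \<Rightarrow> real" and T :: "'a \<Rightarrow> 'a"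
  assumes T: "orthogonal_transformation T" and f: "continuous_on (sphere 0 1) f"
  shows "(LINT x|sphere_measure. f (T x)) = (LINT x|sphere_measure. f x)"
proof -
  have lin: "linear T" and nT: "\<And>x. norm (T x) = norm x"
    using T by (auto simp: orthogonal_transformation)
  \<comment> \<open>Extension by zero gives a Borel function on the whole space, as the passage to
    Lebesgue measure requires.\<close>
  define g where "g x = indicator (sphere 0 1) x *\<^sub>R f x" for x
  have g[measurable]: "g \<in> borel_measurable borel"
    unfolding g_def using f by (intro borel_measurable_continuous_on_indicator) auto
  have T_meas[measurable]: "T \<in> borel_measurable borel"
    using lin by (intro borel_measurable_continuous_onI linear_continuous_on linear_conv_bounded_linear[THEN iffD1])
  have [measurable]: "ball 0 1 - {0::'a} \<in> sets borel" by auto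
  have [measurable]: "(sgn :: 'a \<Rightarrow> 'a) \<in> borel_measurable borel"
    unfolding sgn_div_norm[abs_def] by measurable
  have eq: "(LINT x|sphere_measure. f (S x)) = (LINT x|sphere_measure. g (S x))"
    if "\<And>x. norm (S x) = norm x" for S
    using that by (intro Bochner_Integration.integral_cong) (auto simp: g_def)
  let ?h = "\<lambda>z. indicator (ball 0 1 - {0}) z * g (sgn z)"
  have sgnT: "sgn (T z) = T (sgn z)" for z
    by (simp add: sgn_div_norm nT linear_scale[OF lin])
  have "(LINT x|sphere_measure. g (T x)) = DIM('a) * (LINT z|lborel. indicator (ball 0 1 - {0}) z * g (T (sgn z)))"
    using integral_sphere_measure[of "\<lambda>x. g (T x)"] by simp
  also have "(LINT z|lborel. indicator (ball 0 1 - {0}) z * g (T (sgn z))) = (LINT z|lborel. ?h (T z))"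
  proof (rule Bochner_Integration.integral_cong)
    fix z
    have "T z = 0 \<longleftrightarrow> z = 0" using nT[of z] by (metis norm_eq_zero)
    then show "indicator (ball 0 1 - {0}) z * g (T (sgn z)) = ?h (T z)"
      by (simp add: sgnT indicator_def nT)
  qed simp
  also have "\<dots> = (LINT z|distr lborel borel T. ?h z)"
    by (subst integral_distr) simp_all
  also have "\<dots> = (LINT z|lborel. ?h z)"
    by (simp add: lborel_distr_orthogonal[OF T])
  also have "DIM('a) * \<dots> = (LINT x|sphere_measure. g x)"
    by (rule integral_sphere_measure[symmetric]) simp
  finally show ?thesis using eq[of T] eq[of "\<lambda>x. x"] nT by simp
qed

text \<open>The cone over a point is part of a ray, which lies in a hyperplane; dimension 2 supplies
  a normal vector. This is what makes the diagonal values of a kernel irrelevant.\<close>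

lemma emeasure_sphere_singleton:
  fixes p :: "'a::euclidean_space"
  assumes "DIM('a) \<ge> 2" "p \<in> sphere 0 1"
  shows "emeasure sphere_measure {p} = 0"
proof -
  obtain v where v: "v \<noteq> 0" "orthogonal p v"
    using orthogonal_to_vector_exists[OF assms(1)] by blast
  have "negligible {z. v \<bullet> z = 0}" using v by (intro negligible_hyperplane) simp
  then have "emeasure lborel {z. v \<bullet> z = 0} = 0"
    by (simp add: negligible_iff_null_sets null_sets_completion_iff null_sets_def)
  moreover have "{z \<in> ball 0 1 - {0}. sgn z \<in> {p}} \<subseteq> {z. v \<bullet> z = 0}"
  proof (rule subsetI)
    fix z assume "z \<in> {z \<in> ball 0 1 - {0}. sgn z \<in> {p}}"
    then have "z \<noteq> 0" "p = sgn z" by auto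
    then have "v \<bullet> z = norm z * (v \<bullet> p)" by (simp add: sgn_div_norm)
    then show "z \<in> {z. v \<bullet> z = 0}"
      using v by (simp add: orthogonal_def inner_commute)
  qed
  ultimately have "emeasure lborel {z \<in> ball 0 1 - {0}. sgn z \<in> {p}} = 0"
    using emeasure_mono[of "{z \<in> ball 0 1 - {0}. sgn z \<in> {p}}" "{z. v \<bullet> z = 0}" lborel] by simp
  then show ?thesis
    using assms by (subst emeasure_sphere_measure) auto
qed

section \<open>Divergence theorem\<close>

lemma has_derivative_sgn:
  fixes z :: "'a::euclidean_space"
  assumes "z \<noteq> 0"
  shows "(sgn has_derivative (\<lambda>v. (v - (sgn z \<bullet> v) *\<^sub>R sgn z) /\<^sub>R norm z)) (at z)"
proof -
  have "((\<lambda>z. inverse (norm z) *\<^sub>R z) has_derivative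
      (\<lambda>v. inverse (norm z) *\<^sub>R v + (- (inverse (norm z) * (v \<bullet> sgn z) * inverse (norm z))) *\<^sub>R z)) (at z)"
    using has_derivative_scaleR[OF Deriv.has_derivative_inverse[OF _ has_derivative_norm[OF assms]] has_derivative_ident] assms
    by simp
  moreover have "inverse (norm z) *\<^sub>R v + (- (inverse (norm z) * (v \<bullet> sgn z) * inverse (norm z))) *\<^sub>R z
      = (v - (sgn z \<bullet> v) *\<^sub>R sgn z) /\<^sub>R norm z" for v
    by (simp add: sgn_div_norm scaleR_diff_right inner_commute mult_ac)
  ultimately have "((\<lambda>z. z /\<^sub>R norm z) has_derivative (\<lambda>v. (v - (sgn z \<bullet> v) *\<^sub>R sgn z) /\<^sub>R norm z)) (at z)"
    by simp
  then show ?thesis by (simp add: sgn_div_norm[abs_def])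
qed

text \<open>Differentiate the integral of \<open>f (R t x)\<close>, which does not depend on \<open>t\<close>, at \<open>t = 0\<close>.\<close>

lemma integral_rotational_derivative:
  fixes f :: "'a::euclidean_space \<Rightarrow> real" and A :: "'a \<Rightarrow> 'a" and R :: "real \<Rightarrow> 'a \<Rightarrow> 'a"
  assumes R: "\<And>t. orthogonal_transformation (R t)" "\<And>x. R 0 x = x"
    and dR: "\<And>x t. ((\<lambda>t. R t x) has_vector_derivative A (R t x)) (at t)"
    and f: "\<And>x. x \<in> sphere 0 1 \<Longrightarrow> (f has_derivative f' x) (at x)"
    and cont: "continuous_on (sphere 0 1) (\<lambda>x. f' x (A x))"
  shows "(LINT x|sphere_measure. f' x (A x)) = 0"
proof -
  interpret finite_measure "sphere_measure :: 'a measure" by (rule finite_measure_sphere)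
  have nR: "norm (R t x) = norm x" for t x
    using R by (auto simp: orthogonal_transformation)
  have cf: "continuous_on (sphere 0 1) f"
    using f has_derivative_continuous by (meson continuous_at_imp_continuous_on)
  have "compact ((\<lambda>x. f' x (A x)) ` sphere 0 1)"
    using cont by (intro compact_continuous_image) auto
  then obtain B where B: "\<And>x. x \<in> sphere 0 1 \<Longrightarrow> \<bar>f' x (A x)\<bar> \<le> B"
    by (metis (no_types, lifting) bounded_iff compact_imp_bounded imageI real_norm_def)
  have der: "((\<lambda>t. f (R t x)) has_real_derivative f' (R t x) (A (R t x))) (at t)"
    if "x \<in> sphere 0 1" for x t
  proof -
    have "((\<lambda>t. f (R t x)) has_derivative (\<lambda>h. f' (R t x) (h *\<^sub>R A (R t x)))) (at t)"
      using has_derivative_compose[OF dR[of x t, unfolded has_vector_derivative_def] f[of "R t x"]] that nR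
      by simp
    moreover have "f' (R t x) (h *\<^sub>R A (R t x)) = f' (R t x) (A (R t x)) * h" for h
      using has_derivative_linear[OF f[of "R t x"]] that nR by (simp add: linear_scale)
    ultimately show ?thesis by (simp add: has_field_derivative_def)
  qed
  define s where "s k = inverse (real (Suc k))" for k
  have s: "s k > 0" for k by (simp add: s_def)
  have s0: "s \<longlonglongrightarrow> 0" unfolding s_def by (rule LIMSEQ_inverse_real_of_nat)
  define h where "h k x = (f (R (s k) x) - f x) / s k" for k x
  have cR: "continuous_on (sphere 0 1) (\<lambda>x. f (R t x))" for t
  proof (rule continuous_on_compose2[OF cf])
    show "continuous_on (sphere 0 1) (R t)"
      using R(1)[of t] by (intro linear_continuous_on linear_conv_bounded_linear[THEN iffD1]) (auto simp: orthogonal_transformation)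
  qed (use nR in auto)
  have "(\<lambda>k. LINT x|sphere_measure. h k x) \<longlonglongrightarrow> (LINT x|sphere_measure. f' x (A x))"
  proof (rule integral_dominated_convergence[where w="\<lambda>_. B"])
    show "(\<lambda>x. f' x (A x)) \<in> borel_measurable sphere_measure"
      by (rule integrable_sphere_continuous[OF cont])
    show "h k \<in> borel_measurable sphere_measure" for k
      unfolding h_def by (intro integrable_sphere_continuous continuous_intros cR cf) (use s in \<open>auto simp: less_imp_neq[symmetric]\<close>)
    show "AE x in sphere_measure. (\<lambda>k. h k x) \<longlonglongrightarrow> f' x (A x)"
    proof (rule AE_I2)
      fix x :: 'a assume "x \<in> space sphere_measure"
      then have "((\<lambda>t. f (R t x)) has_real_derivative f' x (A x)) (at 0)"
        using der[of x 0] R(2) by simp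
      then have "((\<lambda>t. (f (R t x) - f x) / t) \<longlongrightarrow> f' x (A x)) (at 0)"
        by (simp add: DERIV_def R(2))
      then show "(\<lambda>k. h k x) \<longlonglongrightarrow> f' x (A x)"
        unfolding h_def
        by (rule filterlim_compose) (use s0 s in \<open>auto simp: filterlim_at less_imp_neq[symmetric]\<close>)
    qed
    \<comment> \<open>By the mean value theorem each difference quotient is a value of the
      derivative at a rotated point, so one constant dominates them all.\<close>
    show "AE x in sphere_measure. norm (h k x) \<le> B" for k
    proof (rule AE_I2)
      fix x :: 'a assume x: "x \<in> space sphere_measure"
      then obtain t where "f (R (s k) x) - f (R 0 x) = (s k - 0) * f' (R t x) (A (R t x))"
        using MVT2[of 0 "s k" "\<lambda>t. f (R t x)" "\<lambda>t. f' (R t x) (A (R t x))"] der s by auto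
      then have "h k x = f' (R t x) (A (R t x))"
        using s[of k] by (simp add: h_def R(2))
      then show "norm (h k x) \<le> B"
        using B[of "R t x"] x nR by simp
    qed
  qed simp
  moreover have "(LINT x|sphere_measure. h k x) = 0" for k
  proof -
    have "(LINT x|sphere_measure. h k x) = ((LINT x|sphere_measure. f (R (s k) x)) - (LINT x|sphere_measure. f x)) / s k"
      unfolding h_def using cR cf by (simp add: integrable_sphere_continuous)
    then show ?thesis using integral_sphere_orthogonal[OF R(1) cf] by simp
  qed
  ultimately show ?thesis by (simp add: LIMSEQ_const_iff)
qed

text \<open>Stated for \<open>f \<circ> sgn\<close>, the extension that \<open>sphere_grad\<close>
  and \<open>sphere_div\<close> differentiate, and with continuity only along the sphere, where the
  integrands live.\<close>

definition C1_sphere :: "('a::euclidean_space \<Rightarrow> 'b::real_normed_vector) \<Rightarrow> bool" where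
  "C1_sphere f \<longleftrightarrow> (\<forall>x\<in>sphere 0 1. (f \<circ> sgn) differentiable (at x)) \<and>
     (\<forall>v. continuous_on (sphere 0 1) (\<lambda>x. frechet_derivative (f \<circ> sgn) (at x) v))"

lemma C1_sphereI:
  assumes "\<And>x. x \<in> sphere 0 1 \<Longrightarrow> ((f \<circ> sgn) has_derivative f' x) (at x)"
    and "\<And>v. continuous_on (sphere 0 1) (\<lambda>x. f' x v)"
  shows "C1_sphere f"
  unfolding C1_sphere_def
proof (intro conjI ballI allI)
  fix v
  have "frechet_derivative (f \<circ> sgn) (at x) = f' x" if "x \<in> sphere 0 1" for x
    using frechet_derivative_at[OF assms(1)[OF that]] by simp
  then show "continuous_on (sphere 0 1) (\<lambda>x. frechet_derivative (f \<circ> sgn) (at x) v)"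
    using assms(2)[of v] by (subst continuous_on_cong[OF refl, of _ _ "\<lambda>x. f' x v"]) auto
qed (use assms(1) in \<open>auto simp: differentiable_def\<close>)

lemma C1_sphere_has_derivative:
  "C1_sphere f \<Longrightarrow> x \<in> sphere 0 1 \<Longrightarrow> ((f \<circ> sgn) has_derivative frechet_derivative (f \<circ> sgn) (at x)) (at x)"
  by (simp add: C1_sphere_def frechet_derivative_works)

lemma C1_sphere_continuous:
  assumes "C1_sphere f"
  shows "continuous_on (sphere 0 1) f"
proof -
  have "continuous_on (sphere 0 1) (f \<circ> sgn)"
    using C1_sphere_has_derivative[OF assms] has_derivative_continuous
    by (meson continuous_at_imp_continuous_on)
  then show ?thesis
    by (subst (asm) continuous_on_cong[OF refl, of _ _ f]) (auto simp: sgn_div_norm)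
qed

lemma sphere_div_continuous:
  "C1_sphere X \<Longrightarrow> continuous_on (sphere 0 1) (sphere_div X)"
  unfolding sphere_div_def[abs_def] C1_sphere_def by (intro continuous_intros) auto

lemma sphere_grad_inner:
  assumes "C1_sphere f" "x \<in> sphere 0 1"
  shows "sphere_grad f x \<bullet> v = frechet_derivative (f \<circ> sgn) (at x) v"
proof -
  let ?D = "frechet_derivative (f \<circ> sgn) (at x)"
  have lin: "linear ?D"
    using C1_sphere_has_derivative[OF assms] by (rule has_derivative_linear)
  have "?D v = ?D (\<Sum>b\<in>Basis. (v \<bullet> b) *\<^sub>R b)" by (simp add: euclidean_representation)
  also have "\<dots> = sphere_grad f x \<bullet> v"
    by (simp add: sphere_grad_def linear_sum[OF lin] linear_scale[OF lin] inner_sum_left inner_commute[of v] mult.commute)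
  finally show ?thesis ..
qed

lemma sphere_grad_continuous:
  "C1_sphere f \<Longrightarrow> continuous_on (sphere 0 1) (sphere_grad f)"
  unfolding sphere_grad_def[abs_def] C1_sphere_def by (intro continuous_intros) auto

lemma sphere_div_scaleR:
  fixes g :: "'a::euclidean_space \<Rightarrow> real" and X :: "'a \<Rightarrow> 'a"
  assumes g: "C1_sphere g" and X: "C1_sphere X"
  shows "C1_sphere (\<lambda>x. g x *\<^sub>R X x)"
    and "x \<in> sphere 0 1 \<Longrightarrow> sphere_div (\<lambda>x. g x *\<^sub>R X x) x = g x * sphere_div X x + sphere_grad g x \<bullet> X x"
proof -
  let ?Dg = "\<lambda>x. frechet_derivative (g \<circ> sgn) (at x)" and ?DX = "\<lambda>x. frechet_derivative (X \<circ> sgn) (at x)"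
  have der: "(((\<lambda>x. g x *\<^sub>R X x) \<circ> sgn) has_derivative (\<lambda>v. g x *\<^sub>R ?DX x v + ?Dg x v *\<^sub>R X x)) (at x)"
    if x: "x \<in> sphere 0 1" for x
  proof -
    have "sgn x = x" using x by (simp add: sgn_div_norm)
    with has_derivative_scaleR[OF C1_sphere_has_derivative[OF g x] C1_sphere_has_derivative[OF X x]]
    show ?thesis by (simp add: o_def)
  qed
  show "C1_sphere (\<lambda>x. g x *\<^sub>R X x)"
  proof (rule C1_sphereI[OF der])
    fix v
    have "continuous_on (sphere 0 1) (\<lambda>x. ?DX x v)" "continuous_on (sphere 0 1) (\<lambda>x. ?Dg x v)"
      using g X by (auto simp: C1_sphere_def)
    then show "continuous_on (sphere 0 1) (\<lambda>x. g x *\<^sub>R ?DX x v + ?Dg x v *\<^sub>R X x)"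
      by (intro continuous_on_add continuous_on_scaleR C1_sphere_continuous[OF g] C1_sphere_continuous[OF X])
  qed
  assume x: "x \<in> sphere 0 1"
  have eq: "frechet_derivative ((\<lambda>x. g x *\<^sub>R X x) \<circ> sgn) (at x) = (\<lambda>v. g x *\<^sub>R ?DX x v + ?Dg x v *\<^sub>R X x)"
    using frechet_derivative_at[OF der[OF x]] by simp
  have "(\<Sum>b\<in>Basis. ?Dg x b * (X x \<bullet> b)) = sphere_grad g x \<bullet> X x"
    by (simp add: sphere_grad_def inner_sum_left inner_commute[of "X x"])
  then show "sphere_div (\<lambda>x. g x *\<^sub>R X x) x = g x * sphere_div X x + sphere_grad g x \<bullet> X x"
    by (simp add: sphere_div_def eq inner_add_left sum.distrib sum_distrib_left)
qed

definition plane_rotation :: "'a::euclidean_space \<Rightarrow> 'a \<Rightarrow> real \<Rightarrow> 'a \<Rightarrow> 'a" where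
  "plane_rotation i j t x = x + ((cos t - 1) * (x \<bullet> i) - sin t * (x \<bullet> j)) *\<^sub>R i
     + ((cos t - 1) * (x \<bullet> j) + sin t * (x \<bullet> i)) *\<^sub>R j"

lemma plane_rotation:
  assumes ij: "i \<in> Basis" "j \<in> Basis" "i \<noteq> j"
  shows "orthogonal_transformation (plane_rotation i j t)"
    and "((\<lambda>t. plane_rotation i j t x) has_vector_derivative
           (plane_rotation i j t x \<bullet> i) *\<^sub>R j - (plane_rotation i j t x \<bullet> j) *\<^sub>R i) (at t)"
proof -
  have b: "i \<bullet> i = 1" "j \<bullet> j = 1" "i \<bullet> j = 0" "j \<bullet> i = 0"
    using ij by (auto simp: inner_Basis)
  have lin: "linear (plane_rotation i j t)"
    by (rule linearI) (simp_all add: plane_rotation_def inner_add_left algebra_simps)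
  moreover have "plane_rotation i j t x \<bullet> plane_rotation i j t y = x \<bullet> y" for x y
  proof -
    have "plane_rotation i j t x \<bullet> plane_rotation i j t y = x \<bullet> y
        + (cos t * (x \<bullet> i) - sin t * (x \<bullet> j)) * (cos t * (y \<bullet> i) - sin t * (y \<bullet> j))
        + (cos t * (x \<bullet> j) + sin t * (x \<bullet> i)) * (cos t * (y \<bullet> j) + sin t * (y \<bullet> i))
        - (x \<bullet> i) * (y \<bullet> i) - (x \<bullet> j) * (y \<bullet> j)"
      by (simp add: plane_rotation_def inner_add_left inner_add_right b inner_commute[of i y] inner_commute[of j y] algebra_simps)
    also have "\<dots> = x \<bullet> y + ((cos t)\<^sup>2 + (sin t)\<^sup>2 - 1) * ((x \<bullet> i) * (y \<bullet> i) + (x \<bullet> j) * (y \<bullet> j))"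
      by (simp add: algebra_simps power2_eq_square del: sin_cos_squared_add sin_cos_squared_add2 sin_cos_squared_add3)
    finally show ?thesis by simp
  qed
  ultimately show "orthogonal_transformation (plane_rotation i j t)"
    by (simp add: orthogonal_transformation_def)
  have "((\<lambda>t. plane_rotation i j t x) has_vector_derivative
       (- sin t * (x \<bullet> i) - cos t * (x \<bullet> j)) *\<^sub>R i + (- sin t * (x \<bullet> j) + cos t * (x \<bullet> i)) *\<^sub>R j) (at t)"
    unfolding plane_rotation_def
    by (auto intro!: derivative_eq_intros simp: has_real_derivative_iff_has_vector_derivative[symmetric])
  then show "((\<lambda>t. plane_rotation i j t x) has_vector_derivative
           (plane_rotation i j t x \<bullet> i) *\<^sub>R j - (plane_rotation i j t x \<bullet> j) *\<^sub>R i) (at t)"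
    by (rule has_vector_derivative_eq_rhs) (simp add: plane_rotation_def inner_add_left b algebra_simps)
qed

text \<open>
  The fields \<open>A\<^sub>i\<^sub>j x = x\<^sub>i e\<^sub>j - x\<^sub>j e\<^sub>i\<close> generate rotations,
  \<open>\<Sum>\<^sub>i\<^sub>j A\<^sub>i\<^sub>j x \<otimes> A\<^sub>i\<^sub>j x\<close> is twice the projection onto the tangent space,
  and \<open>\<Sum>\<^sub>i\<^sub>j A\<^sub>i\<^sub>j A\<^sub>i\<^sub>j x\<close> is normal. So the divergence of a tangent field \<open>Y\<close> is half
  the sum of the derivatives of \<open>Y \<bullet> A\<^sub>i\<^sub>j\<close> along \<open>A\<^sub>i\<^sub>j\<close>.
\<close>

theorem sphere_divergence_theorem:
  fixes Y :: "'a::euclidean_space \<Rightarrow> 'a"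
  assumes Y: "C1_sphere Y" and tangent: "\<And>x. x \<in> sphere 0 1 \<Longrightarrow> Y x \<bullet> x = 0"
  shows "(LINT x|sphere_measure. sphere_div Y x) = 0"
proof -
  define A where "A i j x = (x \<bullet> i) *\<^sub>R j - (x \<bullet> j) *\<^sub>R i" for i j x :: 'a
  define D where "D x = frechet_derivative (Y \<circ> sgn) (at x)" for x
  have Y': "((Y \<circ> sgn) has_derivative D x) (at x)" if "x \<in> sphere 0 1" for x
    unfolding D_def by (rule C1_sphere_has_derivative[OF Y that])
  have lin: "linear (D x)" if "x \<in> sphere 0 1" for x
    using Y'[OF that] by (rule has_derivative_linear)
  \<comment> \<open>The product rule for Y \<bullet> \<open>A i j\<close>, differentiated along
    \<open>A i j\<close>; the linear field \<open>A i j\<close> is its own derivative.\<close>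
  define F where "F i j x = D x (A i j x) \<bullet> A i j x + Y x \<bullet> A i j (A i j x)" for i j x
  have cD: "continuous_on (sphere 0 1) (\<lambda>x. D x (w x))" if "continuous_on (sphere 0 1) w" for w
  proof -
    have "continuous_on (sphere 0 1) (\<lambda>x. \<Sum>b\<in>Basis. (w x \<bullet> b) *\<^sub>R D x b)"
      using Y that by (intro continuous_intros) (auto simp: C1_sphere_def D_def)
    moreover have "D x (w x) = (\<Sum>b\<in>Basis. (w x \<bullet> b) *\<^sub>R D x b)" if "x \<in> sphere 0 1" for x
      by (subst euclidean_representation[of "w x", symmetric])
        (simp only: linear_sum[OF lin[OF that]] linear_scale[OF lin[OF that]])
    ultimately show ?thesis by (subst continuous_on_cong[OF refl]) auto
  qed
  have cF: "continuous_on (sphere 0 1) (F i j)" for i j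
    unfolding F_def A_def by (intro continuous_intros cD C1_sphere_continuous[OF Y])
  have F0: "(LINT x|sphere_measure. F i j x) = 0" if ij: "i \<in> Basis" "j \<in> Basis" for i j
  proof (cases "i = j")
    case False
    let ?f = "\<lambda>x. (Y \<circ> sgn) x \<bullet> A i j x"
    let ?f' = "\<lambda>x v. (Y \<circ> sgn) x \<bullet> A i j v + D x v \<bullet> A i j x"
    have sgn: "sgn x = x" if "x \<in> sphere 0 1" for x :: 'a
      using that by (simp add: sgn_div_norm)
    have A': "(A i j has_derivative A i j) (at x)" for x
      unfolding A_def by (auto intro!: derivative_eq_intros)
    have "(LINT x|sphere_measure. ?f' x (A i j x)) = 0"
    proof (rule integral_rotational_derivative[where R="plane_rotation i j" and A="A i j" and f="?f" and f'="?f'"])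
      show "(?f has_derivative ?f' x) (at x)" if "x \<in> sphere 0 1" for x
        using has_derivative_inner[OF Y'[OF that] A'] by simp
      show "continuous_on (sphere 0 1) (\<lambda>x. ?f' x (A i j x))"
        using cF[of i j] by (subst continuous_on_cong[OF refl, of _ _ "F i j"]) (auto simp: F_def sgn)
    qed (use plane_rotation[OF ij False] in \<open>auto simp: A_def plane_rotation_def\<close>)
    then show ?thesis
      by (subst Bochner_Integration.integral_cong[OF refl, of _ _ "\<lambda>x. ?f' x (A i j x)"]) (auto simp: F_def sgn)
  qed (use lin in \<open>simp add: F_def A_def linear_0 cong: Bochner_Integration.integral_cong\<close>)
  have sumF: "(\<Sum>i\<in>Basis. \<Sum>j\<in>Basis. F i j x) = 2 * sphere_div Y x" if x: "x \<in> sphere 0 1" for x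
  proof -
    let ?M = "\<lambda>i j. D x i \<bullet> j"
    \<comment> \<open>\<open>Y \<circ> sgn\<close> is constant along rays.\<close>
    have Dx: "D x x = 0"
    proof -
      have "((\<lambda>s. x + s *\<^sub>R x) has_derivative (\<lambda>s. s *\<^sub>R x)) (at 0)"
        by (auto intro!: derivative_eq_intros)
      then have "((\<lambda>s. (Y \<circ> sgn) (x + s *\<^sub>R x)) has_derivative (\<lambda>s. D x (s *\<^sub>R x))) (at 0)"
        by (rule has_derivative_compose) (use Y'[OF x] in \<open>simp add: o_def\<close>)
      moreover have "((\<lambda>s. (Y \<circ> sgn) (x + s *\<^sub>R x)) has_derivative (\<lambda>s. 0)) (at 0)"
      proof (rule has_derivative_transform_within_open[of "\<lambda>_. Y x" _ _ _ "{-1<..}"])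
        fix s :: real assume "s \<in> {-1<..}"
        then have "sgn (x + s *\<^sub>R x) = x"
          using x by (simp add: scaleR_left_distrib[of 1 s x, simplified, symmetric] sgn_scaleR sgn_div_norm)
        then show "Y x = (Y \<circ> sgn) (x + s *\<^sub>R x)" by simp
      qed auto
      ultimately have "(\<lambda>s. D x (s *\<^sub>R x)) = (\<lambda>s. 0)"
        by (rule has_derivative_unique)
      from fun_cong[OF this, of 1] show ?thesis by simp
    qed
    have nx: "(\<Sum>i\<in>Basis. (x \<bullet> i)\<^sup>2) = 1"
      using x by (simp add: euclidean_inner[of x x, symmetric] power2_eq_square dot_square_norm)
    have Yx: "(\<Sum>i\<in>Basis. (Y x \<bullet> i) * (x \<bullet> i)) = 0"
      using tangent[OF x] by (simp add: euclidean_inner[of "Y x" x, symmetric])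
    have M: "(\<Sum>i\<in>Basis. \<Sum>j\<in>Basis. (x \<bullet> i) * (x \<bullet> j) * ?M i j) = 0"
    proof -
      have "D x (\<Sum>i\<in>Basis. (x \<bullet> i) *\<^sub>R i) \<bullet> (\<Sum>j\<in>Basis. (x \<bullet> j) *\<^sub>R j) = 0"
        by (simp add: euclidean_representation Dx)
      then show ?thesis
        by (subst sum.swap) (simp add: linear_sum[OF lin[OF x]] linear_scale[OF lin[OF x]] inner_sum_left inner_sum_right mult_ac sum_distrib_left)
    qed
    have F1: "D x (A i j x) \<bullet> A i j x = (x \<bullet> i)\<^sup>2 * ?M j j + (x \<bullet> j)\<^sup>2 * ?M i i
        - (x \<bullet> i) * (x \<bullet> j) * ?M i j - (x \<bullet> j) * (x \<bullet> i) * ?M j i" for i j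
      using lin[OF x]
      by (simp add: A_def linear_diff linear_scale inner_diff_left inner_diff_right power2_eq_square algebra_simps)
    have F2: "Y x \<bullet> A i j (A i j x) = (if i = j then 2 * ((Y x \<bullet> i) * (x \<bullet> i)) else 0) - (Y x \<bullet> j) * (x \<bullet> j) - (Y x \<bullet> i) * (x \<bullet> i)"
      if "i \<in> Basis" "j \<in> Basis" for i j
      using that by (simp add: A_def inner_diff_left inner_diff_right inner_Basis algebra_simps)
    have "(\<Sum>i\<in>Basis. \<Sum>j\<in>Basis. Y x \<bullet> A i j (A i j x)) =
        (\<Sum>i\<in>Basis. \<Sum>j\<in>Basis. (if i = j then 2 * ((Y x \<bullet> i) * (x \<bullet> i)) else 0) - (Y x \<bullet> j) * (x \<bullet> j) - (Y x \<bullet> i) * (x \<bullet> i))"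
      by (intro sum.cong refl F2)
    also have "\<dots> = 0"
      by (simp add: sum_subtractf Yx sum.delta sum_distrib_left[symmetric])
    finally have S2: "(\<Sum>i\<in>Basis. \<Sum>j\<in>Basis. Y x \<bullet> A i j (A i j x)) = 0" .
    have M': "(\<Sum>i\<in>Basis. \<Sum>j\<in>Basis. (x \<bullet> j) * (x \<bullet> i) * ?M j i) = 0"
      using M by (subst sum.swap)
    have "(\<Sum>i\<in>Basis. \<Sum>j\<in>Basis. (x \<bullet> i)\<^sup>2 * ?M j j) = (\<Sum>i\<in>Basis. (x \<bullet> i)\<^sup>2) * (\<Sum>j\<in>Basis. ?M j j)"
      by (simp add: sum_product)
    moreover have "(\<Sum>i\<in>Basis. \<Sum>j\<in>Basis. (x \<bullet> j)\<^sup>2 * ?M i i) = (\<Sum>i\<in>Basis. (x \<bullet> i)\<^sup>2) * (\<Sum>j\<in>Basis. ?M j j)"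
      by (subst sum.swap) (simp add: sum_product)
    moreover have "(\<Sum>j\<in>Basis. ?M j j) = sphere_div Y x"
      by (simp add: sphere_div_def D_def)
    ultimately show ?thesis
      by (simp add: F_def sum.distrib S2 F1 sum_subtractf M M' nx)
  qed
  have "2 * (LINT x|sphere_measure. sphere_div Y x) = (LINT x|sphere_measure. 2 * sphere_div Y x)" by simp
  also have "\<dots> = (LINT x|sphere_measure. (\<Sum>i\<in>Basis. \<Sum>j\<in>Basis. F i j x))"
    by (rule Bochner_Integration.integral_cong) (auto simp: sumF)
  also have "\<dots> = (\<Sum>i\<in>Basis. \<Sum>j\<in>Basis. LINT x|sphere_measure. F i j x)"
    by (simp add: Bochner_Integration.integral_sum integrable_sphere_continuous cF)
  also have "\<dots> = 0" by (simp add: F0)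
  finally show ?thesis by simp
qed

corollary sphere_integral_by_parts:
  fixes g :: "'a::euclidean_space \<Rightarrow> real" and X :: "'a \<Rightarrow> 'a"
  assumes g: "C1_sphere g" and X: "C1_sphere X" and tangent: "\<And>x. x \<in> sphere 0 1 \<Longrightarrow> X x \<bullet> x = 0"
  shows "(LINT x|sphere_measure. g x * sphere_div X x) = - (LINT x|sphere_measure. sphere_grad g x \<bullet> X x)"
proof -
  have "0 = (LINT x|sphere_measure. sphere_div (\<lambda>x. g x *\<^sub>R X x) x)"
    using tangent by (intro sphere_divergence_theorem[symmetric] sphere_div_scaleR g X) simp
  also have "\<dots> = (LINT x|sphere_measure. g x * sphere_div X x + sphere_grad g x \<bullet> X x)"
    by (intro Bochner_Integration.integral_cong refl sphere_div_scaleR g X) simp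
  also have "\<dots> = (LINT x|sphere_measure. g x * sphere_div X x) + (LINT x|sphere_measure. sphere_grad g x \<bullet> X x)"
    by (intro Bochner_Integration.integral_add integrable_sphere_continuous continuous_intros
        C1_sphere_continuous sphere_div_continuous sphere_grad_continuous g X)
  finally show ?thesis by simp
qed

text \<open>A local extension g may differ from f off the sphere, but \<open>sgn\<close> lands on
  the sphere. So f and g agree after composition with \<open>sgn\<close> near each point, and the
  chain rule expresses the derivative through that of g.\<close>

lemma smooth_fun_on_imp_C1_sphere:
  fixes f :: "'a::euclidean_space \<Rightarrow> 'b::euclidean_space"
  assumes f: "smooth_fun_on (sphere 0 1) f"
  shows "C1_sphere f"
proof -
  let ?w = "\<lambda>v x::'a. v - (x \<bullet> v) *\<^sub>R x"
  let ?D = "\<lambda>x. frechet_derivative (f \<circ> sgn) (at x)"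
  have local: "\<exists>U g. open U \<and> x \<in> U \<and> continuous_on (sphere 0 1 \<inter> U) (\<lambda>x. \<Sum>b\<in>Basis. (?w v x \<bullet> b) *\<^sub>R frechet_derivative g (at x) b) \<and>
     (\<forall>z\<in>sphere 0 1 \<inter> U. ((f \<circ> sgn) has_derivative (\<lambda>v. \<Sum>b\<in>Basis. (?w v z \<bullet> b) *\<^sub>R frechet_derivative g (at z) b)) (at z))"
    if x: "x \<in> sphere 0 1" for x v
  proof -
    obtain U g where Ug: "open U \<and> x \<in> U \<and> (\<forall>k. Ck_on k U g) \<and> (\<forall>z\<in>sphere 0 1 \<inter> U. g z = f z)"
      using bspec[OF f[unfolded smooth_fun_on_def] x] by (elim exE)
    then have U: "open U" "x \<in> U" and Ck: "Ck_on k U g" and eq: "z \<in> sphere 0 1 \<inter> U \<Longrightarrow> g z = f z" for k z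
      by auto
    have d: "(g has_derivative frechet_derivative g (at z)) (at z)" if "z \<in> U" for z
      using Ck[of 1] that by (simp add: frechet_derivative_works)
    have c: "continuous_on U (\<lambda>x. frechet_derivative g (at x) v)" for v
      using Ck[of 1] by simp
    have "((f \<circ> sgn) has_derivative (\<lambda>v. \<Sum>b\<in>Basis. (?w v z \<bullet> b) *\<^sub>R frechet_derivative g (at z) b)) (at z)"
      if z: "z \<in> sphere 0 1 \<inter> U" for z
    proof -
      have z0: "z \<noteq> 0" and sz: "sgn z = z" and nz: "norm z = 1" using z by (auto simp: sgn_div_norm)
      have lin: "linear (frechet_derivative g (at z))" using has_derivative_linear[OF d[of z]] z by blast
      have "((\<lambda>z. g (sgn z)) has_derivative (\<lambda>v. frechet_derivative g (at z) ((v - (sgn z \<bullet> v) *\<^sub>R sgn z) /\<^sub>R norm z))) (at z)"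
        using has_derivative_compose[OF has_derivative_sgn[OF z0], of g] d[of z] z sz by simp
      moreover have "frechet_derivative g (at z) ((v - (sgn z \<bullet> v) *\<^sub>R sgn z) /\<^sub>R norm z) =
          (\<Sum>b\<in>Basis. (?w v z \<bullet> b) *\<^sub>R frechet_derivative g (at z) b)" for v
      proof -
        have "frechet_derivative g (at z) (?w v z) = frechet_derivative g (at z) (\<Sum>b\<in>Basis. (?w v z \<bullet> b) *\<^sub>R b)"
          by (simp only: euclidean_representation)
        then show ?thesis
          by (simp add: sz nz linear_sum[OF lin] linear_scale[OF lin])
      qed
      ultimately have g': "((\<lambda>z. g (sgn z)) has_derivative (\<lambda>v. \<Sum>b\<in>Basis. (?w v z \<bullet> b) *\<^sub>R frechet_derivative g (at z) b)) (at z)"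
        by simp
      have "isCont sgn z" by (rule has_derivative_continuous[OF has_derivative_sgn[OF z0]])
      then have "(sgn \<longlongrightarrow> z) (at z)" by (simp add: isCont_def sz)
      then have "eventually (\<lambda>y. sgn y \<in> U) (at z)"
        by (rule topological_tendstoD) (use U z in auto)
      moreover have "eventually (\<lambda>y. y \<noteq> 0) (at z)"
        using z0 eventually_neq_at_within by blast
      ultimately have "eventually (\<lambda>y. g (sgn y) = (f \<circ> sgn) y) (at z)"
      proof eventually_elim
        case (elim y)
        then show ?case using eq[of "sgn y"] by (simp add: norm_sgn)
      qed
      then show ?thesis
        by (intro has_derivative_transform_eventually[OF g']) (use eq[OF z] sz z in auto)
    qed
    moreover have "continuous_on (sphere 0 1 \<inter> U) (\<lambda>x. \<Sum>b\<in>Basis. (?w v x \<bullet> b) *\<^sub>R frechet_derivative g (at x) b)"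
      by (intro continuous_intros continuous_on_subset[OF c]) auto
    ultimately show ?thesis using U by blast
  qed
  show ?thesis
    unfolding C1_sphere_def
  proof (intro conjI ballI allI)
    show "(f \<circ> sgn) differentiable at x" if "x \<in> sphere 0 1" for x
      using local[OF that] that unfolding differentiable_def by blast
    fix v
    show "continuous_on (sphere 0 1) (\<lambda>x. ?D x v)"
      unfolding continuous_on_eq_continuous_within
    proof
      fix x :: 'a assume x: "x \<in> sphere 0 1"
      obtain U g where Ug: "open U \<and> x \<in> U \<and> continuous_on (sphere 0 1 \<inter> U) (\<lambda>x. \<Sum>b\<in>Basis. (?w v x \<bullet> b) *\<^sub>R frechet_derivative g (at x) b) \<and>
          (\<forall>z\<in>sphere 0 1 \<inter> U. ((f \<circ> sgn) has_derivative (\<lambda>v. \<Sum>b\<in>Basis. (?w v z \<bullet> b) *\<^sub>R frechet_derivative g (at z) b)) (at z))"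
        using local[OF x, of v] by (elim exE)
      then have U: "open U" "x \<in> U"
        and c: "continuous_on (sphere 0 1 \<inter> U) (\<lambda>x. \<Sum>b\<in>Basis. (?w v x \<bullet> b) *\<^sub>R frechet_derivative g (at x) b)"
        by auto
      have d: "((f \<circ> sgn) has_derivative (\<lambda>v. \<Sum>b\<in>Basis. (?w v z \<bullet> b) *\<^sub>R frechet_derivative g (at z) b)) (at z)"
        if "z \<in> sphere 0 1 \<inter> U" for z
        using Ug that by (elim conjE) (rule bspec)
      have "?D z v = (\<Sum>b\<in>Basis. (?w v z \<bullet> b) *\<^sub>R frechet_derivative g (at z) b)" if "z \<in> sphere 0 1 \<inter> U" for z
        using fun_cong[OF frechet_derivative_at[OF d[OF that]], of v] by simp
      then have "continuous_on (sphere 0 1 \<inter> U) (\<lambda>x. ?D x v)"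
        using c by (subst continuous_on_cong[OF refl]) auto
      then have "continuous (at x within sphere 0 1 \<inter> U) (\<lambda>x. ?D x v)"
        using x U by (simp add: continuous_on_eq_continuous_within)
      then show "continuous (at x within sphere 0 1) (\<lambda>x. ?D x v)"
        using at_within_nhd[of x U "sphere 0 1 \<inter> U" "sphere 0 1"] U by (simp add: continuous_within Int_assoc)
    qed
  qed
qed

section \<open>Sums of zonal polynomials\<close>

text \<open>
  For a unit vector \<open>a\<close> and \<open>s = a \<bullet> x\<close>, the function \<open>P (a \<bullet> x)\<close> on the sphere has
  the Riemannian gradient \<open>P' s * (a - s x)\<close> and the Laplacian
  \<open>(1 - s\<^sup>2) P'' s - n s P' s\<close>, where \<open>n\<close> is the dimension of the sphere.
\<close>

definition zonal :: "(real poly \<times> 'a::euclidean_space) list \<Rightarrow> 'a \<Rightarrow> real" where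
  "zonal ps x = (\<Sum>(P, a)\<leftarrow>ps. poly P (a \<bullet> x))"

definition zonal_grad :: "(real poly \<times> 'a::euclidean_space) list \<Rightarrow> 'a \<Rightarrow> 'a" where
  "zonal_grad ps x = (\<Sum>(P, a)\<leftarrow>ps. poly (pderiv P) (a \<bullet> x) *\<^sub>R (a - (a \<bullet> x) *\<^sub>R x))"

definition zonal_lap :: "(real poly \<times> 'a::euclidean_space) list \<Rightarrow> 'a \<Rightarrow> real" where
  "zonal_lap ps x = (\<Sum>(P, a)\<leftarrow>ps. (1 - (a \<bullet> x)\<^sup>2) * poly (pderiv (pderiv P)) (a \<bullet> x)
     - (real DIM('a) - 1) * (a \<bullet> x) * poly (pderiv P) (a \<bullet> x))"

text \<open>The formula in \<open>zonal_lap\<close> rests on |a - s x|^2 = 1 - s^2, which holds for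
  unit vectors a and x with s = a \<bullet> x.\<close>

definition unit_axes :: "(real poly \<times> 'a::euclidean_space) list \<Rightarrow> bool" where
  "unit_axes ps \<longleftrightarrow> (\<forall>(P, a)\<in>set ps. norm a = 1)"

lemma zonal_simps [simp]:
  "zonal [] x = 0" "zonal ((P, a) # ps) x = poly P (a \<bullet> x) + zonal ps x"
  "zonal_grad [] x = 0"
  "zonal_grad ((P, a) # ps) x = poly (pderiv P) (a \<bullet> x) *\<^sub>R (a - (a \<bullet> x) *\<^sub>R x) + zonal_grad ps x"
  "unit_axes []" "unit_axes ((P, a) # ps) \<longleftrightarrow> norm a = 1 \<and> unit_axes ps"
  by (auto simp: zonal_def zonal_grad_def unit_axes_def)

lemma zonal_lap_simps [simp]:
  fixes a :: "'a::euclidean_space"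
  shows "zonal_lap [] a = 0"
  "zonal_lap ((P, a) # ps) x = (1 - (a \<bullet> x)\<^sup>2) * poly (pderiv (pderiv P)) (a \<bullet> x)
     - (real DIM('a) - 1) * (a \<bullet> x) * poly (pderiv P) (a \<bullet> x) + zonal_lap ps x"
  by (auto simp: zonal_lap_def)

lemma zonal_append [simp]:
  "zonal (ps @ qs) x = zonal ps x + zonal qs x" "unit_axes (ps @ qs) \<longleftrightarrow> unit_axes ps \<and> unit_axes qs"
  by (auto simp: zonal_def unit_axes_def)

lemma zonal_grad_tangent: "x \<in> sphere 0 1 \<Longrightarrow> zonal_grad ps x \<bullet> x = 0"
  by (induction ps) (auto simp: inner_add_left inner_diff_left dot_square_norm)

lemma zonal_continuous: "continuous_on S (zonal ps)"
proof (induction ps)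
  case Nil
  then show ?case by simp
next
  case (Cons p ps)
  then show ?case by (cases p) (auto intro!: continuous_intros)
qed

lemma zonal_grad_continuous: "continuous_on S (zonal_grad ps)"
proof (induction ps)
  case Nil
  then show ?case by simp
next
  case (Cons p ps)
  then show ?case by (cases p) (auto intro!: continuous_intros)
qed

lemma zonal_lap_continuous: "continuous_on S (zonal_lap ps)"
proof (induction ps)
  case Nil
  then show ?case by (simp add: zonal_lap_def)
next
  case (Cons p ps)
  then show ?case by (cases p) (auto intro!: continuous_intros)
qed

section \<open>Derivatives and smoothness of zonal sums\<close>

lemma has_derivative_poly_inner_sgn:
  fixes a z :: "'a::euclidean_space"
  assumes "z \<noteq> 0"
  shows "((\<lambda>z. poly P (a \<bullet> sgn z)) has_derivative
    (\<lambda>v. poly (pderiv P) (a \<bullet> sgn z) * (a \<bullet> ((v - (sgn z \<bullet> v) *\<^sub>R sgn z) /\<^sub>R norm z)))) (at z)"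
  using has_derivative_compose[OF has_derivative_inner_right[OF has_derivative_sgn[OF assms], of a]
      poly_DERIV[of P, unfolded has_field_derivative_def]]
  by (simp add: mult.commute)

lemma zonal_has_derivative:
  fixes z :: "'a::euclidean_space"
  assumes "z \<noteq> 0"
  shows "((zonal ps \<circ> sgn) has_derivative (\<lambda>v. (zonal_grad ps (sgn z) \<bullet> v) / norm z)) (at z)"
proof (induction ps)
  case Nil
  then show ?case by (simp add: o_def)
next
  case (Cons p ps)
  obtain P a where p: "p = (P, a)" by (cases p)
  show ?case
    using has_derivative_add[OF has_derivative_poly_inner_sgn[OF assms, of P a] Cons.IH]
    by (simp add: p o_def inner_add_left inner_diff_left inner_diff_right inner_commute algebra_simps add_divide_distrib diff_divide_distrib divide_inverse)
qed

lemma C1_sphere_zonal: "C1_sphere (zonal ps)"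
  and sphere_grad_zonal: "z \<noteq> 0 \<Longrightarrow> sphere_grad (zonal ps) z = zonal_grad ps (sgn z) /\<^sub>R norm z"
proof -
  show "C1_sphere (zonal ps)"
  proof (rule C1_sphereI)
    fix x :: 'a assume "x \<in> sphere 0 1"
    then have "x \<noteq> 0" "sgn x = x" "norm x = 1" by (auto simp: sgn_div_norm)
    then show "((zonal ps \<circ> sgn) has_derivative (\<lambda>v. zonal_grad ps x \<bullet> v)) (at x)"
      using zonal_has_derivative[of x ps] by simp
  qed (intro continuous_intros zonal_grad_continuous)
  assume z: "z \<noteq> 0"
  have "sphere_grad (zonal ps) z = (\<Sum>b\<in>Basis. ((zonal_grad ps (sgn z) /\<^sub>R norm z) \<bullet> b) *\<^sub>R b)"
    using frechet_derivative_at[OF zonal_has_derivative[OF z, of ps], symmetric]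
    by (simp add: sphere_grad_def divide_inverse mult.commute)
  then show "sphere_grad (zonal ps) z = zonal_grad ps (sgn z) /\<^sub>R norm z"
    by (simp only: euclidean_representation)
qed

lemma polynomial_function_zonal_grad: "polynomial_function (zonal_grad ps)"
  and polynomial_function_zonal: "polynomial_function (zonal ps)"
proof -
  have poly: "real_polynomial_function (\<lambda>x. poly P (a \<bullet> x))" for P :: "real poly" and a :: 'a
    by (induction P) (auto intro!: real_polynomial_function.intros(2-4) real_polynomial_function.intros(1)[OF bounded_linear_inner_right])
  have "real_polynomial_function (\<lambda>x. zonal_grad ps x \<bullet> b)" for b
  proof (induction ps)
    case (Cons p ps)
    obtain P a where p: "p = (P, a)" by (cases p)
    have "real_polynomial_function (\<lambda>x. poly (pderiv P) (a \<bullet> x) * ((a \<bullet> b) - (a \<bullet> x) * (x \<bullet> b)) + zonal_grad ps x \<bullet> b)"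
      by (intro real_polynomial_function.intros real_polynomial_function_diff poly Cons.IH bounded_linear_inner_right bounded_linear_inner_left)
    then show ?case by (simp add: p inner_add_left inner_diff_left)
  qed (simp add: real_polynomial_function.intros)
  then show "polynomial_function (zonal_grad ps)"
    by (simp add: polynomial_function_iff_Basis_inner)
  show "polynomial_function (zonal ps)"
    unfolding real_polynomial_function_eq[symmetric]
  proof (induction ps)
    case (Cons p ps)
    then show ?case by (cases p) (auto intro!: real_polynomial_function.intros(3) poly)
  qed (simp add: real_polynomial_function.intros)
qed

lemma real_polynomial_function_has_derivative:
  fixes f :: "'a::euclidean_space \<Rightarrow> real"
  assumes "real_polynomial_function f"
  shows "\<exists>f'. (\<forall>x. (f has_derivative f' x) (at x)) \<and> (\<forall>v. real_polynomial_function (\<lambda>x. f' x v))"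
  using assms
proof induction
  case (linear f)
  then show ?case
    by (intro exI[of _ "\<lambda>x. f"]) (auto intro: bounded_linear_imp_has_derivative real_polynomial_function.intros)
next
  case (const c)
  then show ?case
    by (intro exI[of _ "\<lambda>x v. 0"]) (auto intro: real_polynomial_function.intros)
next
  case (add f g)
  then obtain f' g' where "\<forall>x. (f has_derivative f' x) (at x)" "\<forall>v. real_polynomial_function (\<lambda>x. f' x v)"
    "\<forall>x. (g has_derivative g' x) (at x)" "\<forall>v. real_polynomial_function (\<lambda>x. g' x v)"
    by blast
  then show ?case
    by (intro exI[of _ "\<lambda>x v. f' x v + g' x v"]) (auto intro: has_derivative_add real_polynomial_function.intros(3))
next
  case (mult f g)
  then obtain f' g' where "\<forall>x. (f has_derivative f' x) (at x)" "\<forall>v. real_polynomial_function (\<lambda>x. f' x v)"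
    "\<forall>x. (g has_derivative g' x) (at x)" "\<forall>v. real_polynomial_function (\<lambda>x. g' x v)"
    by blast
  with mult.hyps show ?case
    by (intro exI[of _ "\<lambda>x v. f x * g' x v + f' x v * g x"])
      (auto intro!: has_derivative_mult real_polynomial_function.intros(3,4))
qed

lemma polynomial_function_has_derivative:
  fixes f :: "'a::euclidean_space \<Rightarrow> 'b::euclidean_space"
  assumes "polynomial_function f"
  shows "f differentiable (at x)" "polynomial_function (\<lambda>x. frechet_derivative f (at x) v)"
proof -
  have "\<forall>b. \<exists>f'. b \<in> Basis \<longrightarrow> (\<forall>x. ((\<lambda>x. f x \<bullet> b) has_derivative f' x) (at x)) \<and> (\<forall>v. real_polynomial_function (\<lambda>x. f' x v))"
    using assms real_polynomial_function_has_derivative by (auto simp: polynomial_function_iff_Basis_inner)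
  then obtain F where F: "\<And>b x. b \<in> Basis \<Longrightarrow> ((\<lambda>x. f x \<bullet> b) has_derivative F b x) (at x)"
      "\<And>b v. b \<in> Basis \<Longrightarrow> real_polynomial_function (\<lambda>x. F b x v)"
    by metis
  have d: "(f has_derivative (\<lambda>v. \<Sum>b\<in>Basis. F b x v *\<^sub>R b)) (at x)" for x
    by (subst has_derivative_componentwise_within) (use F in \<open>auto simp: inner_sum_left inner_Basis if_distrib[of "\<lambda>c. _ * c"] sum.delta cong: if_cong\<close>)
  then show "f differentiable (at x)" unfolding differentiable_def by blast
  have "frechet_derivative f (at x) v = (\<Sum>b\<in>Basis. F b x v *\<^sub>R b)" for x
    using fun_cong[OF frechet_derivative_at[OF d[of x]], of v] by simp
  then show "polynomial_function (\<lambda>x. frechet_derivative f (at x) v)"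
    by (simp add: polynomial_function_iff_Basis_inner inner_sum_left inner_Basis F if_distrib[of "\<lambda>c. _ * c"] sum.delta cong: if_cong)
qed

text \<open>Directional derivatives of polynomial functions are polynomial, so the induction on the
  order never leaves the class.\<close>

lemma polynomial_function_smooth:
  fixes f :: "'a::euclidean_space \<Rightarrow> 'b::euclidean_space"
  assumes "polynomial_function f"
  shows "smooth_fun_on S f"
proof -
  have "Ck_on k UNIV f" for k
    using assms
    by (induction k arbitrary: f) (auto simp: continuous_on_polymonial_function polynomial_function_has_derivative)
  then show ?thesis unfolding smooth_fun_on_def by blast
qed

text \<open>The derivative and its trace are produced together because the induction over the
  summands has to build the derivative; the trace is the divergence.\<close>

lemma zonal_grad_sgn_has_derivative:
  fixes x :: "'a::euclidean_space"
  assumes x: "x \<in> sphere 0 1"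
  shows "\<exists>f'. ((zonal_grad ps \<circ> sgn) has_derivative f') (at x) \<and> (unit_axes ps \<longrightarrow> (\<Sum>b\<in>Basis. f' b \<bullet> b) = zonal_lap ps x)"
proof (induction ps)
  case Nil
  then show ?case by (intro exI[of _ "\<lambda>v. 0"]) (auto simp: o_def zonal_lap_def)
next
  case (Cons p ps)
  then obtain f' where f': "((zonal_grad ps \<circ> sgn) has_derivative f') (at x)"
    and lap: "unit_axes ps \<Longrightarrow> (\<Sum>b\<in>Basis. f' b \<bullet> b) = zonal_lap ps x" by blast
  obtain P a where p: "p = (P, a)" by (cases p)
  have x0: "x \<noteq> 0" and sx: "sgn x = x" and nx: "norm x = 1" using x by (auto simp: sgn_div_norm)
  let ?s = "a \<bullet> x"
  let ?w = "\<lambda>v. v - (x \<bullet> v) *\<^sub>R x"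
  let ?P1 = "poly (pderiv P) ?s" and ?P2 = "poly (pderiv (pderiv P)) ?s"
  let ?g' = "\<lambda>v. ?P1 *\<^sub>R (- (?s *\<^sub>R ?w v + (a \<bullet> ?w v) *\<^sub>R x)) + (?P2 * (a \<bullet> ?w v)) *\<^sub>R (a - ?s *\<^sub>R x)"
  have s': "(sgn has_derivative ?w) (at x)"
    using has_derivative_sgn[OF x0] by (simp add: sx nx)
  have "((\<lambda>z. a - (a \<bullet> sgn z) *\<^sub>R sgn z) has_derivative (\<lambda>v. - (?s *\<^sub>R ?w v + (a \<bullet> ?w v) *\<^sub>R x))) (at x)"
    using has_derivative_diff[OF has_derivative_const[of a] has_derivative_scaleR[OF has_derivative_inner_right[OF s', of a] s']]
    by (simp add: sx)
  from has_derivative_scaleR[OF has_derivative_poly_inner_sgn[OF x0, of "pderiv P" a] this]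
  have "((\<lambda>z. poly (pderiv P) (a \<bullet> sgn z) *\<^sub>R (a - (a \<bullet> sgn z) *\<^sub>R sgn z)) has_derivative ?g') (at x)"
    by (simp add: sx nx)
  from has_derivative_add[OF this f']
  have "((zonal_grad (p # ps) \<circ> sgn) has_derivative (\<lambda>v. ?g' v + f' v)) (at x)"
    by (simp add: p o_def)
  moreover have "(\<Sum>b\<in>Basis. (?g' b + f' b) \<bullet> b) = zonal_lap (p # ps) x" if u: "unit_axes (p # ps)"
  proof -
    have na: "a \<bullet> a = 1" using u by (simp add: p dot_square_norm)
    have xx: "x \<bullet> x = 1" using nx by (simp add: dot_square_norm)
    have aw: "a \<bullet> ?w v = (a - ?s *\<^sub>R x) \<bullet> v" for v
      by (simp add: inner_diff_left inner_diff_right inner_commute)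
    \<comment> \<open>Three traces: of the tangential projection, of a tangent vector paired with
      the normal x, and of a - s x paired with itself.\<close>
    have tr1: "(\<Sum>b\<in>Basis. ?w b \<bullet> b) = real DIM('a) - 1"
    proof -
      have "(\<Sum>b\<in>Basis. ?w b \<bullet> b) = (\<Sum>b\<in>Basis. 1 - (x \<bullet> b) * (x \<bullet> b))"
        by (intro sum.cong) (auto simp: inner_diff_left inner_Basis)
      then show ?thesis using euclidean_inner[of x x] xx
        by (simp add: sum_subtractf)
    qed
    have tr2: "(\<Sum>b\<in>Basis. (a \<bullet> ?w b) * (x \<bullet> b)) = 0"
      unfolding aw euclidean_inner[of "a - ?s *\<^sub>R x" x, symmetric] by (simp add: inner_diff_left xx)
    have tr3: "(\<Sum>b\<in>Basis. (a \<bullet> ?w b) * ((a - ?s *\<^sub>R x) \<bullet> b)) = 1 - ?s\<^sup>2"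
      unfolding aw euclidean_inner[of "a - ?s *\<^sub>R x" "a - ?s *\<^sub>R x", symmetric]
      by (simp add: inner_diff_left inner_diff_right xx na inner_commute power2_eq_square)
    have "(\<Sum>b\<in>Basis. ?g' b \<bullet> b) = (\<Sum>b\<in>Basis. - ?P1 * ?s * (?w b \<bullet> b) - ?P1 * ((a \<bullet> ?w b) * (x \<bullet> b))
        + ?P2 * ((a \<bullet> ?w b) * ((a - ?s *\<^sub>R x) \<bullet> b)))"
      by (intro sum.cong refl) (simp add: inner_add_left algebra_simps)
    also have "\<dots> = - ?P1 * ?s * (\<Sum>b\<in>Basis. ?w b \<bullet> b) - ?P1 * (\<Sum>b\<in>Basis. (a \<bullet> ?w b) * (x \<bullet> b))
        + ?P2 * (\<Sum>b\<in>Basis. (a \<bullet> ?w b) * ((a - ?s *\<^sub>R x) \<bullet> b))"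
      by (simp only: sum.distrib sum_subtractf sum_distrib_left)
    also have "\<dots> = (1 - ?s\<^sup>2) * ?P2 - (real DIM('a) - 1) * ?s * ?P1"
      unfolding tr1 tr2 tr3 by (simp add: algebra_simps)
    finally show ?thesis
      using u lap by (simp add: p inner_add_left sum.distrib)
  qed
  ultimately show ?case by blast
qed

lemma C1_sphere_zonal_grad: "C1_sphere (zonal_grad ps)"
  by (intro smooth_fun_on_imp_C1_sphere polynomial_function_smooth polynomial_function_zonal_grad)

lemma sphere_div_zonal_grad:
  assumes "x \<in> sphere 0 1" "unit_axes ps"
  shows "sphere_div (zonal_grad ps) x = zonal_lap ps x"
proof -
  obtain f' where f': "((zonal_grad ps \<circ> sgn) has_derivative f') (at x)" "(\<Sum>b\<in>Basis. f' b \<bullet> b) = zonal_lap ps x"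
    using zonal_grad_sgn_has_derivative[OF assms(1)] assms(2) by blast
  then show ?thesis
    using frechet_derivative_at[OF f'(1)] by (simp add: sphere_div_def)
qed

lemma laplace_beltrami_zonal:
  assumes x: "x \<in> sphere 0 1" and u: "unit_axes ps"
  shows "laplace_beltrami (zonal ps) x = zonal_lap ps x"
proof -
  obtain f' where f': "((zonal_grad ps \<circ> sgn) has_derivative f') (at x)" "(\<Sum>b\<in>Basis. f' b \<bullet> b) = zonal_lap ps x"
    using zonal_grad_sgn_has_derivative[OF x] u by blast
  have "((sphere_grad (zonal ps) \<circ> sgn) has_derivative f') (at x)"
    by (rule has_derivative_transform_within_open[OF f'(1), of "-{0}"])
       (use x in \<open>auto simp: sphere_grad_zonal sgn_div_norm\<close>)
  then show ?thesis
    using frechet_derivative_at[of _ f'] f'(2) by (simp add: laplace_beltrami_def sphere_div_def)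
qed

subsection \<open>Solvability\<close>

text \<open>
  On \<open>s ^ k\<close> the operator \<open>u \<mapsto> u - e ((1 - s\<^sup>2) u'' - m s u')\<close> is triangular:
  \<open>s ^ k\<close> goes to \<open>(1 + e k (k - 1 + m)) s ^ k - e k (k - 1) s ^ (k - 2)\<close>.
\<close>

lemma zonal_poly_equation_solvable:
  fixes e m :: real
  assumes em: "e \<ge> 0" "m \<ge> 0"
  shows "\<exists>Q. \<forall>s. poly Q s - e * ((1 - s\<^sup>2) * poly (pderiv (pderiv Q)) s - m * s * poly (pderiv Q) s) = poly P s"
proof -
  define R where "R P Q \<longleftrightarrow> (\<forall>s. poly Q s - e * ((1 - s\<^sup>2) * poly (pderiv (pderiv Q)) s - m * s * poly (pderiv Q) s) = poly P s)" for P Q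
  have add: "R (P + P') (Q + Q')" if "R P Q" "R P' Q'" for P P' Q Q'
  proof -
    have "poly (Q + Q') s - e * ((1 - s\<^sup>2) * poly (pderiv (pderiv (Q + Q'))) s - m * s * poly (pderiv (Q + Q')) s)
      = poly P s + poly P' s" for s
      unfolding that(1)[unfolded R_def, rule_format, of s, symmetric] that(2)[unfolded R_def, rule_format, of s, symmetric]
      by (simp add: pderiv_add algebra_simps)
    then show ?thesis by (simp add: R_def)
  qed
  have monom: "\<exists>Q. R (monom c k) Q" for c k
  proof (induction k arbitrary: c rule: less_induct)
    case (less k)
    \<comment> \<open>The diagonal entry of the triangular system. It is positive because
      \<open>e\<close> and \<open>m\<close> are nonnegative, so one can divide by it.\<close>
    define d where "d = 1 + e * (real k * (real k - 1) + m * real k)"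
    have "real k * (real k - 1) \<ge> 0" by (cases k) auto
    then have "e * (real k * (real k - 1) + m * real k) \<ge> 0"
      using em by simp
    then have d: "d > 0" unfolding d_def by linarith
    \<comment> \<open>For k < 2 the exponent k - 2 truncates to 0, which is harmless since the
      factor k (k - 1) vanishes.\<close>
    have head: "R (monom c k - monom (e * (real k * (real k - 1)) * (c / d)) (k - 2)) (monom (c / d) k)"
      unfolding R_def
    proof
      fix s :: real
      have k: "k = 0 \<or> k = 1 \<or> (\<exists>j. k = Suc (Suc j))"
        by (metis One_nat_def not0_implies_Suc)
      obtain q where q: "c = d * q" "c / d = q" using d by (intro that[of "c / d"]) auto
      from k show "poly (monom (c / d) k) s - e * ((1 - s\<^sup>2) * poly (pderiv (pderiv (monom (c / d) k))) s - m * s * poly (pderiv (monom (c / d) k)) s) =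
          poly (monom c k - monom (e * (real k * (real k - 1)) * (c / d)) (k - 2)) s"
      proof (elim disjE exE)
        assume "k = 0" then show ?thesis
          unfolding q(2) unfolding q(1) d_def by (simp add: poly_monom monom_0)
      next
        assume "k = 1" then show ?thesis
          unfolding q(2) unfolding q(1) d_def
          by (simp add: pderiv_monom poly_monom algebra_simps)
      next
        fix j assume "k = Suc (Suc j)" then show ?thesis
          unfolding q(2) unfolding q(1) d_def
          by (simp add: pderiv_monom poly_monom algebra_simps power2_eq_square)
      qed
    qed
    show ?case
    proof (cases "k < 2")
      case True
      then have "real k * (real k - 1) = 0" by (cases k) auto
      then show ?thesis using head by auto
    next
      case False
      then obtain Q where "R (monom (e * (real k * (real k - 1)) * (c / d)) (k - 2)) Q"
        using less.IH[of "k - 2"] by auto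
      from add[OF head this] show ?thesis by auto
    qed
  qed
  have "\<exists>Q. R (\<Sum>i\<in>I. monom (coeff P i) i) Q" if "finite I" for I
    using that
  proof induction
    case empty
    have "R 0 0" by (simp add: R_def)
    then show ?case by auto
  next
    case (insert i I)
    then show ?case using monom[of "coeff P i" i] add by simp blast
  qed
  from this[of "{..degree P}"] show ?thesis
    by (simp add: poly_as_sum_of_monoms R_def)
qed

lemma zonal_equation_solvable:
  fixes ps :: "(real poly \<times> 'a::euclidean_space) list"
  assumes "e \<ge> 0" "unit_axes ps"
  shows "\<exists>qs. unit_axes qs \<and> (\<forall>x. zonal qs x - e * zonal_lap qs x = zonal ps x)"
  using assms(2)
proof (induction ps)
  case Nil
  then show ?case by (intro exI[of _ "[]"]) (auto simp: zonal_lap_def)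
next
  case (Cons p ps)
  obtain P a where p: "p = (P, a)" by (cases p)
  obtain qs where qs: "unit_axes qs" "\<And>x. zonal qs x - e * zonal_lap qs x = zonal ps x"
    using Cons by (auto simp: p)
  have "0 \<le> real DIM('a) - 1" using DIM_positive[where 'a='a] by simp
  then obtain Q where Q: "\<forall>s :: real. poly Q s - e * ((1 - s\<^sup>2) * poly (pderiv (pderiv Q)) s - (real DIM('a) - 1) * s * poly (pderiv Q) s) = poly P s"
    using zonal_poly_equation_solvable[OF assms(1), of "real DIM('a) - 1" P] by (elim impE exE meta_impE)
  show ?case
  proof (intro exI[of _ "(Q, a) # qs"] conjI allI)
    show "unit_axes ((Q, a) # qs)" using Cons.prems qs(1) by (simp add: p)
    show "zonal ((Q, a) # qs) x - e * zonal_lap ((Q, a) # qs) x = zonal (p # ps) x" for x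
      using Q[rule_format, of "a \<bullet> x"] qs(2)[of x] by (simp add: p algebra_simps)
  qed
qed

subsection \<open>Density\<close>

lemma poly_approx:
  fixes h :: "real \<Rightarrow> real"
  assumes "continuous_on {a..b} h" "0 < \<delta>"
  obtains P where "\<And>s. s \<in> {a..b} \<Longrightarrow> \<bar>h s - poly P s\<bar> < \<delta>"
proof -
  obtain g where g: "real_polynomial_function g" "\<And>s. s \<in> {a..b} \<Longrightarrow> \<bar>h s - g s\<bar> < \<delta>"
    using Stone_Weierstrass_real_polynomial_function[OF compact_Icc assms] by blast
  then obtain c n where "g = (\<lambda>x. \<Sum>i\<le>n. c i * x ^ i)"
    using real_polynomial_function_iff_sum by blast
  then have "g s = poly (\<Sum>i\<le>n. monom (c i) i) s" for s
    by (simp add: poly_sum poly_monom)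
  then show ?thesis using g that by metis
qed

text \<open>
  The algebra for the Stone--Weierstrass theorem: unlike that of two zonal polynomials with different axes, the
  product of two exponentials \<open>exp (a \<bullet> x)\<close> is zonal again.
\<close>

inductive exp_sum :: "('a::euclidean_space \<Rightarrow> real) \<Rightarrow> bool" where
  exp: "exp_sum (\<lambda>x. c * exp (a \<bullet> x))"
| add: "exp_sum f \<Longrightarrow> exp_sum g \<Longrightarrow> exp_sum (\<lambda>x. f x + g x)"

lemma exp_sum_mult:
  assumes "exp_sum f" "exp_sum g"
  shows "exp_sum (\<lambda>x. f x * g x)"
  using assms(1)
proof induction
  case (exp c a)
  show ?case using assms(2)
  proof induction
    case (exp d b)
    have "(\<lambda>x. c * exp (a \<bullet> x) * (d * exp (b \<bullet> x))) = (\<lambda>x. (c * d) * exp ((a + b) \<bullet> x))"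
      by (auto simp: inner_add_left exp_add)
    then show ?case by (metis exp_sum.exp)
  qed (auto simp: distrib_left intro: exp_sum.add)
qed (auto simp: distrib_right intro: exp_sum.add)

text \<open>Along its normalised axis an exponential is a function of one variable in [-1, 1], where
  polynomials are dense; for a = 0 any axis will do.\<close>

lemma exp_sum_zonal_approx:
  fixes f :: "'a::euclidean_space \<Rightarrow> real"
  assumes "exp_sum f" "0 < \<delta>"
  shows "\<exists>ps. unit_axes ps \<and> (\<forall>x\<in>sphere 0 1. \<bar>f x - zonal ps x\<bar> < \<delta>)"
  using assms
proof (induction arbitrary: \<delta>)
  case (exp c a)
  obtain u t where u: "norm (u :: 'a) = 1" "a = t *\<^sub>R u"
  proof (cases "a = 0")
    case True
    obtain b :: 'a where "b \<in> Basis" using nonempty_Basis by blast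
    then show ?thesis using True that[of b 0] by simp
  next
    case False
    then show ?thesis using that[of "sgn a" "norm a"] by (simp add: norm_sgn sgn_div_norm)
  qed
  have "continuous_on {-1..1} (\<lambda>s. c * exp (t * s))" by (intro continuous_intros)
  from poly_approx[OF this exp]
  obtain P where P: "\<And>s. s \<in> {-1..1} \<Longrightarrow> \<bar>c * exp (t * s) - poly P s\<bar> < \<delta>" by blast
  show ?case
  proof (intro exI[of _ "[(P, u)]"] conjI ballI)
    fix x :: 'a assume x: "x \<in> sphere 0 1"
    have "\<bar>u \<bullet> x\<bar> \<le> 1" using Cauchy_Schwarz_ineq2[of u x] u x by simp
    then show "\<bar>c * exp (a \<bullet> x) - zonal [(P, u)] x\<bar> < \<delta>"
      using P[of "u \<bullet> x"] by (simp add: u abs_le_iff)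
  qed (use u in simp)
next
  case (add f g)
  obtain ps qs where u: "unit_axes ps" "unit_axes qs"
    and ps: "\<forall>x\<in>sphere 0 1. \<bar>f x - zonal ps x\<bar> < \<delta> / 2"
    and qs: "\<forall>x\<in>sphere 0 1. \<bar>g x - zonal qs x\<bar> < \<delta> / 2"
    using add.IH[of "\<delta> / 2"] add.prems by (meson half_gt_zero)
  show ?case
  proof (intro exI[of _ "ps @ qs"] conjI ballI)
    fix x :: 'a assume "x \<in> sphere 0 1"
    then have "\<bar>f x - zonal ps x\<bar> < \<delta> / 2" "\<bar>g x - zonal qs x\<bar> < \<delta> / 2"
      using ps qs by blast+
    then show "\<bar>f x + g x - zonal (ps @ qs) x\<bar> < \<delta>"
      unfolding zonal_append by linarith
  qed (simp add: u)
qed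

lemma zonal_approx:
  fixes g :: "'a::euclidean_space \<Rightarrow> real"
  assumes g: "continuous_on (sphere 0 1) g" and \<delta>: "0 < \<delta>"
  shows "\<exists>ps. unit_axes ps \<and> (\<forall>x\<in>sphere 0 1. \<bar>g x - zonal ps x\<bar> < \<delta>)"
proof -
  interpret function_ring_on "Collect exp_sum" "sphere (0::'a) 1"
  proof
    show "continuous_on (sphere 0 1) f" if "f \<in> Collect exp_sum" for f :: "'a \<Rightarrow> real"
      using that[simplified] by induction (auto intro!: continuous_intros)
    show "(\<lambda>_::'a. c) \<in> Collect exp_sum" for c
      using exp_sum.exp[of c 0] by simp
    show "\<exists>f\<in>Collect exp_sum. f x \<noteq> f y" if "x \<noteq> y" for x y :: 'a
    proof
      have "(x - y) \<bullet> x \<noteq> (x - y) \<bullet> y" using that by (metis eq_iff_diff_eq_0 inner_diff_right inner_eq_zero_iff)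
      then show "1 * exp ((x - y) \<bullet> x) \<noteq> 1 * exp ((x - y) \<bullet> y)" by simp
    qed (use exp_sum.exp in blast)
  qed (auto intro: exp_sum.add exp_sum_mult)
  obtain f where f: "exp_sum f" "\<And>x. x \<in> sphere 0 1 \<Longrightarrow> \<bar>g x - f x\<bar> < \<delta> / 2"
    using Stone_Weierstrass_basic[OF g, of "\<delta> / 2"] \<delta> by auto
  obtain ps where ps: "unit_axes ps" "\<And>x. x \<in> sphere 0 1 \<Longrightarrow> \<bar>f x - zonal ps x\<bar> < \<delta> / 2"
    using exp_sum_zonal_approx[OF f(1), of "\<delta> / 2"] \<delta> by auto
  have "\<bar>g x - zonal ps x\<bar> < \<delta>" if "x \<in> sphere 0 1" for x
    using f(2)[OF that] ps(2)[OF that] by linarith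
  then show ?thesis using ps(1) by blast
qed

text \<open>Compressing g into [h, 1 - h] before approximating it within h keeps the approximant in
  [0, 1], the range that the maximum principle for differences asks of the right-hand side.
  Compression costs at most h and approximation less than another h.\<close>

lemma zonal_approx_unit_interval:
  fixes g :: "'a::euclidean_space \<Rightarrow> real"
  assumes g: "continuous_on (sphere 0 1) g" and g01: "\<And>x. x \<in> sphere 0 1 \<Longrightarrow> g x \<in> {0..1}" and \<delta>: "0 < \<delta>"
  shows "\<exists>ps. unit_axes ps \<and> (\<forall>x\<in>sphere 0 1. \<bar>g x - zonal ps x\<bar> < \<delta> \<and> zonal ps x \<in> {0..1})"
proof -
  define h where "h = min (\<delta> / 4) (1 / 2)"
  have h: "0 < h" "h \<le> \<delta> / 4" "h \<le> 1 / 2" using \<delta> by (auto simp: h_def)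
  have "continuous_on (sphere 0 1) (\<lambda>x. (1 - 2 * h) * g x + h)" using g by (intro continuous_intros)
  from zonal_approx[OF this h(1)] obtain ps where ps: "unit_axes ps"
    "\<And>x. x \<in> sphere 0 1 \<Longrightarrow> \<bar>(1 - 2 * h) * g x + h - zonal ps x\<bar> < h" by blast
  have "\<bar>g x - zonal ps x\<bar> < \<delta> \<and> zonal ps x \<in> {0..1}" if x: "x \<in> sphere 0 1" for x
  proof -
    have "0 \<le> (1 - 2 * h) * g x" "(1 - 2 * h) * g x \<le> 1 - 2 * h" "h * g x \<le> h" "0 \<le> h * g x"
      using g01[OF x] h by (auto intro!: mult_nonneg_nonneg mult_left_le)
    moreover have "(1 - 2 * h) * g x = g x - 2 * (h * g x)" by (simp add: algebra_simps)
    ultimately have "\<bar>g x - zonal ps x\<bar> < \<delta>" "0 \<le> zonal ps x" "zonal ps x \<le> 1"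
      using ps(2)[OF x] h by linarith+
    then show ?thesis by simp
  qed
  then show ?thesis using ps(1) by blast
qed

section \<open>Maximum principles\<close>

text \<open>Supplies the directions along which the Laplacian is a sum of second derivatives.
  Parseval and the count are all that the trace computation uses.\<close>

lemma orthonormal_complement:
  fixes S :: "'a::euclidean_space set"
  assumes S: "pairwise orthogonal S" "\<And>s. s \<in> S \<Longrightarrow> norm s = 1"
  obtains W where "finite W" "\<And>w. w \<in> W \<Longrightarrow> norm w = 1" "\<And>w s. w \<in> W \<Longrightarrow> s \<in> S \<Longrightarrow> s \<bullet> w = 0"
    "\<And>a. (\<Sum>w\<in>W. (a \<bullet> w)\<^sup>2) = a \<bullet> a - (\<Sum>s\<in>S. (a \<bullet> s)\<^sup>2)" "card W + card S = DIM('a)"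
proof -
  have fS: "finite S" using S(1) by (rule pairwise_orthogonal_imp_finite)
  define T where "T = {v. \<forall>s\<in>S. s \<bullet> v = 0}"
  have "subspace T" by (auto simp: T_def subspace_def inner_add_right)
  then obtain W where W: "W \<subseteq> T" "pairwise orthogonal W" "\<And>w. w \<in> W \<Longrightarrow> norm w = 1" "span W = T"
    using orthonormal_basis_subspace by metis
  have fW: "finite W" using W(2) by (rule pairwise_orthogonal_imp_finite)
  have pars: "a \<bullet> a = (\<Sum>s\<in>S. (a \<bullet> s)\<^sup>2) + (\<Sum>w\<in>W. (a \<bullet> w)\<^sup>2)" for a
  proof -
    define r where "r = a - (\<Sum>s\<in>S. (a \<bullet> s) *\<^sub>R s)"
    have "s \<bullet> r = 0" if s: "s \<in> S" for s
    proof -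
      have "(\<Sum>t\<in>S. (a \<bullet> t) * (s \<bullet> t)) = (\<Sum>t\<in>S. if t = s then a \<bullet> s else 0)"
        using S s by (intro sum.cong) (auto simp: pairwise_def orthogonal_def dot_square_norm)
      then show ?thesis using fS s by (simp add: r_def inner_diff_right inner_sum_right inner_commute)
    qed
    then have "r \<in> span W" by (simp add: W(4) T_def)
    then have r: "(\<Sum>w\<in>W. (r \<bullet> w) *\<^sub>R w) = r"
      by (intro orthonormal_basis_expand W fW)
    have "r \<bullet> w = a \<bullet> w" if "w \<in> W" for w
      using W(1) that by (auto simp: r_def inner_diff_left inner_sum_left T_def)
    then have "r = (\<Sum>w\<in>W. (a \<bullet> w) *\<^sub>R w)" by (subst r[symmetric]) simp
    then have "a = (\<Sum>s\<in>S. (a \<bullet> s) *\<^sub>R s) + (\<Sum>w\<in>W. (a \<bullet> w) *\<^sub>R w)" by (simp add: r_def algebra_simps)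
    then have "a \<bullet> a = a \<bullet> ((\<Sum>s\<in>S. (a \<bullet> s) *\<^sub>R s) + (\<Sum>w\<in>W. (a \<bullet> w) *\<^sub>R w))" by simp
    then show ?thesis by (simp add: inner_add_right inner_sum_right power2_eq_square)
  qed
  have tr: "(\<Sum>b\<in>Basis. \<Sum>w\<in>V. (b \<bullet> w)\<^sup>2) = card V" if "finite V" "\<And>w. w \<in> V \<Longrightarrow> norm w = 1" for V :: "'a set"
  proof -
    have "(\<Sum>b\<in>Basis. \<Sum>w\<in>V. (b \<bullet> w)\<^sup>2) = (\<Sum>w\<in>V. \<Sum>b\<in>Basis. (w \<bullet> b) * (w \<bullet> b))"
      by (subst sum.swap) (simp add: power2_eq_square inner_commute)
    also have "\<dots> = (\<Sum>w\<in>V. 1)"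
      by (intro sum.cong refl) (simp add: euclidean_inner[symmetric] dot_square_norm that)
    finally show ?thesis by simp
  qed
  \<comment> \<open>Parseval summed over the standard basis counts vectors, as every unit vector
    contributes 1.\<close>
  have "real DIM('a) = (\<Sum>b\<in>Basis. (b::'a) \<bullet> b)" by simp
  also have "\<dots> = real (card S) + real (card W)"
    by (simp only: pars sum.distrib tr[OF fS S(2)] tr[OF fW W(3)])
  finally have "card W + card S = DIM('a)" by linarith
  moreover have "\<And>a. (\<Sum>w\<in>W. (a \<bullet> w)\<^sup>2) = a \<bullet> a - (\<Sum>s\<in>S. (a \<bullet> s)\<^sup>2)"
    using pars by simp
  moreover have "\<And>w s. w \<in> W \<Longrightarrow> s \<in> S \<Longrightarrow> s \<bullet> w = 0" using W(1) by (auto simp: T_def)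
  ultimately show ?thesis using that[of W] fW W(3) by blast
qed

section \<open>Second variations along great circles\<close>

lemma second_derivative_nonpos_at_max:
  fixes h :: "real \<Rightarrow> real"
  assumes r: "0 < r" and h: "\<And>t. \<bar>t\<bar> < r \<Longrightarrow> (h has_real_derivative h' t) (at t)"
    and h': "(h' has_real_derivative D) (at 0)" and max: "\<And>t. \<bar>t\<bar> < r \<Longrightarrow> h t \<le> h 0"
  shows "D \<le> 0"
proof (rule ccontr)
  assume "\<not> D \<le> 0"
  then have "0 < D" by simp
  have h0: "h' 0 = 0"
    by (rule DERIV_local_max[of h _ 0 r]) (use h[of 0] r max in auto)
  obtain d where d: "0 < d" "\<And>t. 0 < t \<Longrightarrow> t < d \<Longrightarrow> 0 < h' t"
    using DERIV_pos_inc_right[OF h' \<open>0 < D\<close>] h0 by auto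
  define s where "s = min d r / 2"
  have s: "0 < s" "s < d" "s < r" using d r by (auto simp: s_def)
  obtain z where "0 < z" "z < s" "h s - h 0 = (s - 0) * h' z"
    using MVT2[OF s(1), of h h'] h s by auto
  moreover from this d(2)[of z] s have "0 < s * h' z" by (intro mult_pos_pos) auto
  ultimately have "h s > h 0" by simp
  with max[of s] s show False by simp
qed

text \<open>For a unit vector w tangent at x this is the Riemannian Hessian on (w, w). The second
  term comes from the acceleration of the great circle, which points to the centre.\<close>

definition zonal_hess :: "(real poly \<times> 'a::euclidean_space) list \<Rightarrow> 'a \<Rightarrow> 'a \<Rightarrow> real" where
  "zonal_hess ps x w = (\<Sum>(P, a)\<leftarrow>ps. poly (pderiv (pderiv P)) (a \<bullet> x) * (a \<bullet> w)\<^sup>2 - poly (pderiv P) (a \<bullet> x) * (a \<bullet> x))"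

lemma zonal_great_circle:
  fixes x w :: "'a::euclidean_space"
  assumes xw: "x \<bullet> w = 0" "norm x = 1" "norm w = 1"
  shows "((\<lambda>t. zonal ps (cos t *\<^sub>R x + sin t *\<^sub>R w)) has_real_derivative
           zonal_grad ps (cos t *\<^sub>R x + sin t *\<^sub>R w) \<bullet> (cos t *\<^sub>R w - sin t *\<^sub>R x)) (at t)"
    and "((\<lambda>t. zonal_grad ps (cos t *\<^sub>R x + sin t *\<^sub>R w) \<bullet> (cos t *\<^sub>R w - sin t *\<^sub>R x)) has_real_derivative
           zonal_hess ps x w) (at 0)"
proof -
  define c c' where "c t = cos t *\<^sub>R x + sin t *\<^sub>R w" and "c' t = cos t *\<^sub>R w - sin t *\<^sub>R x" for t
  \<comment> \<open>Velocity is orthogonal to position, so the radial correction in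
    \<open>zonal_grad\<close> drops out.\<close>
  have cc': "c t \<bullet> c' t = 0" for t
    using xw by (simp add: c_def c'_def inner_add_left inner_diff_right inner_commute[of w x] dot_square_norm)
  have dc: "((\<lambda>t. a \<bullet> c t) has_real_derivative a \<bullet> c' t) (at t)"
    and dc': "((\<lambda>t. a \<bullet> c' t) has_real_derivative - (a \<bullet> c t)) (at t)" for a t
    unfolding c_def c'_def inner_add_right inner_diff_right inner_scaleR_right
    by (auto intro!: derivative_eq_intros)
  have dP: "((\<lambda>t. poly P (a \<bullet> c t)) has_real_derivative poly (pderiv P) (a \<bullet> c t) * (a \<bullet> c' t)) (at t)" for P a t
    by (rule DERIV_chain2[OF poly_DERIV dc])
  have "((\<lambda>t. zonal ps (c t)) has_real_derivative zonal_grad ps (c t) \<bullet> c' t) (at t)" for t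
  proof (induction ps)
    case (Cons p ps)
    obtain P a where p: "p = (P, a)" by (cases p)
    show ?case using DERIV_add[OF dP[of P a t] Cons.IH] by (simp add: p inner_add_left inner_diff_left cc')
  qed simp
  then show "((\<lambda>t. zonal ps (cos t *\<^sub>R x + sin t *\<^sub>R w)) has_real_derivative
           zonal_grad ps (cos t *\<^sub>R x + sin t *\<^sub>R w) \<bullet> (cos t *\<^sub>R w - sin t *\<^sub>R x)) (at t)"
    by (simp add: c_def c'_def)
  have "((\<lambda>t. zonal_grad ps (c t) \<bullet> c' t) has_real_derivative zonal_hess ps (c 0) (c' 0)) (at 0)"
  proof (induction ps)
    case Nil
    then show ?case by (simp add: zonal_hess_def)
  next
    case (Cons p ps)
    obtain P a where p: "p = (P, a)" by (cases p)
    have "((\<lambda>t. poly (pderiv P) (a \<bullet> c t) * (a \<bullet> c' t)) has_real_derivative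
        poly (pderiv P) (a \<bullet> c 0) * - (a \<bullet> c 0) + poly (pderiv (pderiv P)) (a \<bullet> c 0) * (a \<bullet> c' 0) * (a \<bullet> c' 0)) (at 0)"
      by (rule DERIV_mult'[OF dP dc'])
    from DERIV_add[OF this Cons.IH] show ?case
      by (simp add: p inner_add_left inner_diff_left cc' zonal_hess_def power2_eq_square algebra_simps)
  qed
  then show "((\<lambda>t. zonal_grad ps (cos t *\<^sub>R x + sin t *\<^sub>R w) \<bullet> (cos t *\<^sub>R w - sin t *\<^sub>R x)) has_real_derivative
           zonal_hess ps x w) (at 0)"
    by (simp add: c_def c'_def)
qed

text \<open>The Laplacian is the trace of the Hessian. The frame W enters only through Parseval and
  its size, so a rotated frame qualifies as soon as its squared components are compared.\<close>

lemma zonal_hess_sum: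
  fixes x :: "'a::euclidean_space"
  assumes W: "finite W" "\<And>a. (\<Sum>w\<in>W. (a \<bullet> w)\<^sup>2) = a \<bullet> a - (a \<bullet> x)\<^sup>2" "card W + 1 = DIM('a)"
    and u: "unit_axes ps"
  shows "(\<Sum>w\<in>W. zonal_hess ps x w) = zonal_lap ps x"
  using u
proof (induction ps)
  case Nil
  then show ?case by (simp add: zonal_hess_def zonal_lap_def)
next
  case (Cons p ps)
  obtain P a where p: "p = (P, a)" by (cases p)
  have card: "real (card W) = real DIM('a) - 1" using W(3) by linarith
  have na: "a \<bullet> a = 1" using Cons.prems by (simp add: p dot_square_norm)
  have "zonal_hess (p # ps) x w = poly (pderiv (pderiv P)) (a \<bullet> x) * (a \<bullet> w)\<^sup>2 - poly (pderiv P) (a \<bullet> x) * (a \<bullet> x) + zonal_hess ps x w" for w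
    by (simp add: zonal_hess_def p)
  then have "(\<Sum>w\<in>W. zonal_hess (p # ps) x w) = poly (pderiv (pderiv P)) (a \<bullet> x) * (\<Sum>w\<in>W. (a \<bullet> w)\<^sup>2)
      - card W * (poly (pderiv P) (a \<bullet> x) * (a \<bullet> x)) + (\<Sum>w\<in>W. zonal_hess ps x w)"
    by (simp add: sum.distrib sum_subtractf sum_distrib_left)
  then show ?case
    using Cons by (simp add: p card W(2) na algebra_simps)
qed

lemma norm_great_circle:
  assumes "x \<bullet> w = 0" "norm x = 1" "norm w = 1"
  shows "norm (cos t *\<^sub>R x + sin t *\<^sub>R w) = 1"
proof -
  have "x \<bullet> x = 1" "w \<bullet> w = 1" using assms by (simp_all add: dot_square_norm)
  then have "(cos t *\<^sub>R x + sin t *\<^sub>R w) \<bullet> (cos t *\<^sub>R x + sin t *\<^sub>R w) = (cos t)\<^sup>2 + (sin t)\<^sup>2"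
    using assms(1) by (simp add: inner_add_left inner_add_right inner_commute power2_eq_square del: sin_cos_squared_add2)
  then show ?thesis by (simp add: norm_eq_sqrt_inner)
qed

text \<open>At a minimum all second derivatives along great circles are nonnegative, hence so is the
  Laplacian, and the minimum of u is at least the value of the right-hand side there.\<close>

lemma zonal_minimum_principle:
  fixes ps :: "(real poly \<times> 'a::euclidean_space) list"
  assumes u: "unit_axes ps" and e: "0 \<le> e"
    and f: "\<And>x. x \<in> sphere 0 1 \<Longrightarrow> 0 \<le> zonal ps x - e * zonal_lap ps x" and x: "x \<in> sphere 0 1"
  shows "0 \<le> zonal ps x"
proof -
  obtain p where p: "p \<in> sphere 0 1" "\<And>x. x \<in> sphere 0 1 \<Longrightarrow> zonal ps p \<le> zonal ps x"
    using continuous_attains_inf[OF compact_sphere _ zonal_continuous, of "0::'a" 1 ps] x by auto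
  have np: "norm p = 1" using p by simp
  obtain W where W: "finite W" "\<And>w. w \<in> W \<Longrightarrow> norm w = 1" "\<And>w s. w \<in> W \<Longrightarrow> s \<in> {p} \<Longrightarrow> s \<bullet> w = 0"
    "\<And>a. (\<Sum>w\<in>W. (a \<bullet> w)\<^sup>2) = a \<bullet> a - (\<Sum>s\<in>{p}. (a \<bullet> s)\<^sup>2)" "card W + card {p} = DIM('a)"
    using orthonormal_complement[of "{p}"] np by auto
  have "- zonal_hess ps p w \<le> 0" if w: "w \<in> W" for w
  proof (rule second_derivative_nonpos_at_max)
    note w' = W(3)[OF w, of p, simplified] np W(2)[OF w]
    show "((\<lambda>t. - zonal ps (cos t *\<^sub>R p + sin t *\<^sub>R w)) has_real_derivative
        - (zonal_grad ps (cos t *\<^sub>R p + sin t *\<^sub>R w) \<bullet> (cos t *\<^sub>R w - sin t *\<^sub>R p))) (at t)" for t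
      by (intro DERIV_minus zonal_great_circle w')
    show "((\<lambda>t. - (zonal_grad ps (cos t *\<^sub>R p + sin t *\<^sub>R w) \<bullet> (cos t *\<^sub>R w - sin t *\<^sub>R p))) has_real_derivative
        - zonal_hess ps p w) (at 0)"
      by (intro DERIV_minus zonal_great_circle w')
    show "- zonal ps (cos t *\<^sub>R p + sin t *\<^sub>R w) \<le> - zonal ps (cos 0 *\<^sub>R p + sin 0 *\<^sub>R w)" for t
      using p(2)[of "cos t *\<^sub>R p + sin t *\<^sub>R w"] norm_great_circle[OF w'] by simp
  qed (rule zero_less_one)
  then have "0 \<le> (\<Sum>w\<in>W. zonal_hess ps p w)" by (intro sum_nonneg) auto
  also have "\<dots> = zonal_lap ps p"
    using W by (intro zonal_hess_sum u) auto
  finally have "0 \<le> e * zonal_lap ps p" using e by simp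
  then show ?thesis using f[OF p(1)] p(2)[OF x] by linarith
qed

text \<open>
  Two-point maximum principle. At a maximum of \<open>u x - u y - (1 - exp (- d x y / (2 \<epsilon>)))\<close>,
  move \<open>x\<close> and \<open>y\<close> apart along their common great circle, so that \<open>d\<close> grows at
  rate 2, and move both of them towards a common orthogonal direction \<open>w\<close>, which does not increase
  \<open>d\<close>. The second variations add up to
  \<open>\<Delta> u x - \<Delta> u y \<le> - exp (- d / (2 \<epsilon>)) / \<epsilon>\<^sup>2\<close>.
\<close>

lemma zonal_modulus_of_continuity:
  fixes ps :: "(real poly \<times> 'a::euclidean_space) list"
  assumes u: "unit_axes ps" and \<epsilon>: "0 < \<epsilon>" and dim: "2 \<le> DIM('a)"
    and f: "\<And>x. x \<in> sphere 0 1 \<Longrightarrow> zonal ps x - \<epsilon>\<^sup>2 * zonal_lap ps x \<in> {0..1}"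
    and xy: "x \<in> sphere 0 1" "y \<in> sphere 0 1"
  shows "zonal ps x - zonal ps y \<le> 1 - exp (- arccos (x \<bullet> y) / (2 * \<epsilon>))"
proof -
  \<comment> \<open>\<open>\<psi>\<close> solves psi - 4 eps^2 psi'' = 1 with psi 0 = 0, the factor
    4 being the square of the rate 2. It is the difference u t - u (- t) of the flat profile at
    distance r = 2 t.\<close>
  define \<psi> where "\<psi> r = 1 - exp (- r / (2 * \<epsilon>))" for r
  define S where "S = sphere (0::'a) 1 \<times> sphere (0::'a) 1"
  define w where "w = (\<lambda>(x::'a, y). zonal ps x - zonal ps y - \<psi> (arccos (x \<bullet> y)))"
  have psi_mono: "\<psi> r \<le> \<psi> s" if "r \<le> s" for r s
    using that \<epsilon> by (simp add: \<psi>_def divide_right_mono)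
  have inner: "-1 \<le> x \<bullet> y \<and> x \<bullet> y \<le> 1" if "norm x = 1" "norm y = 1" for x y :: 'a
    using Cauchy_Schwarz_ineq2[of x y] that by (simp add: abs_le_iff)
  have "continuous_on S (\<lambda>z. zonal ps (fst z))" "continuous_on S (\<lambda>z. zonal ps (snd z))"
    by (intro continuous_on_compose2[OF zonal_continuous[of UNIV]] continuous_intros; simp)+
  then have "continuous_on S w"
    unfolding w_def S_def \<psi>_def case_prod_unfold
    using inner \<epsilon> by (intro continuous_intros) auto
  moreover have "compact S" "S \<noteq> {}" using xy by (auto simp: S_def intro: compact_Times)
  ultimately obtain q where q: "q \<in> S" "\<And>z. z \<in> S \<Longrightarrow> w z \<le> w q"
    using continuous_attains_sup by metis
  obtain p y0 where q': "q = (p, y0)" by (cases q)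
  have np: "norm p = 1" and ny: "norm y0 = 1" using q(1) by (auto simp: q' S_def)
  have max: "zonal ps x - zonal ps y - \<psi> (arccos (x \<bullet> y)) \<le> w (p, y0)" if "norm x = 1" "norm y = 1" for x y
    using q(2)[of "(x, y)"] that by (simp add: S_def q' w_def)
  define d where "d = arccos (p \<bullet> y0)"
  have w_d: "w (p, y0) = zonal ps p - zonal ps y0 - \<psi> d" by (simp add: w_def d_def)
  have d_bounds: "0 \<le> d" "d \<le> pi" and cos_d: "cos d = p \<bullet> y0"
    using inner[OF np ny] by (auto simp: d_def arccos_lbound arccos_ubound cos_arccos)
  have "w (p, y0) \<le> 0"
  proof (cases "d = 0")
    case True
    then have "p \<bullet> y0 = 1" using cos_d by simp
    moreover have "(norm (p - y0))\<^sup>2 = (norm p)\<^sup>2 + (norm y0)\<^sup>2 - 2 * (p \<bullet> y0)"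
      by (simp add: power2_norm_eq_inner inner_diff_left inner_diff_right inner_commute)
    ultimately have "p = y0" using np ny by simp
    then show ?thesis unfolding w_d using True by (simp add: \<psi>_def)
  next
    case False
    then have d: "0 < d" using d_bounds by simp
    have pp: "p \<bullet> p = 1" and yy: "y0 \<bullet> y0 = 1" using np ny by (simp_all add: dot_square_norm)
    obtain e where e: "norm e = 1" "p \<bullet> e = 0" "y0 = cos d *\<^sub>R p + sin d *\<^sub>R e"
    proof (cases "sin d = 0")
      \<comment> \<open>For antipodal points every great circle through p meets y0, so any direction
        orthogonal to p serves.\<close>
      case True
      then have "d = pi" using d d_bounds sin_gt_zero[of d] by force
      then have c: "cos d = -1" by simp
      have "(y0 + p) \<bullet> (y0 + p) = 0"
        using pp yy c cos_d by (simp add: inner_add_left inner_add_right inner_commute)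
      then have "y0 = - p" by (simp add: eq_neg_iff_add_eq_0)
      moreover obtain v where "v \<noteq> 0" "orthogonal p v"
        using orthogonal_to_vector_exists[OF dim, of p] by blast
      ultimately show ?thesis using that[of "sgn v"] c True
        by (simp add: norm_sgn sgn_div_norm orthogonal_def)
    next
      case False
      let ?e = "(y0 - cos d *\<^sub>R p) /\<^sub>R sin d"
      have "(y0 - cos d *\<^sub>R p) \<bullet> (y0 - cos d *\<^sub>R p) = 1 - (cos d)\<^sup>2"
        by (simp add: inner_diff_left inner_diff_right pp yy cos_d inner_commute power2_eq_square)
      also have "\<dots> = (sin d)\<^sup>2" by (simp add: sin_squared_eq)
      finally have v: "(y0 - cos d *\<^sub>R p) \<bullet> (y0 - cos d *\<^sub>R p) = (sin d)\<^sup>2" .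
      have "?e \<bullet> ?e = inverse (sin d) * (inverse (sin d) * ((y0 - cos d *\<^sub>R p) \<bullet> (y0 - cos d *\<^sub>R p)))"
        by (simp only: inner_scaleR_left inner_scaleR_right)
      then have "?e \<bullet> ?e = 1" unfolding v using False by (simp add: power2_eq_square field_simps)
      then have "norm ?e = 1" by (simp add: norm_eq_sqrt_inner)
      moreover have "p \<bullet> ?e = 0" by (simp add: inner_diff_right pp cos_d)
      ultimately show ?thesis using that[of ?e] False by simp
    qed
    have ee: "e \<bullet> e = 1" using e by (simp add: dot_square_norm)
    \<comment> \<open>The velocity at y0 of the great circle that leaves p in the direction e; it
      points away from p.\<close>
    define e' where "e' = cos d *\<^sub>R e - sin d *\<^sub>R p"
    have e': "norm e' = 1" "y0 \<bullet> e' = 0"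
    proof -
      have "e' = cos d *\<^sub>R e + sin d *\<^sub>R (- p)" by (simp add: e'_def)
      then show "norm e' = 1" using norm_great_circle[of e "- p" d] e np by (simp add: inner_commute)
      show "y0 \<bullet> e' = 0"
        using e(2) by (simp add: e(3) e'_def inner_add_left inner_diff_right inner_commute[of e p] pp ee)
    qed
    have curve: "cos t *\<^sub>R y0 + sin t *\<^sub>R e' = cos (d + t) *\<^sub>R p + sin (d + t) *\<^sub>R e" for t
      by (simp add: e(3) e'_def cos_add sin_add algebra_simps)
    have ne: "norm (- e) = 1" "p \<bullet> - e = 0" using e by simp_all
    have "zonal_hess ps p (- e) - zonal_hess ps y0 e' - (- exp (- d / (2 * \<epsilon>)) / \<epsilon>\<^sup>2) \<le> 0"
    proof (rule second_derivative_nonpos_at_max)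
      let ?x = "\<lambda>t. cos t *\<^sub>R p + sin t *\<^sub>R (- e)" and ?y = "\<lambda>t. cos t *\<^sub>R y0 + sin t *\<^sub>R e'"
      let ?h' = "\<lambda>t. zonal_grad ps (?x t) \<bullet> (cos t *\<^sub>R (- e) - sin t *\<^sub>R p)
        - zonal_grad ps (?y t) \<bullet> (cos t *\<^sub>R e' - sin t *\<^sub>R y0) - exp (- (d + 2 * t) / (2 * \<epsilon>)) / \<epsilon>"
      show "((\<lambda>t. zonal ps (?x t) - zonal ps (?y t) - \<psi> (d + 2 * t)) has_real_derivative ?h' t) (at t)" for t
      proof (intro DERIV_diff zonal_great_circle ne np ny e')
        show "((\<lambda>t. \<psi> (d + 2 * t)) has_real_derivative exp (- (d + 2 * t) / (2 * \<epsilon>)) / \<epsilon>) (at t)"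
          unfolding \<psi>_def using \<epsilon> by (auto intro!: derivative_eq_intros simp: field_simps)
      qed
      show "(?h' has_real_derivative zonal_hess ps p (- e) - zonal_hess ps y0 e' - (- exp (- d / (2 * \<epsilon>)) / \<epsilon>\<^sup>2)) (at 0)"
      proof (intro DERIV_diff zonal_great_circle ne np ny e')
        show "((\<lambda>t. exp (- (d + 2 * t) / (2 * \<epsilon>)) / \<epsilon>) has_real_derivative - exp (- d / (2 * \<epsilon>)) / \<epsilon>\<^sup>2) (at 0)"
          using \<epsilon> by (auto intro!: derivative_eq_intros simp: field_simps power2_eq_square)
      qed
      show "0 < d / 2" using d by simp
      fix t :: real assume t: "\<bar>t\<bar> < d / 2"
      have nx': "norm (?x t) = 1" by (rule norm_great_circle) (use ne np in auto)
      have ny': "norm (?y t) = 1" by (rule norm_great_circle) (use e' ny in auto)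
      have "?x t \<bullet> ?y t = cos t * cos (d + t) - sin t * sin (d + t)"
        unfolding curve using e by (simp add: inner_add_left inner_add_right inner_commute[of e p] pp ee inner_diff_left)
      also have "\<dots> = cos (d + 2 * t)" by (simp add: cos_add[of t "d + t", symmetric] add_ac)
      finally have xy: "?x t \<bullet> ?y t = cos (d + 2 * t)" .
      \<comment> \<open>Past pi the distance falls behind d + 2 t. As \<open>\<psi>\<close>
        increases, the inequality still has the direction needed at a maximum.\<close>
      have "arccos (cos (d + 2 * t)) \<le> d + 2 * t"
      proof (cases "d + 2 * t \<le> pi")
        case True
        then show ?thesis using t by (simp add: arccos_cos)
      next
        case False
        then show ?thesis using arccos_ubound[of "cos (d + 2 * t)"] by simp
      qed
      then have "\<psi> (arccos (?x t \<bullet> ?y t)) \<le> \<psi> (d + 2 * t)" unfolding xy by (rule psi_mono)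
      with max[OF nx' ny'] show "zonal ps (?x t) - zonal ps (?y t) - \<psi> (d + 2 * t)
          \<le> zonal ps (?x 0) - zonal ps (?y 0) - \<psi> (d + 2 * 0)"
        by (simp add: w_d)
    qed
    then have A: "zonal_hess ps p (- e) - zonal_hess ps y0 e' \<le> - exp (- d / (2 * \<epsilon>)) / \<epsilon>\<^sup>2" by simp
    have pe: "p \<noteq> e" using e np pp by auto
    have "pairwise orthogonal {p, e}" using e by (auto simp: pairwise_def orthogonal_def inner_commute)
    then obtain W where W: "finite W" "\<And>w. w \<in> W \<Longrightarrow> norm w = 1" "\<And>w s. w \<in> W \<Longrightarrow> s \<in> {p, e} \<Longrightarrow> s \<bullet> w = 0"
      "\<And>a. (\<Sum>w\<in>W. (a \<bullet> w)\<^sup>2) = a \<bullet> a - (\<Sum>s\<in>{p, e}. (a \<bullet> s)\<^sup>2)" "card W + card {p, e} = DIM('a)"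
      using orthonormal_complement[of "{p, e}"] np e by (metis insertE singletonD)
    \<comment> \<open>Since the distance does not grow, the comparison term may be frozen at
      \<open>\<psi> d\<close>, and it contributes no second derivative.\<close>
    have B: "zonal_hess ps p w - zonal_hess ps y0 w \<le> 0" if w: "w \<in> W" for w
    proof (rule second_derivative_nonpos_at_max)
      let ?x = "\<lambda>t. cos t *\<^sub>R p + sin t *\<^sub>R w" and ?y = "\<lambda>t. cos t *\<^sub>R y0 + sin t *\<^sub>R w"
      have pw: "p \<bullet> w = 0" and yw: "y0 \<bullet> w = 0" and nw: "norm w = 1"
        using W(3)[OF w] W(2)[OF w] by (auto simp: e(3) inner_add_left)
      show "((\<lambda>t. zonal ps (?x t) - zonal ps (?y t) - \<psi> d) has_real_derivative
         zonal_grad ps (?x t) \<bullet> (cos t *\<^sub>R w - sin t *\<^sub>R p) - zonal_grad ps (?y t) \<bullet> (cos t *\<^sub>R w - sin t *\<^sub>R y0)) (at t)" for t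
        using DERIV_diff[OF DERIV_diff[OF zonal_great_circle(1)[OF pw np nw] zonal_great_circle(1)[OF yw ny nw]] DERIV_const]
        by simp
      show "((\<lambda>t. zonal_grad ps (?x t) \<bullet> (cos t *\<^sub>R w - sin t *\<^sub>R p) - zonal_grad ps (?y t) \<bullet> (cos t *\<^sub>R w - sin t *\<^sub>R y0))
         has_real_derivative zonal_hess ps p w - zonal_hess ps y0 w) (at 0)"
        by (intro DERIV_diff zonal_great_circle pw yw nw np ny)
      fix t :: real
      have nx': "norm (?x t) = 1" by (rule norm_great_circle) (use pw np nw in auto)
      have ny': "norm (?y t) = 1" by (rule norm_great_circle) (use yw ny nw in auto)
      have ww: "w \<bullet> w = 1" using nw by (simp add: dot_square_norm)
      have "?x t \<bullet> ?y t = (cos t)\<^sup>2 * (p \<bullet> y0) + (sin t)\<^sup>2"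
        using pw yw by (simp add: inner_add_left inner_add_right inner_commute[of w y0] ww power2_eq_square)
      also have "\<dots> = p \<bullet> y0 + (sin t)\<^sup>2 * (1 - p \<bullet> y0)" by (simp add: cos_squared_eq algebra_simps)
      also have "\<dots> \<ge> p \<bullet> y0" using inner[OF np ny] by simp
      finally have "arccos (?x t \<bullet> ?y t) \<le> d"
        unfolding d_def using inner[OF np ny] inner[OF nx' ny'] by (simp add: arccos_le_mono)
      from psi_mono[OF this] max[OF nx' ny']
      show "zonal ps (?x t) - zonal ps (?y t) - \<psi> d \<le> zonal ps (?x 0) - zonal ps (?y 0) - \<psi> d"
        by (simp add: w_d)
    qed (rule zero_less_one)
    have e_notin: "- e \<notin> W" using W(3)[of "- e" e] ee by auto
    have e'_notin: "e' \<notin> W"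
    proof
      assume "e' \<in> W"
      then have "e' \<bullet> e' = 0" using W(3)[of e' e] W(3)[of e' p] by (simp add: e'_def inner_diff_left)
      then show False using e' by simp
    qed
    have "(\<Sum>v\<in>insert (- e) W. zonal_hess ps p v) = zonal_lap ps p"
      by (rule zonal_hess_sum) (use W u e_notin pe in auto)
    moreover have "(\<Sum>v\<in>insert e' W. zonal_hess ps y0 v) = zonal_lap ps y0"
    proof (rule zonal_hess_sum)
      fix a
      \<comment> \<open>y0 and e' arise from p and e by a rotation of their common plane, which
        preserves the sum of the two squared components.\<close>
      have rot: "(c * q + s * r)\<^sup>2 + (c * r - s * q)\<^sup>2 = (s\<^sup>2 + c\<^sup>2) * (q\<^sup>2 + r\<^sup>2)" for c s q r :: real
        by algebra
      have "(a \<bullet> y0)\<^sup>2 + (a \<bullet> e')\<^sup>2 = (a \<bullet> p)\<^sup>2 + (a \<bullet> e)\<^sup>2"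
        using rot[of "cos d" "a \<bullet> p" "sin d" "a \<bullet> e"] by (simp add: e(3) e'_def inner_add_right inner_diff_right)
      then show "(\<Sum>w\<in>insert e' W. (a \<bullet> w)\<^sup>2) = a \<bullet> a - (a \<bullet> y0)\<^sup>2"
        using W(1,4) pe e'_notin by simp
    qed (use W u e'_notin pe in auto)
    ultimately have "zonal_lap ps p - zonal_lap ps y0 =
        zonal_hess ps p (- e) - zonal_hess ps y0 e' + (\<Sum>w\<in>W. zonal_hess ps p w - zonal_hess ps y0 w)"
      using W(1) e_notin e'_notin by (simp add: sum_subtractf)
    also have "\<dots> \<le> - exp (- d / (2 * \<epsilon>)) / \<epsilon>\<^sup>2 + 0"
      using A B by (intro add_mono sum_nonpos)
    finally have "\<epsilon>\<^sup>2 * (zonal_lap ps p - zonal_lap ps y0) \<le> - exp (- d / (2 * \<epsilon>))"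
      using \<epsilon> by (simp add: field_simps)
    moreover have "zonal ps p - \<epsilon>\<^sup>2 * zonal_lap ps p \<le> 1" "0 \<le> zonal ps y0 - \<epsilon>\<^sup>2 * zonal_lap ps y0"
      using f[of p] f[of y0] np ny by auto
    ultimately show ?thesis unfolding w_d \<psi>_def by (simp add: algebra_simps)
  qed
  with max[of x y] xy show ?thesis by (simp add: \<psi>_def)
qed

text \<open>The modulus of continuity has slope 1 / (2 eps) at distance 0. Along the great circle in
  gradient direction a steeper u would exceed it at once.\<close>

lemma zonal_gradient_bound:
  fixes ps :: "(real poly \<times> 'a::euclidean_space) list"
  assumes u: "unit_axes ps" and \<epsilon>: "0 < \<epsilon>" and dim: "2 \<le> DIM('a)"
    and f: "\<And>x. x \<in> sphere 0 1 \<Longrightarrow> zonal ps x - \<epsilon>\<^sup>2 * zonal_lap ps x \<in> {0..1}"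
    and x: "x \<in> sphere 0 1"
  shows "norm (zonal_grad ps x) \<le> 1 / (2 * \<epsilon>)"
proof (cases "zonal_grad ps x = 0")
  case False
  define w where "w = sgn (zonal_grad ps x)"
  have w: "norm w = 1" "x \<bullet> w = 0" "zonal_grad ps x \<bullet> w = norm (zonal_grad ps x)"
    using False zonal_grad_tangent[OF x, of ps]
    by (simp_all add: w_def norm_sgn sgn_div_norm inner_commute dot_square_norm power2_eq_square)
  have nx: "norm x = 1" and xx: "x \<bullet> x = 1" using x by (simp_all add: dot_square_norm)
  define h where "h t = zonal ps (cos t *\<^sub>R x + sin t *\<^sub>R w) - (1 - exp (- t / (2 * \<epsilon>)))" for t
  have "((\<lambda>t. 1 - exp (- t / (2 * \<epsilon>))) has_real_derivative 1 / (2 * \<epsilon>)) (at 0)"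
    using \<epsilon> by (auto intro!: derivative_eq_intros)
  from DERIV_diff[OF zonal_great_circle(1)[OF w(2) nx w(1), of ps 0] this]
  have dh: "(h has_real_derivative (norm (zonal_grad ps x) - 1 / (2 * \<epsilon>))) (at 0)"
    by (simp add: h_def[abs_def] w(3))
  show ?thesis
  proof (rule ccontr)
    assume "\<not> ?thesis"
    then have "0 < norm (zonal_grad ps x) - 1 / (2 * \<epsilon>)" by simp
    from DERIV_pos_inc_right[OF dh this] obtain d where d: "0 < d" "\<And>t. 0 < t \<Longrightarrow> t < d \<Longrightarrow> h 0 < h t"
      by auto
    define t where "t = min (d / 2) 1"
    have t: "0 < t" "t < d" "t < pi" using d pi_gt3 by (auto simp: t_def)
    let ?y = "cos t *\<^sub>R x + sin t *\<^sub>R w"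
    have ny: "norm ?y = 1" by (rule norm_great_circle) (use w nx in auto)
    have "?y \<bullet> x = cos t" using w(2) by (simp add: inner_add_left inner_commute[of w x] xx)
    then have "arccos (?y \<bullet> x) = t" using t by (simp add: arccos_cos)
    with zonal_modulus_of_continuity[OF u \<epsilon> dim f, of ?y x] ny x have "h t \<le> h 0"
      by (simp add: h_def)
    with d(2)[OF t(1,2)] show False by simp
  qed
qed (use \<epsilon> in simp)

section \<open>Approximation of sets\<close>

lemma (in finite_measure) bounded_convergence:
  fixes f :: "'a \<Rightarrow> real" and F :: "nat \<Rightarrow> 'a \<Rightarrow> real"
  assumes "f \<in> borel_measurable M" "\<And>j. F j \<in> borel_measurable M"
    and "AE x in M. (\<lambda>j. F j x) \<longlonglongrightarrow> f x" "\<And>j x. x \<in> space M \<Longrightarrow> \<bar>F j x\<bar> \<le> B"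
  shows "(\<lambda>j. LINT x|M. F j x) \<longlonglongrightarrow> (LINT x|M. f x)"
  by (rule integral_dominated_convergence[where w="\<lambda>_. B"]) (use assms in auto)

text \<open>Up to a null set of the completion the set is Borel. Regularity squeezes it between a
  compact and an open set, a Urysohn function separates these, and zonal sums approximate that
  function.\<close>

lemma sphere_measurable_set_approx:
  fixes \<Omega> :: "'a::euclidean_space set"
  assumes \<Omega>: "\<Omega> \<in> sets sphere_measure" and \<delta>: "0 < \<delta>"
  shows "\<exists>ps. unit_axes ps \<and> (\<forall>x\<in>sphere 0 1. zonal ps x \<in> {0..1}) \<and>
    (LINT x|sphere_measure. \<bar>indicator \<Omega> x - zonal ps x\<bar>) < \<delta>"
proof -
  let ?M = "sphere_measure :: 'a measure"
  interpret finite_measure ?M by (rule finite_measure_sphere)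
  have id[measurable]: "(\<lambda>x. x) \<in> measurable ?M borel"
    by (rule sphere_measure_borel) simp
  have borel_sets: "A \<inter> sphere 0 1 \<in> sets ?M" if "A \<in> sets borel" for A
    using measurable_sets[OF id that] by simp
  obtain S N N' where SN: "\<Omega> = S \<union> N" "N \<subseteq> N'" and N': "N' \<in> null_sets (scale_measure (of_nat DIM('a))
        (distr (restrict_space lborel (ball 0 1 - {0})) (restrict_space borel (sphere (0::'a) 1)) sgn))"
    and S: "S \<in> sets (restrict_space borel (sphere (0::'a) 1))"
    using \<Omega> unfolding sphere_measure_def by (elim sets_completionE) (simp add: sets_scale_measure)
  have "N' \<in> null_sets ?M" unfolding sphere_measure_def using N' by (rule null_sets_completionI)
  then have "AE x in ?M. x \<notin> N'" by (rule AE_not_in)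
  then have ae: "AE x in ?M. indicator \<Omega> x = (indicator S x :: real)"
    by eventually_elim (use SN in \<open>auto simp: indicator_def\<close>)
  have Sb: "S \<in> sets borel" "S \<subseteq> sphere 0 1"
    using S by (subst (asm) sets_restrict_space_iff; auto)+
  have S_M[measurable]: "S \<in> sets ?M" using borel_sets[OF Sb(1)] Sb(2) by (simp add: Int_absorb2)
  \<comment> \<open>The regularity theorems speak of Borel measures on the whole space, hence the
    push-forward along the inclusion.\<close>
  define D where "D = distr ?M borel (\<lambda>x. x)"
  have D: "emeasure D A = emeasure ?M (A \<inter> sphere 0 1)" if "A \<in> sets borel" for A
    unfolding D_def using that by (subst emeasure_distr[OF id]) auto
  have D_fin: "emeasure D A \<noteq> \<infinity>" if "A \<in> sets borel" for A
    using that emeasure_finite by (simp add: D)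
  have [simp]: "sets D = sets borel" "space D = UNIV" by (auto simp: D_def)
  have sp: "emeasure D (space D) \<noteq> \<infinity>" using D_fin[of UNIV] by simp
  have "{K. K \<subseteq> S \<and> compact K} \<noteq> {}" by blast
  then obtain C where C: "C \<subseteq> S" "compact C" "emeasure D S < emeasure D C + ennreal (\<delta> / 4)"
    using SUP_approx_ennreal[OF _ _ inner_regular[OF \<open>sets D = sets borel\<close> sp Sb(1)], of "\<delta> / 4"] \<delta> D_fin[OF Sb(1)] by auto
  obtain U where U: "S \<subseteq> U" "open U" "emeasure D U < emeasure D S + ennreal (\<delta> / 4)"
    using INF_approx_ennreal[OF _ outer_regular[OF \<open>sets D = sets borel\<close> sp Sb(1)], of "\<delta> / 4"] \<delta> D_fin[OF Sb(1)] by auto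
  have Cb: "C \<in> sets borel" "U \<in> sets borel" using C U by (auto intro: borel_compact)
  have CU: "closed C" "closed (- U)" "C \<inter> - U = {}"
    using C U by (auto simp: compact_imp_closed)
  obtain g :: "'a \<Rightarrow> real" where g: "continuous_on UNIV g" "\<And>x. g x \<in> closed_segment 1 0"
      "\<And>x. x \<in> C \<Longrightarrow> g x = 1" "\<And>x. x \<in> - U \<Longrightarrow> g x = 0"
    by (rule Urysohn[OF CU, of "1::real" 0]) blast
  have g01: "g x \<in> {0..1}" for x using g(2)[of x] by (simp add: closed_segment_eq_real_ivl)
  have gc: "continuous_on (sphere 0 1) g" using g(1) continuous_on_subset by blast
  have g_int: "integrable ?M g" by (rule integrable_sphere_continuous[OF gc])
  let ?A = "(U - C) \<inter> sphere 0 1"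
  have A_M[measurable]: "?A \<in> sets ?M" using Cb by (intro borel_sets) auto
  have "measure ?M ?A < \<delta> / 2"
  proof -
    have m: "emeasure D B = ennreal (measure ?M (B \<inter> sphere 0 1))" if "B \<in> sets borel" for B
      using D[OF that] by (simp add: emeasure_eq_measure)
    have "measure ?M (U \<inter> sphere 0 1) < measure ?M (S \<inter> sphere 0 1) + \<delta> / 4"
      "measure ?M (S \<inter> sphere 0 1) < measure ?M (C \<inter> sphere 0 1) + \<delta> / 4"
      using U(3) C(3) \<delta> unfolding m[OF Cb(1)] m[OF Cb(2)] m[OF Sb(1)]
      by (simp_all add: ennreal_plus[symmetric] ennreal_less_iff del: ennreal_plus)
    moreover have "measure ?M ?A = measure ?M (U \<inter> sphere 0 1) - measure ?M (C \<inter> sphere 0 1)"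
    proof -
      have "?A = (U \<inter> sphere 0 1) - (C \<inter> sphere 0 1)" by auto
      then show ?thesis
        using finite_measure_Diff[OF borel_sets[OF Cb(2)] borel_sets[OF Cb(1)]] C(1) U(1) by auto
    qed
    ultimately show ?thesis by linarith
  qed
  moreover have "(LINT x|?M. \<bar>indicator S x - g x\<bar>) \<le> (LINT x|?M. indicator ?A x)"
  proof (rule integral_mono)
    show "integrable ?M (\<lambda>x. \<bar>indicator S x - g x\<bar>)"
      using g_int by (intro integrable_abs Bochner_Integration.integrable_diff) (auto intro!: integrable_real_indicator emeasure_finite simp: less_top[symmetric])
    fix x assume "x \<in> space ?M"
    then show "\<bar>indicator S x - g x\<bar> \<le> indicator ?A x"
      using g01[of x] g(3,4)[of x] C(1) U(1) by (auto simp: indicator_def)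
  qed (auto intro!: integrable_real_indicator emeasure_finite simp: less_top[symmetric])
  ultimately have Sg: "(LINT x|?M. \<bar>indicator S x - g x\<bar>) < \<delta> / 2" by simp
  define B where "B = measure ?M (sphere 0 1)"
  have B: "0 \<le> B" by (simp add: B_def)
  define \<eta> where "\<eta> = \<delta> / (2 * (B + 1))"
  have \<eta>: "0 < \<eta>" "\<eta> * B \<le> \<delta> / 2" using \<delta> B by (auto simp: \<eta>_def field_simps)
  obtain ps where ps: "unit_axes ps" "\<And>x. x \<in> sphere 0 1 \<Longrightarrow> \<bar>g x - zonal ps x\<bar> < \<eta>" "\<And>x. x \<in> sphere 0 1 \<Longrightarrow> zonal ps x \<in> {0..1}"
    using zonal_approx_unit_interval[OF gc _ \<eta>(1)] g01 by blast
  have z_int: "integrable ?M (zonal ps)" by (rule integrable_sphere_continuous[OF zonal_continuous])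
  have "(LINT x|?M. \<bar>indicator \<Omega> x - zonal ps x\<bar>) = (LINT x|?M. \<bar>indicator S x - zonal ps x\<bar>)"
    by (rule integral_cong_AE) (use ae z_int \<Omega> in \<open>auto elim!: eventually_mono\<close>)
  also have "\<dots> \<le> (LINT x|?M. \<bar>indicator S x - g x\<bar> + \<eta>)"
  proof (rule integral_mono)
    have "integrable ?M (indicator S :: 'a \<Rightarrow> real)"
      by (auto intro!: integrable_real_indicator emeasure_finite simp: less_top[symmetric])
    then show "integrable ?M (\<lambda>x. \<bar>indicator S x - zonal ps x\<bar>)" "integrable ?M (\<lambda>x. \<bar>indicator S x - g x\<bar> + \<eta>)"
      using g_int z_int by auto
    show "\<bar>indicator S x - zonal ps x\<bar> \<le> \<bar>indicator S x - g x\<bar> + \<eta>" if "x \<in> space ?M" for x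
      using ps(2)[of x] that by auto
  qed
  also have "\<dots> = (LINT x|?M. \<bar>indicator S x - g x\<bar>) + \<eta> * B"
  proof -
    have "integrable ?M (\<lambda>x. \<bar>indicator S x - g x\<bar>)"
      using g_int by (intro integrable_abs Bochner_Integration.integrable_diff) (auto intro!: integrable_real_indicator emeasure_finite simp: less_top[symmetric])
    then show ?thesis by (simp add: B_def mult.commute)
  qed
  finally have "(LINT x|?M. \<bar>indicator \<Omega> x - zonal ps x\<bar>) < \<delta>" using Sg \<eta> by linarith
  with ps show ?thesis by blast
qed

text \<open>The kernel is merely integrable, so L1 convergence would not pass under the integral. A
  subsequence that converges almost everywhere with values in [0, 1] does, by dominated
  convergence.\<close>

lemma sphere_measurable_set_approx_AE:
  fixes \<Omega> :: "'a::euclidean_space set"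
  assumes \<Omega>: "\<Omega> \<in> sets sphere_measure"
  obtains F where "\<And>j :: nat. unit_axes (F j)" "\<And>j x. x \<in> sphere 0 1 \<Longrightarrow> zonal (F j) x \<in> {0..1}"
    "AE x in sphere_measure. (\<lambda>j. zonal (F j) x) \<longlonglongrightarrow> indicator \<Omega> x"
proof -
  let ?M = "sphere_measure :: 'a measure"
  interpret finite_measure ?M by (rule finite_measure_sphere)
  have "\<forall>j::nat. \<exists>ps. unit_axes ps \<and> (\<forall>x\<in>sphere 0 1. zonal ps x \<in> {0..1}) \<and>
    (LINT x|?M. \<bar>indicator \<Omega> x - zonal ps x\<bar>) < inverse (real (Suc j))"
    using sphere_measurable_set_approx[OF \<Omega>] by simp
  then obtain G where G: "\<And>j::nat. unit_axes (G j)" "\<And>j x. x \<in> sphere 0 1 \<Longrightarrow> zonal (G j) x \<in> {0..1}"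
    "\<And>j. (LINT x|?M. \<bar>indicator \<Omega> x - zonal (G j) x\<bar>) < inverse (real (Suc j))"
    by metis
  define u where "u j x = indicator \<Omega> x - zonal (G j) x" for j x
  have "integrable ?M (u j)" for j
    unfolding u_def using \<Omega>
    by (intro Bochner_Integration.integrable_diff integrable_real_indicator integrable_sphere_continuous zonal_continuous)
       (auto simp: less_top[symmetric])
  moreover have "(\<lambda>j. LINT x|?M. norm (u j x)) \<longlonglongrightarrow> 0"
  proof (rule tendsto_sandwich[OF _ _ tendsto_const LIMSEQ_inverse_real_of_nat])
    show "\<forall>\<^sub>F j in sequentially. (LINT x|?M. norm (u j x)) \<le> inverse (real (Suc j))"
      using G(3) by (auto simp: u_def intro!: always_eventually less_imp_le)
  qed auto
  ultimately obtain r where r: "strict_mono r" "AE x in ?M. (\<lambda>j. u (r j) x) \<longlonglongrightarrow> 0"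
    using tendsto_L1_AE_subseq[of ?M u] by auto
  have "AE x in ?M. (\<lambda>j. zonal (G (r j)) x) \<longlonglongrightarrow> indicator \<Omega> x"
    using r(2)
  proof eventually_elim
    case (elim x)
    from tendsto_diff[OF tendsto_const[of "indicator \<Omega> x"] elim] show ?case by (simp add: u_def)
  qed
  then show ?thesis using that[of "\<lambda>j. G (r j)"] G by auto
qed

section \<open>The Helmholtz resolvent\<close>

locale helmholtz =
  fixes \<epsilon> :: real and K :: "'a::euclidean_space \<Rightarrow> 'a \<Rightarrow> real"
  assumes eps: "0 < \<epsilon>" and dim: "2 \<le> DIM('a)" and kernel: "helmholtz_kernel \<epsilon> K"
begin

abbreviation M :: "'a measure" where "M \<equiv> sphere_measure"

text \<open>The values of \<open>K\<close> on the diagonal are arbitrary, so they need not be measurable.\<close>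

definition k :: "'a \<Rightarrow> 'a \<Rightarrow> real" where "k x y = (if x = y then 0 else K x y)"

sublocale finite_measure M by (rule finite_measure_sphere)

sublocale MM: pair_sigma_finite M M ..

lemma AE_neq: "y \<in> sphere 0 1 \<Longrightarrow> AE x in M. x \<noteq> y"
proof -
  assume y: "y \<in> sphere 0 1"
  have "(\<lambda>x. x) \<in> measurable M borel" by (rule sphere_measure_borel) simp
  from measurable_sets[OF this, of "{y}"] y have "{y} \<in> sets M" by simp
  with emeasure_sphere_singleton[OF dim y] have "{y} \<in> null_sets M" by auto
  from AE_not_in[OF this] show ?thesis by simp
qed

text \<open>Smoothness off the diagonal gives continuity on a Borel set of pairs; elsewhere on the
  product of spheres \<open>k\<close> is 0.\<close>

lemma k_measurable_pair [measurable]: "(\<lambda>z. k (fst z) (snd z)) \<in> borel_measurable (M \<Otimes>\<^sub>M M)"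
proof -
  let ?D = "{(x, y). x \<in> sphere (0::'a) 1 \<and> y \<in> sphere (0::'a) 1 \<and> x \<noteq> y}"
  have cont: "continuous_on ?D (\<lambda>z. K (fst z) (snd z))"
    unfolding continuous_on_eq_continuous_within
  proof
    fix z assume z: "z \<in> ?D"
    from kernel have "smooth_fun_on ?D (\<lambda>(x, y). K x y)" by (simp add: helmholtz_kernel_def)
    from bspec[OF this[unfolded smooth_fun_on_def] z]
    obtain U g where Ug: "open U \<and> z \<in> U \<and> (\<forall>k. Ck_on k U g) \<and> (\<forall>w\<in>?D \<inter> U. g w = (case w of (x, y) \<Rightarrow> K x y))"
      by (elim exE)
    then have "Ck_on 0 U g" and U: "open U" "z \<in> U" by blast+
    then have "continuous_on (?D \<inter> U) g" using continuous_on_subset by force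
    moreover have "g w = K (fst w) (snd w)" if "w \<in> ?D \<inter> U" for w
      using Ug that by (auto simp: case_prod_unfold)
    ultimately have "continuous_on (?D \<inter> U) (\<lambda>z. K (fst z) (snd z))"
      by (subst continuous_on_cong[OF refl]) auto
    then have "continuous (at z within ?D \<inter> U) (\<lambda>z. K (fst z) (snd z))"
      using z U by (simp add: continuous_on_eq_continuous_within)
    then show "continuous (at z within ?D) (\<lambda>z. K (fst z) (snd z))"
      using at_within_nhd[of z U "?D \<inter> U" ?D] U by (simp add: continuous_within Int_assoc)
  qed
  have D: "?D \<in> sets borel"
  proof -
    have "?D = (sphere 0 1 \<times> sphere 0 1) \<inter> - {z. fst z = snd z}" by auto
    moreover have "closed {z :: 'a \<times> 'a. fst z = snd z}" by (intro closed_Collect_eq continuous_intros)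
    moreover have "closed (sphere (0::'a) 1 \<times> sphere (0::'a) 1)" by (intro closed_Times) auto
    ultimately show ?thesis by (metis (no_types, lifting) borel_closed borel_comp sets.Int)
  qed
  have "(\<lambda>z. indicator ?D z *\<^sub>R K (fst z) (snd z)) \<in> borel_measurable borel"
    using D cont by (rule borel_measurable_continuous_on_indicator)
  moreover have "(\<lambda>z. z) \<in> measurable (M \<Otimes>\<^sub>M M) (borel :: ('a \<times> 'a) measure)"
  proof -
    have [measurable]: "(\<lambda>x. x) \<in> measurable M borel" by (rule sphere_measure_borel) simp
    have "(\<lambda>z. (fst z, snd z)) \<in> measurable (M \<Otimes>\<^sub>M M) (borel \<Otimes>\<^sub>M borel)"
      using measurable_compose[OF measurable_fst \<open>(\<lambda>x. x) \<in> measurable M borel\<close>]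
        measurable_compose[OF measurable_snd \<open>(\<lambda>x. x) \<in> measurable M borel\<close>]
      by (intro measurable_Pair) auto
    then show ?thesis by (simp add: borel_prod)
  qed
  ultimately have "(\<lambda>z. indicator ?D z *\<^sub>R K (fst z) (snd z)) \<in> borel_measurable (M \<Otimes>\<^sub>M M)"
    by (rule measurable_compose[rotated])
  then show ?thesis
    by (subst (asm) measurable_cong[of _ _ "\<lambda>z. k (fst z) (snd z)"]) (auto simp: k_def space_pair_measure)
qed

section \<open>Integrals against the kernel\<close>

lemma k_integrable:
  assumes y: "y \<in> sphere 0 1"
  shows "integrable M (\<lambda>x. k x y)"
proof (rule integrable_cong_AE_imp)
  show "integrable M (\<lambda>x. K x y)" using kernel y by (simp add: helmholtz_kernel_def)
  show "(\<lambda>x. k x y) \<in> borel_measurable M"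
    using measurable_compose[OF measurable_Pair2'[of y M M] k_measurable_pair] y by simp
  show "AE x in M. K x y = k x y"
    using AE_neq[OF y] by eventually_elim (simp add: k_def)
qed

lemma integral_k_eq:
  assumes y: "y \<in> sphere 0 1" and g: "g \<in> borel_measurable M"
  shows "(LINT x|M. K x y * g x) = (LINT x|M. k x y * g x)"
proof (rule integral_cong_AE)
  show "AE x in M. K x y * g x = k x y * g x"
    using AE_neq[OF y] by eventually_elim (simp add: k_def)
  have "(\<lambda>x. K x y) \<in> borel_measurable M" "(\<lambda>x. k x y) \<in> borel_measurable M"
    using kernel y k_integrable[OF y] by (auto simp: helmholtz_kernel_def)
  then show "(\<lambda>x. K x y * g x) \<in> borel_measurable M" "(\<lambda>x. k x y * g x) \<in> borel_measurable M"
    using g by auto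
qed

lemma k_mult_integrable:
  assumes "y \<in> sphere 0 1" "g \<in> borel_measurable M" "\<And>x. x \<in> sphere 0 1 \<Longrightarrow> \<bar>g x\<bar> \<le> B"
  shows "integrable M (\<lambda>x. k x y * g x)"
proof (rule Bochner_Integration.integrable_bound[where f="\<lambda>x. B * k x y"])
  show "integrable M (\<lambda>x. B * k x y)" using k_integrable[OF assms(1)] by simp
  have "(\<lambda>x. k x y) \<in> borel_measurable M" using k_integrable[OF assms(1)] by auto
  then show "(\<lambda>x. k x y * g x) \<in> borel_measurable M" using assms(2) by simp
  show "AE x in M. norm (k x y * g x) \<le> norm (B * k x y)"
  proof (rule AE_I2)
    fix x assume "x \<in> space M"
    then have "\<bar>g x\<bar> \<le> B" using assms(3) by simp
    then have "\<bar>k x y\<bar> * \<bar>g x\<bar> \<le> \<bar>k x y\<bar> * \<bar>B\<bar>" by (intro mult_left_mono) auto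
    then show "norm (k x y * g x) \<le> norm (B * k x y)" by (simp add: abs_mult mult.commute)
  qed
qed

lemma k_mult_continuous_integrable:
  assumes "y \<in> sphere 0 1" "continuous_on (sphere 0 1) g"
  shows "integrable M (\<lambda>x. k x y * g x)"
proof -
  have "compact (g ` sphere 0 1)" using assms by (intro compact_continuous_image) auto
  then obtain B where "\<And>x. x \<in> sphere 0 1 \<Longrightarrow> norm (g x) \<le> B"
    by (meson bounded_iff compact_imp_bounded imageI)
  then show ?thesis
    using assms by (intro k_mult_integrable integrable_sphere_continuous(1)) auto
qed

lemma k_zonal:
  assumes "y \<in> sphere 0 1" "unit_axes ps"
  shows "(LINT x|M. k x y * (zonal ps x - \<epsilon>\<^sup>2 * zonal_lap ps x)) = zonal ps y"
proof -
  have "smooth_fun_on (sphere 0 1) (zonal ps)"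
    by (intro polynomial_function_smooth polynomial_function_zonal)
  then have "zonal ps y = (LINT x|M. K x y * (zonal ps x - \<epsilon>\<^sup>2 * laplace_beltrami (zonal ps) x))"
    using kernel assms(1) by (simp add: helmholtz_kernel_def)
  also have "\<dots> = (LINT x|M. K x y * (zonal ps x - \<epsilon>\<^sup>2 * zonal_lap ps x))"
    by (rule Bochner_Integration.integral_cong) (auto simp: laplace_beltrami_zonal assms(2))
  also have "\<dots> = (LINT x|M. k x y * (zonal ps x - \<epsilon>\<^sup>2 * zonal_lap ps x))"
    by (intro integral_k_eq assms integrable_sphere_continuous(1) continuous_intros zonal_continuous zonal_lap_continuous)
  finally show ?thesis ..
qed

text \<open>Testing the kernel with the algebraic solution identifies that solution with the kernel
  integral of its right-hand side. This is how the maximum principles become statements about the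
  kernel.\<close>

lemma resolvent:
  assumes "unit_axes ps"
  obtains qs where "unit_axes qs" "\<And>x. zonal qs x - \<epsilon>\<^sup>2 * zonal_lap qs x = zonal ps x"
    "\<And>y. y \<in> sphere 0 1 \<Longrightarrow> zonal qs y = (LINT x|M. k x y * zonal ps x)"
proof -
  obtain qs where qs: "unit_axes qs" "\<And>x. zonal qs x - \<epsilon>\<^sup>2 * zonal_lap qs x = zonal ps x"
    using zonal_equation_solvable[of "\<epsilon>\<^sup>2" ps] assms by auto
  moreover have "zonal qs y = (LINT x|M. k x y * zonal ps x)" if "y \<in> sphere 0 1" for y
    using k_zonal[OF that qs(1)] by (simp add: qs(2))
  ultimately show ?thesis using that by blast
qed

section \<open>Sign and mass of the kernel\<close>

lemma k_limit:
  assumes "y \<in> sphere 0 1" "\<Omega> \<in> sets M" "\<And>j x. x \<in> sphere 0 1 \<Longrightarrow> zonal (F j) x \<in> {0..1}"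
    "AE x in M. (\<lambda>j. zonal (F j) x) \<longlonglongrightarrow> indicator \<Omega> x"
  shows "(\<lambda>j. LINT x|M. k x y * zonal (F j) x) \<longlonglongrightarrow> (LINT x|M. k x y * indicator \<Omega> x)"
proof (rule integral_dominated_convergence[where w="\<lambda>x. \<bar>k x y\<bar>"])
  have [measurable]: "(\<lambda>x. k x y) \<in> borel_measurable M" using k_integrable[OF assms(1)] by auto
  have [measurable]: "zonal (F j) \<in> borel_measurable M" for j
    by (rule integrable_sphere_continuous[OF zonal_continuous])
  note assms(2)[measurable]
  show "(\<lambda>x. k x y * indicator \<Omega> x) \<in> borel_measurable M" "\<And>j. (\<lambda>x. k x y * zonal (F j) x) \<in> borel_measurable M"
    by measurable
  show "integrable M (\<lambda>x. \<bar>k x y\<bar>)" using k_integrable[OF assms(1)] by simp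
  show "AE x in M. (\<lambda>j. k x y * zonal (F j) x) \<longlonglongrightarrow> k x y * indicator \<Omega> x"
    using assms(4) by eventually_elim (intro tendsto_intros)
  show "AE x in M. norm (k x y * zonal (F j) x) \<le> \<bar>k x y\<bar>" for j
  proof (rule AE_I2)
    fix x assume "x \<in> space M"
    then have "\<bar>zonal (F j) x\<bar> \<le> 1" using assms(3)[of x j] by simp
    then show "norm (k x y * zonal (F j) x) \<le> \<bar>k x y\<bar>" by (simp add: abs_mult mult_left_le)
  qed
qed

text \<open>The indicator of the set where k is negative is a limit of zonal sums with values in
  [0, 1], whose potentials are nonnegative by the minimum principle. So the integral of k over this
  set is both nonnegative and nonpositive.\<close>

lemma k_nonneg:
  assumes y: "y \<in> sphere 0 1"
  shows "AE x in M. 0 \<le> k x y"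
proof -
  have [measurable]: "(\<lambda>x. k x y) \<in> borel_measurable M" using k_integrable[OF y] by auto
  define \<Omega> where "\<Omega> = {x \<in> space M. k x y < 0}"
  have \<Omega>[measurable]: "\<Omega> \<in> sets M" unfolding \<Omega>_def by measurable
  obtain F where F: "\<And>j :: nat. unit_axes (F j)" "\<And>j x. x \<in> sphere 0 1 \<Longrightarrow> zonal (F j) x \<in> {0..1}"
    "AE x in M. (\<lambda>j. zonal (F j) x) \<longlonglongrightarrow> indicator \<Omega> x"
    using sphere_measurable_set_approx_AE[OF \<Omega>] by blast
  have "0 \<le> (LINT x|M. k x y * zonal (F j) x)" for j
  proof -
    obtain qs where qs: "unit_axes qs" "\<And>x. zonal qs x - \<epsilon>\<^sup>2 * zonal_lap qs x = zonal (F j) x"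
      "\<And>y. y \<in> sphere 0 1 \<Longrightarrow> zonal qs y = (LINT x|M. k x y * zonal (F j) x)"
      using resolvent[OF F(1)] by blast
    have "0 \<le> zonal qs y"
      by (rule zonal_minimum_principle[OF qs(1), of "\<epsilon>\<^sup>2"]) (use qs(2) F(2) y in auto)
    then show ?thesis using qs(3)[OF y] by simp
  qed
  with k_limit[OF y \<Omega> F(2,3)] have "0 \<le> (LINT x|M. k x y * indicator \<Omega> x)"
    by (intro LIMSEQ_le_const) auto
  moreover have "(LINT x|M. - (k x y * indicator \<Omega> x)) = - (LINT x|M. k x y * indicator \<Omega> x)"
    by simp
  moreover have int: "integrable M (\<lambda>x. - (k x y * indicator \<Omega> x))"
    by (intro Bochner_Integration.integrable_minus k_mult_integrable[OF y, where B=1]) (auto simp: indicator_def)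
  moreover have nn: "AE x in M. 0 \<le> - (k x y * indicator \<Omega> x)"
    by (auto simp: \<Omega>_def indicator_def)
  ultimately have "(LINT x|M. - (k x y * indicator \<Omega> x)) = 0"
    using integral_nonneg_AE[OF nn] by linarith
  then have "AE x in M. - (k x y * indicator \<Omega> x) = 0"
    using integral_nonneg_eq_0_iff_AE[OF int nn] by simp
  moreover have "AE x in M. x \<in> space M" by (rule AE_space)
  ultimately show ?thesis
    by eventually_elim (auto simp: \<Omega>_def indicator_def split: if_splits)
qed

lemma k_mass:
  assumes y: "y \<in> sphere 0 1"
  shows "(LINT x|M. k x y) = 1"
  \<comment> \<open>The test function is the constant 1; y serves as an arbitrary unit axis.\<close>
  using k_zonal[OF y, of "[([:1:], y)]"] y by (simp add: pderiv_pCons)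

end

section \<open>The nonlocal term and the perimeter\<close>

context helmholtz
begin

definition smoothed :: "'a set \<Rightarrow> 'a \<Rightarrow> real" where
  "smoothed \<Omega> y = (LINT x|M. k x y * indicator \<Omega> x)"

definition nonlocal :: "'a set \<Rightarrow> real" where
  "nonlocal \<Omega> = 1 / \<epsilon> * (LINT (x, y)|(M \<Otimes>\<^sub>M M). K x y * \<bar>indicator \<Omega> x - indicator \<Omega> y\<bar>)"

text \<open>Every estimate for \<open>smoothed\<close> is proved for pairs \<open>F j\<close>,
  \<open>G j\<close> that solve the equation exactly, and then passes to the limit. The range of
  \<open>G j\<close> comes from the positivity and unit mass of the kernel.\<close>

lemma smoothed_approx:
  assumes \<Omega>: "\<Omega> \<in> sets M"
  obtains F G where "\<And>j :: nat. unit_axes (F j)" "\<And>j. unit_axes (G j)"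
    "\<And>j x. zonal (G j) x - \<epsilon>\<^sup>2 * zonal_lap (G j) x = zonal (F j) x"
    "\<And>j x. x \<in> sphere 0 1 \<Longrightarrow> zonal (F j) x \<in> {0..1}"
    "\<And>j x. x \<in> sphere 0 1 \<Longrightarrow> zonal (G j) x \<in> {0..1}"
    "AE x in M. (\<lambda>j. zonal (F j) x) \<longlonglongrightarrow> indicator \<Omega> x"
    "\<And>y. y \<in> sphere 0 1 \<Longrightarrow> (\<lambda>j. zonal (G j) y) \<longlonglongrightarrow> smoothed \<Omega> y"
proof -
  obtain F where F: "\<And>j :: nat. unit_axes (F j)" "\<And>j x. x \<in> sphere 0 1 \<Longrightarrow> zonal (F j) x \<in> {0..1}"
    "AE x in M. (\<lambda>j. zonal (F j) x) \<longlonglongrightarrow> indicator \<Omega> x"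
    using sphere_measurable_set_approx_AE[OF \<Omega>] by blast
  have "\<exists>qs. unit_axes qs \<and> (\<forall>x. zonal qs x - \<epsilon>\<^sup>2 * zonal_lap qs x = zonal (F j) x) \<and>
      (\<forall>y\<in>sphere 0 1. zonal qs y = (LINT x|M. k x y * zonal (F j) x))" for j
    by (rule resolvent[OF F(1)]) blast
  then obtain G where G: "\<And>j. unit_axes (G j)" "\<And>j x. zonal (G j) x - \<epsilon>\<^sup>2 * zonal_lap (G j) x = zonal (F j) x"
    "\<And>j y. y \<in> sphere 0 1 \<Longrightarrow> zonal (G j) y = (LINT x|M. k x y * zonal (F j) x)"
    by metis
  have G01: "zonal (G j) y \<in> {0..1}" if y: "y \<in> sphere 0 1" for j y
  proof -
    have kF: "AE x in M. 0 \<le> k x y * zonal (F j) x \<and> k x y * zonal (F j) x \<le> k x y"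
      using k_nonneg[OF y] AE_space
    proof eventually_elim
      case (elim x)
      then show ?case using F(2)[of x j] by (simp add: mult_left_le)
    qed
    have int: "integrable M (\<lambda>x. k x y * zonal (F j) x)"
      by (rule k_mult_continuous_integrable[OF y zonal_continuous])
    have "0 \<le> (LINT x|M. k x y * zonal (F j) x)"
      by (rule integral_nonneg_AE) (use kF in \<open>auto elim: eventually_mono\<close>)
    moreover have "(LINT x|M. k x y * zonal (F j) x) \<le> (LINT x|M. k x y)"
      by (rule integral_mono_AE[OF int k_integrable[OF y]]) (use kF in \<open>auto elim: eventually_mono\<close>)
    ultimately show ?thesis by (simp add: G(3)[OF y] k_mass[OF y])
  qed
  have "(\<lambda>j. zonal (G j) y) \<longlonglongrightarrow> smoothed \<Omega> y" if y: "y \<in> sphere 0 1" for y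
    using k_limit[OF y \<Omega> F(2,3)] by (simp add: G(3)[OF y] smoothed_def)
  then show ?thesis by (intro that[of F G] F G(1,2) G01)
qed

lemma
  assumes \<Omega>: "\<Omega> \<in> sets M"
  shows smoothed_measurable: "smoothed \<Omega> \<in> borel_measurable M"
    and smoothed_range: "y \<in> sphere 0 1 \<Longrightarrow> smoothed \<Omega> y \<in> {0..1}"
    and integral_smoothed: "(LINT y|M. smoothed \<Omega> y) = (LINT y|M. indicator \<Omega> y)"
proof -
  obtain F G where FG: "\<And>j :: nat. unit_axes (F j)" "\<And>j. unit_axes (G j)"
    "\<And>j x. zonal (G j) x - \<epsilon>\<^sup>2 * zonal_lap (G j) x = zonal (F j) x"
    "\<And>j x. x \<in> sphere 0 1 \<Longrightarrow> zonal (F j) x \<in> {0..1}"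
    "\<And>j x. x \<in> sphere 0 1 \<Longrightarrow> zonal (G j) x \<in> {0..1}"
    "AE x in M. (\<lambda>j. zonal (F j) x) \<longlonglongrightarrow> indicator \<Omega> x"
    "\<And>y. y \<in> sphere 0 1 \<Longrightarrow> (\<lambda>j. zonal (G j) y) \<longlonglongrightarrow> smoothed \<Omega> y"
    using smoothed_approx[OF \<Omega>] by blast
  have meas: "zonal ps \<in> borel_measurable M" for ps
    by (rule integrable_sphere_continuous[OF zonal_continuous])
  show sm: "smoothed \<Omega> \<in> borel_measurable M"
    by (rule borel_measurable_LIMSEQ_real[of M "\<lambda>j. zonal (G j)"]) (use FG(7) meas in auto)
  show "smoothed \<Omega> y \<in> {0..1}" if y: "y \<in> sphere 0 1"
    using FG(5)[OF y] by (intro Lim_in_closed_set[OF _ _ _ FG(7)[OF y]]) auto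
  have "(\<lambda>j. LINT y|M. zonal (G j) y) \<longlonglongrightarrow> (LINT y|M. smoothed \<Omega> y)"
  proof (rule bounded_convergence[OF sm meas, where B=1])
    show "\<bar>zonal (G j) x\<bar> \<le> 1" if "x \<in> space M" for j x
      using FG(5)[of x j] that by simp
  qed (use FG(7) in auto)
  moreover have "(\<lambda>j. LINT y|M. zonal (F j) y) \<longlonglongrightarrow> (LINT y|M. indicator \<Omega> y)"
  proof (rule bounded_convergence[OF _ meas FG(6), where B=1])
    show "\<bar>zonal (F j) x\<bar> \<le> 1" if "x \<in> space M" for j x
      using FG(4)[of x j] that by simp
  qed (use \<Omega> in auto)
  \<comment> \<open>\<open>k_mass\<close> integrates over the first argument of the kernel.
    Conservation of the integral concerns the second one and comes from the divergence theorem: the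
    Laplacian integrates to 0.\<close>
  moreover have "(LINT y|M. zonal (F j) y) = (LINT y|M. zonal (G j) y)" for j
  proof -
    have "(LINT y|M. zonal_lap (G j) y) = (LINT y|M. sphere_div (zonal_grad (G j)) y)"
      by (rule Bochner_Integration.integral_cong) (auto simp: sphere_div_zonal_grad FG(2))
    also have "\<dots> = 0"
      by (intro sphere_divergence_theorem C1_sphere_zonal_grad zonal_grad_tangent)
    finally have lap: "(LINT y|M. zonal_lap (G j) y) = 0" .
    have "(LINT y|M. zonal (F j) y) = (LINT y|M. zonal (G j) y - \<epsilon>\<^sup>2 * zonal_lap (G j) y)"
      by (simp add: FG(3))
    also have "\<dots> = (LINT y|M. zonal (G j) y) - \<epsilon>\<^sup>2 * (LINT y|M. zonal_lap (G j) y)"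
      by (subst Bochner_Integration.integral_diff)
         (auto intro!: integrable_sphere_continuous zonal_continuous zonal_lap_continuous)
    finally show ?thesis by (simp add: lap)
  qed
  ultimately show "(LINT y|M. smoothed \<Omega> y) = (LINT y|M. indicator \<Omega> y)"
    using LIMSEQ_unique by auto
qed

lemma integrable_bounded:
  fixes f :: "'a \<Rightarrow> real"
  assumes "f \<in> borel_measurable M" "\<And>x. x \<in> sphere 0 1 \<Longrightarrow> \<bar>f x\<bar> \<le> B"
  shows "integrable M f"
  by (rule integrable_const_bound[of _ B]) (use assms in auto)

text \<open>For indicators |a - b| = a + b - 2 a b, and smoothing preserves the integral, so the two
  linear terms agree. The same expression is |chi - u| for 0 \<le> u \<le> 1, which gives the L1
  distance.\<close>

lemma nonlocal_eq:
  assumes \<Omega>: "\<Omega> \<in> sets M"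
  shows "nonlocal \<Omega> = 2 / \<epsilon> * (LINT y|M. indicator \<Omega> y * (indicator \<Omega> y - smoothed \<Omega> y))"
    and "(LINT y|M. \<bar>indicator \<Omega> y - smoothed \<Omega> y\<bar>) = \<epsilon> * nonlocal \<Omega>"
proof -
  note \<Omega>[measurable] smoothed_measurable[OF \<Omega>, measurable]
  \<comment> \<open>Tonelli with the unit mass: the double integral of |k| is the volume of the
    sphere.\<close>
  have k_int: "integrable (M \<Otimes>\<^sub>M M) (\<lambda>z. k (fst z) (snd z))"
  proof (rule integrableI_bounded)
    have "(\<integral>\<^sup>+z. ennreal (norm (k (fst z) (snd z))) \<partial>(M \<Otimes>\<^sub>M M)) = (\<integral>\<^sup>+y. (\<integral>\<^sup>+x. ennreal (norm (k x y)) \<partial>M) \<partial>M)"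
      by (subst MM.nn_integral_snd[symmetric]) auto
    also have "\<dots> = (\<integral>\<^sup>+y. 1 \<partial>M)"
    proof (rule nn_integral_cong)
      fix y assume "y \<in> space M"
      then have y: "y \<in> sphere 0 1" by simp
      have "(\<integral>\<^sup>+x. ennreal (norm (k x y)) \<partial>M) = (\<integral>\<^sup>+x. ennreal (k x y) \<partial>M)"
        by (rule nn_integral_cong_AE) (use k_nonneg[OF y] in \<open>auto elim!: eventually_mono\<close>)
      also have "\<dots> = ennreal (LINT x|M. k x y)"
        by (rule nn_integral_eq_integral[OF k_integrable[OF y] k_nonneg[OF y]])
      finally show "(\<integral>\<^sup>+x. ennreal (norm (k x y)) \<partial>M) = 1" by (simp add: k_mass[OF y])
    qed
    also have "\<dots> < \<infinity>" using emeasure_finite[of "space M"] by (simp add: less_top[symmetric] del: space_sphere_measure)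
    finally show "(\<integral>\<^sup>+z. ennreal (norm (k (fst z) (snd z))) \<partial>(M \<Otimes>\<^sub>M M)) < \<infinity>" .
  qed simp
  let ?f = "\<lambda>x y. k x y * \<bar>indicator \<Omega> x - indicator \<Omega> y\<bar>"
  have f_int: "integrable (M \<Otimes>\<^sub>M M) (case_prod ?f)"
  proof (rule Bochner_Integration.integrable_bound[OF k_int])
    show "AE z in M \<Otimes>\<^sub>M M. norm (case_prod ?f z) \<le> norm (k (fst z) (snd z))"
      by (auto simp: case_prod_unfold abs_mult indicator_def)
  qed (simp add: case_prod_unfold)
  have "(LINT (x, y)|(M \<Otimes>\<^sub>M M). K x y * \<bar>indicator \<Omega> x - indicator \<Omega> y\<bar>) = (LINT (x, y)|(M \<Otimes>\<^sub>M M). ?f x y)"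
    by (rule Bochner_Integration.integral_cong) (auto simp: k_def)
  also have "\<dots> = (LINT y|M. (LINT x|M. ?f x y))"
    by (rule MM.integral_snd[OF f_int, symmetric])
  also have "\<dots> = (LINT y|M. smoothed \<Omega> y + indicator \<Omega> y - 2 * (indicator \<Omega> y * smoothed \<Omega> y))"
  proof (rule Bochner_Integration.integral_cong)
    fix y assume "y \<in> space M"
    then have y: "y \<in> sphere 0 1" by simp
    have kO: "integrable M (\<lambda>x. k x y * indicator \<Omega> x)"
      by (rule k_mult_integrable[OF y, where B=1]) (auto simp: indicator_def)
    have "(LINT x|M. ?f x y) = (LINT x|M. k x y * indicator \<Omega> x + indicator \<Omega> y * k x y - 2 * indicator \<Omega> y * (k x y * indicator \<Omega> x))"
      by (rule Bochner_Integration.integral_cong) (auto simp: indicator_def)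
    also have "\<dots> = smoothed \<Omega> y + indicator \<Omega> y * (LINT x|M. k x y) - 2 * indicator \<Omega> y * smoothed \<Omega> y"
      using kO k_integrable[OF y] by (simp add: smoothed_def)
    finally show "(LINT x|M. ?f x y) = smoothed \<Omega> y + indicator \<Omega> y - 2 * (indicator \<Omega> y * smoothed \<Omega> y)"
      by (simp add: k_mass[OF y])
  qed simp
  finally have 1: "(LINT (x, y)|(M \<Otimes>\<^sub>M M). K x y * \<bar>indicator \<Omega> x - indicator \<Omega> y\<bar>)
      = (LINT y|M. smoothed \<Omega> y + indicator \<Omega> y - 2 * (indicator \<Omega> y * smoothed \<Omega> y))" .
  have ints: "integrable M (smoothed \<Omega>)" "integrable M (indicator \<Omega> :: 'a \<Rightarrow> real)"
      "integrable M (\<lambda>y. indicator \<Omega> y * smoothed \<Omega> y)"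
    using smoothed_range[OF \<Omega>] by (auto intro!: integrable_bounded[where B=1] simp: indicator_def)
  have "(LINT y|M. smoothed \<Omega> y + indicator \<Omega> y - 2 * (indicator \<Omega> y * smoothed \<Omega> y))
      = 2 * ((LINT y|M. indicator \<Omega> y) - (LINT y|M. indicator \<Omega> y * smoothed \<Omega> y))"
    using ints by (simp add: integral_smoothed[OF \<Omega>])
  also have "(LINT y|M. indicator \<Omega> y) - (LINT y|M. indicator \<Omega> y * smoothed \<Omega> y)
      = (LINT y|M. indicator \<Omega> y - indicator \<Omega> y * smoothed \<Omega> y)"
    using ints by simp
  also have "\<dots> = (LINT y|M. indicator \<Omega> y * (indicator \<Omega> y - smoothed \<Omega> y))"
    by (rule Bochner_Integration.integral_cong) (auto simp: indicator_def)
  finally have 2: "(LINT y|M. smoothed \<Omega> y + indicator \<Omega> y - 2 * (indicator \<Omega> y * smoothed \<Omega> y))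
      = 2 * (LINT y|M. indicator \<Omega> y * (indicator \<Omega> y - smoothed \<Omega> y))" .
  show N: "nonlocal \<Omega> = 2 / \<epsilon> * (LINT y|M. indicator \<Omega> y * (indicator \<Omega> y - smoothed \<Omega> y))"
    by (simp add: nonlocal_def 1 2)
  have "(LINT y|M. \<bar>indicator \<Omega> y - smoothed \<Omega> y\<bar>) = (LINT y|M. smoothed \<Omega> y + indicator \<Omega> y - 2 * (indicator \<Omega> y * smoothed \<Omega> y))"
    by (rule Bochner_Integration.integral_cong) (use smoothed_range[OF \<Omega>] in \<open>auto simp: indicator_def\<close>)
  then show "(LINT y|M. \<bar>indicator \<Omega> y - smoothed \<Omega> y\<bar>) = \<epsilon> * nonlocal \<Omega>"
    using eps by (simp add: N 2)
qed

text \<open>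
  If \<open>u - \<epsilon>\<^sup>2 \<Delta> u = f\<close> with \<open>0 \<le> f \<le> 1\<close>, then \<open>- 2 \<epsilon> \<nabla> u\<close> is an admissible vector field
  by the gradient bound, with divergence \<open>2 (f - u) / \<epsilon>\<close>.
\<close>

lemma nonlocal_le_Per:
  assumes \<Omega>: "\<Omega> \<in> sets M"
  shows "ereal (nonlocal \<Omega>) \<le> Per \<Omega>"
proof -
  obtain F G where FG: "\<And>j :: nat. unit_axes (F j)" "\<And>j. unit_axes (G j)"
    "\<And>j x. zonal (G j) x - \<epsilon>\<^sup>2 * zonal_lap (G j) x = zonal (F j) x"
    "\<And>j x. x \<in> sphere 0 1 \<Longrightarrow> zonal (F j) x \<in> {0..1}"
    "\<And>j x. x \<in> sphere 0 1 \<Longrightarrow> zonal (G j) x \<in> {0..1}"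
    "AE x in M. (\<lambda>j. zonal (F j) x) \<longlonglongrightarrow> indicator \<Omega> x"
    "\<And>y. y \<in> sphere 0 1 \<Longrightarrow> (\<lambda>j. zonal (G j) y) \<longlonglongrightarrow> smoothed \<Omega> y"
    using smoothed_approx[OF \<Omega>] by blast
  have meas[measurable]: "zonal ps \<in> borel_measurable M" for ps
    by (rule integrable_sphere_continuous[OF zonal_continuous])
  note \<Omega>[measurable] smoothed_measurable[OF \<Omega>, measurable]
  have "ereal (LINT x|M. indicator \<Omega> x * (2 / \<epsilon> * (zonal (F j) x - zonal (G j) x))) \<le> Per \<Omega>" for j
  proof -
    define X where "X x = (- 2 * \<epsilon>) *\<^sub>R zonal_grad (G j) x" for x
    have "real_polynomial_function (\<lambda>x. X x \<bullet> b)" if "b \<in> Basis" for b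
      using real_polynomial_function.intros(4)[OF real_polynomial_function.intros(2)[of "- 2 * \<epsilon>"], of "\<lambda>x. zonal_grad (G j) x \<bullet> b"]
        polynomial_function_zonal_grad[of "G j"] that
      by (simp add: X_def polynomial_function_iff_Basis_inner)
    then have "smooth_fun_on (sphere 0 1) X"
      by (intro polynomial_function_smooth) (simp add: polynomial_function_iff_Basis_inner)
    then have svf: "smooth_vector_field X"
      by (simp add: smooth_vector_field_def X_def zonal_grad_tangent)
    have "norm (X x) \<le> 1" if x: "x \<in> sphere 0 1" for x
    proof -
      have "norm (zonal_grad (G j) x) \<le> 1 / (2 * \<epsilon>)"
        using zonal_gradient_bound[OF FG(2) eps dim _ x, of j] FG(3,4) by simp
      then show ?thesis using eps by (simp add: X_def field_simps)
    qed
    with svf have "ereal (LINT x|M. indicator \<Omega> x * sphere_div X x) \<le> Per \<Omega>"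
      unfolding Per_def total_variation_def by (intro SUP_upper) auto
    also have "(LINT x|M. indicator \<Omega> x * sphere_div X x) = (LINT x|M. indicator \<Omega> x * (2 / \<epsilon> * (zonal (F j) x - zonal (G j) x)))"
    proof (rule Bochner_Integration.integral_cong)
      fix x assume "x \<in> space M"
      then have x: "x \<in> sphere 0 1" by simp
      have c: "C1_sphere (\<lambda>x::'a. - 2 * \<epsilon>)"
        by (rule C1_sphereI[of _ "\<lambda>x v. 0"]) (auto simp: o_def)
      have g: "sphere_grad (\<lambda>x::'a. - 2 * \<epsilon>) x = 0"
        by (simp add: sphere_grad_def o_def frechet_derivative_const)
      have "sphere_div X x = - 2 * \<epsilon> * zonal_lap (G j) x"
        using sphere_div_scaleR(2)[OF c C1_sphere_zonal_grad x, of "G j", unfolded g] x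
        by (simp add: X_def[abs_def] sphere_div_zonal_grad FG(2))
      also have "\<dots> = 2 / \<epsilon> * (zonal (F j) x - zonal (G j) x)"
        unfolding FG(3)[of j x, symmetric] using eps by (simp add: field_simps power2_eq_square)
      finally show "indicator \<Omega> x * sphere_div X x = indicator \<Omega> x * (2 / \<epsilon> * (zonal (F j) x - zonal (G j) x))"
        by simp
    qed simp
    finally show ?thesis .
  qed
  moreover have "(\<lambda>j. LINT x|M. indicator \<Omega> x * (2 / \<epsilon> * (zonal (F j) x - zonal (G j) x)))
      \<longlonglongrightarrow> (LINT x|M. indicator \<Omega> x * (2 / \<epsilon> * (indicator \<Omega> x - smoothed \<Omega> x)))"
  proof (rule bounded_convergence[where B="2 / \<epsilon>"])
    show "AE x in M. (\<lambda>j. indicator \<Omega> x * (2 / \<epsilon> * (zonal (F j) x - zonal (G j) x)))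
        \<longlonglongrightarrow> indicator \<Omega> x * (2 / \<epsilon> * (indicator \<Omega> x - smoothed \<Omega> x))"
      using FG(6) AE_space by eventually_elim (intro tendsto_intros FG(7); simp)
    show "\<bar>indicator \<Omega> x * (2 / \<epsilon> * (zonal (F j) x - zonal (G j) x))\<bar> \<le> 2 / \<epsilon>" if "x \<in> space M" for j x
    proof -
      have "\<bar>zonal (F j) x - zonal (G j) x\<bar> \<le> 1" using FG(4,5)[of x j] that by auto
      then have "\<bar>indicator \<Omega> x\<bar> * (\<bar>2 / \<epsilon>\<bar> * \<bar>zonal (F j) x - zonal (G j) x\<bar>) \<le> 1 * (2 / \<epsilon> * 1)"
        using eps by (intro mult_mono) (auto simp: indicator_def)
      then show ?thesis by (simp only: abs_mult mult_1 mult_1_right)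
    qed
  qed simp_all
  moreover have "(LINT x|M. indicator \<Omega> x * (2 / \<epsilon> * (indicator \<Omega> x - smoothed \<Omega> x))) = nonlocal \<Omega>"
    unfolding nonlocal_eq(1)[OF \<Omega>] integral_mult_right_zero[symmetric] by (simp only: mult.left_commute)
  ultimately show ?thesis
    by (intro LIMSEQ_le_const2[OF tendsto_ereal[of _ "nonlocal \<Omega>"]]) auto
qed

end

text \<open>
  The Modica--Mortola potential: \<open>\<Phi>' s = 4 min s (1 - s)\<close> on \<open>[0, 1]\<close>, with
  \<open>\<Phi> 0 = 0\<close> and \<open>\<Phi> 1 = 1\<close>.
\<close>

definition mm_potential :: "real \<Rightarrow> real" where
  "mm_potential s = 2 * s\<^sup>2 - 4 * (max 0 (s - 1 / 2))\<^sup>2"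

lemma mm_potential_0_1 [simp]: "mm_potential 0 = 0" "mm_potential 1 = 1"
  by (auto simp: mm_potential_def power2_eq_square)

lemma has_real_derivative_max_squared:
  "((\<lambda>s. (max 0 s)\<^sup>2) has_real_derivative 2 * max 0 s) (at (s::real))"
proof -
  consider "s < 0" | "s > 0" | "s = 0" by linarith
  then show ?thesis
  proof cases
    case 1
    have "((\<lambda>s::real. 0) has_real_derivative 2 * max 0 s) (at s)" using 1 by simp
    then show ?thesis
      by (rule has_field_derivative_transform_within_open[of _ _ _ "{..<0}"]) (use 1 in auto)
  next
    case 2
    have "((\<lambda>s::real. s\<^sup>2) has_real_derivative 2 * max 0 s) (at s)"
      using 2 by (auto intro!: derivative_eq_intros)
    then show ?thesis
      by (rule has_field_derivative_transform_within_open[of _ _ _ "{0<..}"]) (use 2 in auto)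
  next
    case 3
    have "((\<lambda>h::real. (max 0 h)\<^sup>2 / h) \<longlongrightarrow> 0) (at 0)"
    proof (rule Lim_null_comparison)
      show "\<forall>\<^sub>F h::real in at 0. norm ((max 0 h)\<^sup>2 / h) \<le> \<bar>h\<bar>"
        by (auto intro!: always_eventually simp: max_def power2_eq_square)
      show "((\<lambda>h::real. \<bar>h\<bar>) \<longlongrightarrow> 0) (at 0)" by (intro tendsto_rabs_zero tendsto_ident_at)
    qed
    then show ?thesis using 3 by (simp add: DERIV_def)
  qed
qed

text \<open>Past 1 / 2 the correction lowers the slope 4 s by 8 (s - 1 / 2), which leaves 4 (1 -
  s).\<close>

lemma mm_potential_deriv: "(mm_potential has_real_derivative 4 * min s (1 - s)) (at s)"
proof -
  have "((\<lambda>s. (max 0 (s - 1 / 2))\<^sup>2) has_real_derivative 2 * max 0 (s - 1 / 2) * 1) (at s)"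
    by (rule DERIV_chain2[OF has_real_derivative_max_squared]) (auto intro!: derivative_eq_intros)
  moreover have "((\<lambda>s. 2 * s\<^sup>2) has_real_derivative 4 * s) (at s)"
    by (auto intro!: derivative_eq_intros)
  ultimately have "((\<lambda>s. 2 * s\<^sup>2 - 4 * (max 0 (s - 1 / 2))\<^sup>2) has_real_derivative 4 * s - 4 * (2 * max 0 (s - 1 / 2) * 1)) (at s)"
    by (intro DERIV_diff DERIV_cmult)
  then have "((\<lambda>s. 2 * s\<^sup>2 - 4 * (max 0 (s - 1 / 2))\<^sup>2) has_real_derivative 4 * s - 4 * (2 * max 0 (s - 1 / 2))) (at s)"
    by simp
  moreover have "4 * s - 4 * (2 * max 0 (s - 1 / 2)) = 4 * min s (1 - s)"
    by (auto simp: max_def min_def)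
  ultimately show ?thesis by (simp add: mm_potential_def[abs_def])
qed

lemma mm_potential_lipschitz:
  assumes "s \<in> {0..1}" "t \<in> {0..1}"
  shows "\<bar>mm_potential s - mm_potential t\<bar> \<le> 2 * \<bar>s - t\<bar>"
proof -
  have "norm (mm_potential s - mm_potential t) \<le> 2 * norm (s - t)"
  proof (rule field_differentiable_bound[of "{0..1}" mm_potential "\<lambda>s. 4 * min s (1 - s)"])
    show "(mm_potential has_field_derivative 4 * min z (1 - z)) (at z within {0..1})" for z
      by (rule has_field_derivative_at_within[OF mm_potential_deriv])
    show "norm (4 * min z (1 - z)) \<le> 2" if "z \<in> {0..1}" for z :: real
      using that by (auto simp: min_def)
  qed (use assms in auto)
  then show ?thesis by simp
qed

lemma mm_potential_continuous: "continuous_on A mm_potential"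
  by (intro continuous_at_imp_continuous_on ballI DERIV_isCont[OF mm_potential_deriv])

lemma C1_sphere_mm_potential:
  "C1_sphere (\<lambda>x. mm_potential (zonal ps x))"
  "x \<in> sphere 0 1 \<Longrightarrow> sphere_grad (\<lambda>x. mm_potential (zonal ps x)) x = (4 * min (zonal ps x) (1 - zonal ps x)) *\<^sub>R zonal_grad ps x"
proof -
  have der: "(((\<lambda>x. mm_potential (zonal ps x)) \<circ> sgn) has_derivative
      (\<lambda>v. 4 * min (zonal ps x) (1 - zonal ps x) * (zonal_grad ps x \<bullet> v))) (at x)"
    if x: "x \<in> sphere 0 1" for x :: 'a
  proof -
    have sx: "x \<noteq> 0" "sgn x = x" "norm x = 1" using x by (auto simp: sgn_div_norm)
    have "((\<lambda>z. zonal ps (sgn z)) has_derivative (\<lambda>v. zonal_grad ps x \<bullet> v)) (at x)"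
      using zonal_has_derivative[OF sx(1), of ps] sx by (simp add: o_def)
    from has_derivative_compose[OF this mm_potential_deriv[unfolded has_field_derivative_def]]
    show ?thesis by (simp add: o_def sx)
  qed
  show C1: "C1_sphere (\<lambda>x. mm_potential (zonal ps x))"
    by (rule C1_sphereI[OF der]) (auto intro!: continuous_intros zonal_continuous zonal_grad_continuous)
  assume x: "x \<in> sphere 0 1"
  have "sphere_grad (\<lambda>x. mm_potential (zonal ps x)) x \<bullet> v = ((4 * min (zonal ps x) (1 - zonal ps x)) *\<^sub>R zonal_grad ps x) \<bullet> v" for v
    using sphere_grad_inner[OF C1 x, of v] fun_cong[OF frechet_derivative_at[OF der[OF x]], of v] by simp
  then show "sphere_grad (\<lambda>x. mm_potential (zonal ps x)) x = (4 * min (zonal ps x) (1 - zonal ps x)) *\<^sub>R zonal_grad ps x"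
    using vector_eq_rdot by blast
qed

context helmholtz
begin

text \<open>Integration by parts moves the divergence onto the potential. The bound |chi - u| \<ge>
  min u (1 - u) needs an indicator, whereas f is only an approximation of one; the term 2 |chi - f|
  pays for the exchange and vanishes in the limit.\<close>

lemma mm_potential_variation:
  assumes G: "unit_axes G" and G01: "\<And>x. x \<in> sphere 0 1 \<Longrightarrow> zonal G x \<in> {0..1}"
    and FG: "\<And>x. zonal G x - \<epsilon>\<^sup>2 * zonal_lap G x = zonal F x" and F01: "\<And>x. x \<in> sphere 0 1 \<Longrightarrow> zonal F x \<in> {0..1}"
    and X: "C1_sphere X" "\<And>x. x \<in> sphere 0 1 \<Longrightarrow> X x \<bullet> x = 0" "\<And>x. x \<in> sphere 0 1 \<Longrightarrow> norm (X x) \<le> 1"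
    and \<Omega>: "\<Omega> \<in> sets M"
  shows "(LINT x|M. mm_potential (zonal G x) * sphere_div X x) \<le>
    2 / \<epsilon> * (LINT x|M. zonal F x * (zonal F x - zonal G x) + 2 * \<bar>indicator \<Omega> x - zonal F x\<bar>)"
proof -
  let ?u = "zonal G" and ?f = "zonal F" and ?g = "zonal_grad G"
  note [continuous_intros] = zonal_continuous zonal_grad_continuous zonal_lap_continuous
    C1_sphere_continuous[OF X(1)]
  have int: "integrable M h" if "continuous_on (sphere 0 1) h" for h :: "'a \<Rightarrow> real"
    using that by (rule integrable_sphere_continuous)
  have intO: "integrable M (\<lambda>x. \<bar>indicator \<Omega> x - ?f x\<bar>)"
    using \<Omega> by (intro integrable_abs Bochner_Integration.integrable_diff[OF integrable_real_indicator int[OF zonal_continuous]])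
       (auto simp: less_top[symmetric])
  have "(LINT x|M. mm_potential (?u x) * sphere_div X x) = - (LINT x|M. sphere_grad (\<lambda>x. mm_potential (?u x)) x \<bullet> X x)"
    by (rule sphere_integral_by_parts[OF C1_sphere_mm_potential(1) X(1,2)])
  also have "\<dots> = (LINT x|M. - (4 * min (?u x) (1 - ?u x) * (?g x \<bullet> X x)))"
    unfolding integral_minus by (subst Bochner_Integration.integral_cong[OF refl]) (auto simp: C1_sphere_mm_potential)
  also have "\<dots> \<le> (LINT x|M. 2 / \<epsilon> * ((?f x - ?u x)\<^sup>2 + 2 * \<bar>indicator \<Omega> x - ?f x\<bar> + \<epsilon>\<^sup>2 * (?g x \<bullet> ?g x)))"
  proof (rule integral_mono)
    show "integrable M (\<lambda>x. - (4 * min (?u x) (1 - ?u x) * (?g x \<bullet> X x)))"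
      by (intro int continuous_intros)
    show "integrable M (\<lambda>x. 2 / \<epsilon> * ((?f x - ?u x)\<^sup>2 + 2 * \<bar>indicator \<Omega> x - ?f x\<bar> + \<epsilon>\<^sup>2 * (?g x \<bullet> ?g x)))"
      by (intro integrable_mult_right Bochner_Integration.integrable_add intO) (intro int continuous_intros)+
    fix x assume "x \<in> space M"
    then have x: "x \<in> sphere 0 1" by simp
    define m where "m = min (?u x) (1 - ?u x)"
    have m: "0 \<le> m" using G01[OF x] by (simp add: m_def)
    have "\<bar>?g x \<bullet> X x\<bar> \<le> norm (?g x) * 1"
      using Cauchy_Schwarz_ineq2[of "?g x" "X x"] X(3)[OF x] by (meson mult_left_mono norm_ge_zero order_trans)
    then have "- (4 * m * (?g x \<bullet> X x)) \<le> 4 * m * norm (?g x)"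
      using m mult_left_mono[of "- (?g x \<bullet> X x)" "norm (?g x)" "4 * m"] by simp
    \<comment> \<open>Young's inequality for m and eps |g|. The factor 4 in the slope of the
      potential turns into the weight 2 / eps of the nonlocal energy.\<close>
    also have "\<dots> \<le> 2 / \<epsilon> * (m\<^sup>2 + \<epsilon>\<^sup>2 * (norm (?g x))\<^sup>2)"
    proof -
      have "0 \<le> (m - \<epsilon> * norm (?g x))\<^sup>2" by simp
      then have "2 * \<epsilon> * (m * norm (?g x)) \<le> m\<^sup>2 + \<epsilon>\<^sup>2 * (norm (?g x))\<^sup>2"
        by (simp add: power2_diff power_mult_distrib algebra_simps)
      then show ?thesis using eps by (simp add: field_simps)
    qed
    also have "\<dots> \<le> 2 / \<epsilon> * ((?f x - ?u x)\<^sup>2 + 2 * \<bar>indicator \<Omega> x - ?f x\<bar> + \<epsilon>\<^sup>2 * (?g x \<bullet> ?g x))"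
    proof -
      let ?c = "indicator \<Omega> x :: real"
      \<comment> \<open>As chi is 0 or 1, |chi - u| is u or 1 - u.\<close>
      have "m\<^sup>2 \<le> (?c - ?u x)\<^sup>2"
        using m G01[OF x] unfolding m_def indicator_def
        by (intro abs_le_square_iff[THEN iffD1]) auto
      also have "(?c - ?u x)\<^sup>2 = (?f x - ?u x)\<^sup>2 + (?c - ?f x) * (?c + ?f x - 2 * ?u x)"
        by (simp add: power2_eq_square algebra_simps)
      also have "(?c - ?f x) * (?c + ?f x - 2 * ?u x) \<le> \<bar>?c - ?f x\<bar> * \<bar>?c + ?f x - 2 * ?u x\<bar>"
        by (simp add: abs_mult[symmetric])
      also have "\<dots> \<le> \<bar>?c - ?f x\<bar> * 2"
        using G01[OF x] F01[OF x] by (intro mult_left_mono) (auto simp: indicator_def)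
      finally have "m\<^sup>2 \<le> (?f x - ?u x)\<^sup>2 + 2 * \<bar>?c - ?f x\<bar>" by simp
      then show ?thesis using eps by (intro mult_left_mono) (auto simp: dot_square_norm)
    qed
    finally show "- (4 * min (?u x) (1 - ?u x) * (?g x \<bullet> X x)) \<le>
        2 / \<epsilon> * ((?f x - ?u x)\<^sup>2 + 2 * \<bar>indicator \<Omega> x - ?f x\<bar> + \<epsilon>\<^sup>2 * (?g x \<bullet> ?g x))"
      by (simp add: m_def)
  qed
  also have "\<dots> = 2 / \<epsilon> * ((LINT x|M. (?f x - ?u x)\<^sup>2 + 2 * \<bar>indicator \<Omega> x - ?f x\<bar>) + \<epsilon>\<^sup>2 * (LINT x|M. ?g x \<bullet> ?g x))"
  proof -
    have "integrable M (\<lambda>x. (?f x - ?u x)\<^sup>2 + 2 * \<bar>indicator \<Omega> x - ?f x\<bar>)" "integrable M (\<lambda>x. ?g x \<bullet> ?g x)"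
      by (intro integrable_mult_right Bochner_Integration.integrable_add intO int continuous_intros)+
    then show ?thesis
      by (subst integral_mult_right_zero, subst Bochner_Integration.integral_add) simp_all
  qed
  \<comment> \<open>The energy identity: multiply the equation by u and integrate by parts.\<close>
  also have "\<epsilon>\<^sup>2 * (LINT x|M. ?g x \<bullet> ?g x) = (LINT x|M. ?u x * (?f x - ?u x))"
  proof -
    have "(LINT x|M. ?u x * sphere_div ?g x) = - (LINT x|M. sphere_grad ?u x \<bullet> ?g x)"
      by (intro sphere_integral_by_parts C1_sphere_zonal C1_sphere_zonal_grad zonal_grad_tangent)
    also have "(LINT x|M. sphere_grad ?u x \<bullet> ?g x) = (LINT x|M. ?g x \<bullet> ?g x)"
    proof (rule Bochner_Integration.integral_cong)
      fix x assume "x \<in> space M"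
      then have "x \<noteq> 0" "sgn x = x" "norm x = 1" by (auto simp: sgn_div_norm)
      then show "sphere_grad ?u x \<bullet> ?g x = ?g x \<bullet> ?g x" by (simp add: sphere_grad_zonal)
    qed simp
    also have "(LINT x|M. ?u x * sphere_div ?g x) = (LINT x|M. ?u x * zonal_lap G x)"
      by (rule Bochner_Integration.integral_cong) (auto simp: sphere_div_zonal_grad G)
    finally have "\<epsilon>\<^sup>2 * (LINT x|M. ?g x \<bullet> ?g x) = (LINT x|M. - \<epsilon>\<^sup>2 * (?u x * zonal_lap G x))" by simp
    also have "\<dots> = (LINT x|M. ?u x * (?f x - ?u x))"
      by (rule Bochner_Integration.integral_cong) (auto simp: FG[symmetric] algebra_simps)
    finally show ?thesis .
  qed
  also have "(LINT x|M. (?f x - ?u x)\<^sup>2 + 2 * \<bar>indicator \<Omega> x - ?f x\<bar>) + (LINT x|M. ?u x * (?f x - ?u x))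
     = (LINT x|M. ((?f x - ?u x)\<^sup>2 + 2 * \<bar>indicator \<Omega> x - ?f x\<bar>) + ?u x * (?f x - ?u x))"
    by (intro Bochner_Integration.integral_add[symmetric] integrable_mult_right Bochner_Integration.integrable_add intO int continuous_intros)
  \<comment> \<open>(f - u)^2 + u (f - u) = f (f - u), whose limit is the integrand of
    \<open>nonlocal_eq\<close>.\<close>
  also have "\<dots> = (LINT x|M. ?f x * (?f x - ?u x) + 2 * \<bar>indicator \<Omega> x - ?f x\<bar>)"
    by (rule Bochner_Integration.integral_cong) (auto simp: power2_eq_square algebra_simps)
  finally show ?thesis .
qed

text \<open>The potential fixes 0 and 1 and has Lipschitz constant 2, so replacing its value at u by
  chi costs 2 B times the L1 distance of chi and u. That distance is eps times the nonlocal
  term.\<close>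

lemma variation_le_nonlocal:
  assumes X: "smooth_vector_field X" "\<And>x. x \<in> sphere 0 1 \<Longrightarrow> norm (X x) \<le> 1"
    and B: "\<And>x. x \<in> sphere 0 1 \<Longrightarrow> \<bar>sphere_div X x\<bar> \<le> B" and \<Omega>: "\<Omega> \<in> sets M"
  shows "(LINT x|M. indicator \<Omega> x * sphere_div X x) \<le> (1 + 2 * B * \<epsilon>) * nonlocal \<Omega>"
proof -
  obtain F G where FG: "\<And>j :: nat. unit_axes (F j)" "\<And>j. unit_axes (G j)"
    "\<And>j x. zonal (G j) x - \<epsilon>\<^sup>2 * zonal_lap (G j) x = zonal (F j) x"
    "\<And>j x. x \<in> sphere 0 1 \<Longrightarrow> zonal (F j) x \<in> {0..1}"
    "\<And>j x. x \<in> sphere 0 1 \<Longrightarrow> zonal (G j) x \<in> {0..1}"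
    "AE x in M. (\<lambda>j. zonal (F j) x) \<longlonglongrightarrow> indicator \<Omega> x"
    "\<And>y. y \<in> sphere 0 1 \<Longrightarrow> (\<lambda>j. zonal (G j) y) \<longlonglongrightarrow> smoothed \<Omega> y"
    using smoothed_approx[OF \<Omega>] by blast
  have X1: "C1_sphere X" "\<And>x. x \<in> sphere 0 1 \<Longrightarrow> X x \<bullet> x = 0"
    using X(1) by (auto simp: smooth_vector_field_def smooth_fun_on_imp_C1_sphere)
  have meas[measurable]: "zonal ps \<in> borel_measurable M" for ps
    by (rule integrable_sphere_continuous[OF zonal_continuous])
  have div_meas[measurable]: "sphere_div X \<in> borel_measurable M"
    by (rule integrable_sphere_continuous[OF sphere_div_continuous[OF X1(1)]])
  have mm_meas[measurable]: "mm_potential \<in> borel_measurable borel"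
    by (intro borel_measurable_continuous_onI mm_potential_continuous)
  note \<Omega>[measurable] smoothed_measurable[OF \<Omega>, measurable]
  have B0: "0 \<le> B"
  proof -
    obtain b :: 'a where "b \<in> Basis" using nonempty_Basis by blast
    then show ?thesis using B[of b] by (auto intro: order_trans[OF abs_ge_zero])
  qed
  have mm_bound: "\<bar>mm_potential s\<bar> \<le> 2" if "s \<in> {0..1}" for s
    using mm_potential_lipschitz[of s 0] that by auto
  have "(\<lambda>j. LINT x|M. mm_potential (zonal (G j) x) * sphere_div X x) \<longlonglongrightarrow> (LINT x|M. mm_potential (smoothed \<Omega> x) * sphere_div X x)"
  proof (rule bounded_convergence[where B="2 * B"])
    show "AE x in M. (\<lambda>j. mm_potential (zonal (G j) x) * sphere_div X x) \<longlonglongrightarrow> mm_potential (smoothed \<Omega> x) * sphere_div X x"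
      using FG(7) by (intro AE_I2 tendsto_intros isCont_tendsto_compose[OF DERIV_isCont[OF mm_potential_deriv]]) auto
    show "\<bar>mm_potential (zonal (G j) x) * sphere_div X x\<bar> \<le> 2 * B" if "x \<in> space M" for j x
      unfolding abs_mult using that FG(5) by (intro mult_mono mm_bound B) auto
  qed simp_all
  moreover have "(\<lambda>j. 2 / \<epsilon> * (LINT x|M. zonal (F j) x * (zonal (F j) x - zonal (G j) x) + 2 * \<bar>indicator \<Omega> x - zonal (F j) x\<bar>))
     \<longlonglongrightarrow> 2 / \<epsilon> * (LINT x|M. indicator \<Omega> x * (indicator \<Omega> x - smoothed \<Omega> x) + 2 * \<bar>indicator \<Omega> x - indicator \<Omega> x\<bar>)"
  proof (intro tendsto_mult_left bounded_convergence[where B=3])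
    show "AE x in M. (\<lambda>j. zonal (F j) x * (zonal (F j) x - zonal (G j) x) + 2 * \<bar>indicator \<Omega> x - zonal (F j) x\<bar>)
       \<longlonglongrightarrow> indicator \<Omega> x * (indicator \<Omega> x - smoothed \<Omega> x) + 2 * \<bar>indicator \<Omega> x - indicator \<Omega> x\<bar>"
      using FG(6) AE_space by eventually_elim (intro tendsto_intros FG(7); simp)
    show "\<bar>zonal (F j) x * (zonal (F j) x - zonal (G j) x) + 2 * \<bar>indicator \<Omega> x - zonal (F j) x\<bar>\<bar> \<le> 3" if "x \<in> space M" for j x
    proof -
      have x: "zonal (F j) x \<in> {0..1}" "zonal (G j) x \<in> {0..1}" using FG(4,5) that by auto
      then have "\<bar>zonal (F j) x * (zonal (F j) x - zonal (G j) x)\<bar> \<le> 1 * 1"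
        unfolding abs_mult by (intro mult_mono) auto
      moreover have "\<bar>indicator \<Omega> x - zonal (F j) x\<bar> \<le> 1" using x by (auto simp: indicator_def)
      moreover have "\<bar>a\<bar> \<le> 1 * 1 \<Longrightarrow> \<bar>b\<bar> \<le> 1 \<Longrightarrow> \<bar>a + 2 * \<bar>b\<bar>\<bar> \<le> 3" for a b :: real
        by linarith
      ultimately show ?thesis by blast
    qed
  qed simp_all
  ultimately have "(LINT x|M. mm_potential (smoothed \<Omega> x) * sphere_div X x)
      \<le> 2 / \<epsilon> * (LINT x|M. indicator \<Omega> x * (indicator \<Omega> x - smoothed \<Omega> x) + 2 * \<bar>indicator \<Omega> x - indicator \<Omega> x\<bar>)"
    by (rule LIMSEQ_le) (use mm_potential_variation[OF FG(2,5,3,4) X1 X(2) \<Omega>] in auto)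
  also have "\<dots> = nonlocal \<Omega>" by (simp add: nonlocal_eq(1)[OF \<Omega>])
  finally have le: "(LINT x|M. mm_potential (smoothed \<Omega> x) * sphere_div X x) \<le> nonlocal \<Omega>" .
  have int1: "integrable M (\<lambda>x. indicator \<Omega> x * sphere_div X x)"
    using B B0 by (intro integrable_bounded[where B=B]) (auto simp: indicator_def)
  have int2: "integrable M (\<lambda>x. mm_potential (smoothed \<Omega> x) * sphere_div X x)"
  proof (rule integrable_bounded[where B="2 * B"])
    show "\<bar>mm_potential (smoothed \<Omega> x) * sphere_div X x\<bar> \<le> 2 * B" if "x \<in> sphere 0 1" for x
      unfolding abs_mult using that smoothed_range[OF \<Omega>] by (intro mult_mono mm_bound B) auto
  qed simp
  have "(LINT x|M. indicator \<Omega> x * sphere_div X x) - (LINT x|M. mm_potential (smoothed \<Omega> x) * sphere_div X x)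
      = (LINT x|M. indicator \<Omega> x * sphere_div X x - mm_potential (smoothed \<Omega> x) * sphere_div X x)"
    using int1 int2 by simp
  also have "\<dots> \<le> (LINT x|M. 2 * B * \<bar>indicator \<Omega> x - smoothed \<Omega> x\<bar>)"
  proof (rule integral_mono)
    show "integrable M (\<lambda>x. 2 * B * \<bar>indicator \<Omega> x - smoothed \<Omega> x\<bar>)"
      using smoothed_range[OF \<Omega>]
      by (intro integrable_mult_right integrable_bounded[where B=1]) (auto simp: indicator_def)
    fix x assume "x \<in> space M"
    then have x: "x \<in> sphere 0 1" by simp
    have "mm_potential (indicator \<Omega> x) = indicator \<Omega> x" by (simp add: indicator_def)
    then have "indicator \<Omega> x * sphere_div X x - mm_potential (smoothed \<Omega> x) * sphere_div X x
        = (mm_potential (indicator \<Omega> x) - mm_potential (smoothed \<Omega> x)) * sphere_div X x"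
      by (simp add: left_diff_distrib)
    also have "\<dots> \<le> \<bar>mm_potential (indicator \<Omega> x) - mm_potential (smoothed \<Omega> x)\<bar> * \<bar>sphere_div X x\<bar>"
      by (simp add: abs_mult[symmetric])
    also have "\<dots> \<le> (2 * \<bar>indicator \<Omega> x - smoothed \<Omega> x\<bar>) * B"
      using smoothed_range[OF \<Omega> x] B[OF x] by (intro mult_mono mm_potential_lipschitz) (auto simp: indicator_def)
    finally show "indicator \<Omega> x * sphere_div X x - mm_potential (smoothed \<Omega> x) * sphere_div X x
        \<le> 2 * B * \<bar>indicator \<Omega> x - smoothed \<Omega> x\<bar>" by (simp add: mult_ac)
  qed (use int1 int2 in simp)
  also have "\<dots> = 2 * B * (\<epsilon> * nonlocal \<Omega>)" by (simp add: nonlocal_eq(2)[OF \<Omega>])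
  finally show ?thesis using le by (simp add: algebra_simps)
qed

end

section \<open>First moments of a cylinder\<close>

abbreviation l2 :: "'i set \<Rightarrow> ('i \<Rightarrow> real) \<Rightarrow> real" where
  "l2 A f \<equiv> sqrt (\<Sum>i\<in>A. (f i)\<^sup>2)"

lemma emeasure_PiM_ball:
  assumes "finite A" "0 < r"
  shows "emeasure (Pi\<^sub>M A (\<lambda>_. lborel)) {f \<in> space (Pi\<^sub>M A (\<lambda>_. lborel)). l2 A f \<le> r} =
    ennreal (unit_ball_vol (card A) * r ^ card A)"
proof -
  have "{f \<in> space (Pi\<^sub>M A (\<lambda>_. lborel)). l2 A f \<le> r} = {f. l2 A f \<le> r} \<inter> space (Pi\<^sub>M A (\<lambda>_. lborel))"
    by auto
  then show ?thesis using emeasure_cball_aux[OF assms] by simp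
qed

text \<open>Layer cake: the norm is the length of {s. 0 \<le> s < |f|}. The shell s < |f| \<le> 1
  has volume w (1 - s ^ n), with w the volume of the ball, and 1 - s ^ n integrates to n / (n +
  1).\<close>

lemma PiM_radial_moment:
  assumes A: "finite A"
  shows "(\<integral>\<^sup>+f. indicator {..1} (l2 A f) * ennreal (l2 A f) \<partial>Pi\<^sub>M A (\<lambda>_. lborel)) =
    ennreal (unit_ball_vol (card A) * (card A / (card A + 1)))"
proof -
  let ?P = "Pi\<^sub>M A (\<lambda>_. lborel :: real measure)" and ?n = "card A"
  interpret product_sigma_finite "\<lambda>_. lborel :: real measure" by standard
  interpret P: sigma_finite_measure ?P by (rule sigma_finite[OF A])
  interpret PL: pair_sigma_finite ?P "lborel :: real measure" ..
  define w where "w = unit_ball_vol (real ?n)"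
  have w: "0 \<le> w" by (simp add: w_def)
  have l2_meas[measurable]: "l2 A \<in> borel_measurable ?P" by measurable
  have nn: "0 \<le> l2 A f" for f by (intro real_sqrt_ge_zero sum_nonneg) auto
  have "(\<integral>\<^sup>+f. indicator {..1} (l2 A f) * ennreal (l2 A f) \<partial>?P) =
      (\<integral>\<^sup>+f. (\<integral>\<^sup>+s. indicator {0..1} s * indicator {f. s < l2 A f \<and> l2 A f \<le> 1} f \<partial>lborel) \<partial>?P)"
  proof (rule nn_integral_cong)
    fix f
    have "(\<integral>\<^sup>+s. indicator {0..1} s * indicator {f. s < l2 A f \<and> l2 A f \<le> 1} f \<partial>lborel)
        = (\<integral>\<^sup>+s. indicator {..1} (l2 A f) * indicator {0..<l2 A f} s \<partial>lborel)"
      by (intro nn_integral_cong) (auto simp: indicator_def simp del: real_sqrt_le_1_iff)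
    also have "\<dots> = indicator {..1} (l2 A f) * ennreal (l2 A f)"
      using nn[of f] by (simp add: nn_integral_cmult)
    finally show "indicator {..1} (l2 A f) * ennreal (l2 A f) =
      (\<integral>\<^sup>+s. indicator {0..1} s * indicator {f. s < l2 A f \<and> l2 A f \<le> 1} f \<partial>lborel)" ..
  qed
  also have "\<dots> = (\<integral>\<^sup>+s. (\<integral>\<^sup>+f. indicator {0..1} s * indicator {f. s < l2 A f \<and> l2 A f \<le> 1} f \<partial>?P) \<partial>lborel)"
  proof (rule PL.Fubini'[symmetric])
    have eq: "(\<lambda>(f, s). indicator {0..1} s * indicator {f. s < l2 A f \<and> l2 A f \<le> 1} f :: ennreal)
      = (\<lambda>z. indicator {0..1} (snd z) * (if snd z < l2 A (fst z) \<and> l2 A (fst z) \<le> 1 then 1 else 0))"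
      by (auto simp: indicator_def)
    show "(\<lambda>(f, s). indicator {0..1} s * indicator {f. s < l2 A f \<and> l2 A f \<le> 1} f :: ennreal)
        \<in> borel_measurable (?P \<Otimes>\<^sub>M lborel)"
      unfolding eq by measurable
  qed
  also have "\<dots> = (\<integral>\<^sup>+s. ennreal (w * (1 - s ^ ?n)) * indicator {0..1} s \<partial>lborel)"
  proof (rule nn_integral_cong_AE)
    show "AE s in lborel. (\<integral>\<^sup>+f. indicator {0..1} s * indicator {f. s < l2 A f \<and> l2 A f \<le> 1} f \<partial>?P)
        = ennreal (w * (1 - s ^ ?n)) * indicator {0..1} s"
      \<comment> \<open>The volume formula for balls needs a positive radius, so s = 0 is
        discarded.\<close>
      using AE_lborel_singleton[of 0]
    proof eventually_elim
      case (elim s)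
      show ?case
      proof (cases "s \<in> {0..1}")
        case True
        then have s: "0 < s" "s \<le> 1" using elim by auto
        let ?B = "\<lambda>r. {f \<in> space ?P. l2 A f \<le> r}"
        have "(\<integral>\<^sup>+f. indicator {0..1} s * indicator {f. s < l2 A f \<and> l2 A f \<le> 1} f \<partial>?P)
            = (\<integral>\<^sup>+f. indicator (?B 1 - ?B s) f \<partial>?P)"
          using True by (intro nn_integral_cong) (auto simp: indicator_def)
        also have "\<dots> = emeasure ?P (?B 1 - ?B s)" by (rule nn_integral_indicator) measurable
        also have "\<dots> = emeasure ?P (?B 1) - emeasure ?P (?B s)"
        proof (rule emeasure_Diff)
          show "?B s \<subseteq> ?B 1" using s by (auto simp del: real_sqrt_le_1_iff)
        qed (use s in \<open>auto simp: emeasure_PiM_ball[OF A]\<close>)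
        also have "\<dots> = ennreal (w * (1 - s ^ ?n))"
          unfolding emeasure_PiM_ball[OF A s(1)] emeasure_PiM_ball[OF A zero_less_one]
          using s by (simp add: w_def ennreal_minus algebra_simps)
        finally show ?thesis using True by simp
      qed simp
    qed
  qed
  also have "\<dots> = ennreal (w * (?n / (?n + 1)))"
  proof (rule nn_integral_has_integral_lebesgue')
    show "0 \<le> w * (1 - s ^ ?n)" if "s \<in> {0..1}" for s
      using that w by (simp add: power_le_one)
    have "((\<lambda>s. w * (1 - s ^ ?n)) has_integral w * (1 - 1 ^ Suc ?n / Suc ?n) - w * (0 - 0 ^ Suc ?n / Suc ?n)) {0..1}"
    proof (rule fundamental_theorem_of_calculus)
      fix s :: real
      have "((\<lambda>s. w * (s - s ^ Suc ?n / Suc ?n)) has_real_derivative w * (1 - real (Suc ?n) * s ^ ?n / Suc ?n)) (at s within {0..1})"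
        using DERIV_cmult[OF DERIV_diff[OF DERIV_ident DERIV_cdivide[OF DERIV_pow[of "Suc ?n" s "{0..1}"], of "Suc ?n"]], of w]
        by (simp only: diff_Suc_Suc diff_zero)
      then show "((\<lambda>s. w * (s - s ^ Suc ?n / Suc ?n)) has_vector_derivative w * (1 - s ^ ?n)) (at s within {0..1})"
        by (simp add: has_real_derivative_iff_has_vector_derivative del: of_nat_Suc)
    qed simp
    moreover have "w * (1 - 1 ^ Suc ?n / Suc ?n) - w * (0 - 0 ^ Suc ?n / Suc ?n) = w * (?n / (?n + 1))"
      by (simp add: field_simps)
    ultimately show "((\<lambda>s. w * (1 - s ^ ?n)) has_integral w * (?n / (?n + 1))) {0..1}" by simp
  qed
  finally show ?thesis by (simp add: w_def)
qed

lemma has_integral_slices: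
  fixes m :: nat
  shows "((\<lambda>t. \<bar>t\<bar> * sqrt (1 - t\<^sup>2) ^ m) has_integral 2 / (m + 2)) {-1..1}"
proof -
  \<comment> \<open>An antiderivative on each half of the interval, up to sign. At the endpoints
    only its continuity is used.\<close>
  define F where "F t = sqrt (1 - t\<^sup>2) ^ (m + 2) / (m + 2)" for t
  have F': "(F has_real_derivative - (t * sqrt (1 - t\<^sup>2) ^ m)) (at t)" if "-1 < t" "t < 1" for t
  proof -
    have t: "0 < 1 - t\<^sup>2" using that by (simp add: abs_square_less_1 abs_less_iff)
    have "((\<lambda>t. sqrt (1 - t\<^sup>2)) has_real_derivative - (2 * t) * (inverse (sqrt (1 - t\<^sup>2)) / 2)) (at t)"
      using t by (auto intro!: derivative_eq_intros simp: field_simps)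
    then have "(F has_real_derivative (real (m + 2) * (- (2 * t) * (inverse (sqrt (1 - t\<^sup>2)) / 2) * sqrt (1 - t\<^sup>2) ^ (m + 2 - Suc 0))) / (m + 2)) (at t)"
      unfolding F_def by (intro DERIV_cdivide DERIV_power)
    moreover have "(real (m + 2) * (- (2 * t) * (inverse (sqrt (1 - t\<^sup>2)) / 2) * sqrt (1 - t\<^sup>2) ^ (m + 2 - Suc 0))) / (m + 2)
        = - (t * sqrt (1 - t\<^sup>2) ^ m)"
    proof -
      define q where "q = sqrt (1 - t\<^sup>2)"
      have "0 < q" using t by (simp add: q_def)
      then show ?thesis unfolding q_def[symmetric] by (simp add: field_simps del: of_nat_add of_nat_Suc)
    qed
    ultimately show ?thesis by (simp only:)
  qed
  have cF: "continuous_on S F" for S unfolding F_def by (intro continuous_intros) auto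
  have F01: "F 1 = 0" "F (-1) = 0" "F 0 = 1 / (m + 2)" by (simp_all add: F_def)
  have "((\<lambda>t. t * sqrt (1 - t\<^sup>2) ^ m) has_integral (- F 1) - (- F 0)) {0..1}"
  proof (rule fundamental_theorem_of_calculus_interior)
    show "((\<lambda>t. - F t) has_vector_derivative t * sqrt (1 - t\<^sup>2) ^ m) (at t)" if "t \<in> {0<..<1}" for t
      using DERIV_minus[OF F'[of t]] that by (simp add: has_real_derivative_iff_has_vector_derivative)
  qed (auto intro: continuous_intros cF)
  then have 1: "((\<lambda>t. \<bar>t\<bar> * sqrt (1 - t\<^sup>2) ^ m) has_integral 1 / (m + 2)) {0..1}"
    by (subst has_integral_cong[of _ _ "\<lambda>t. t * sqrt (1 - t\<^sup>2) ^ m"]) (auto simp: F01)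
  have "((\<lambda>t. - (t * sqrt (1 - t\<^sup>2) ^ m)) has_integral F 0 - F (-1)) {-1..0}"
  proof (rule fundamental_theorem_of_calculus_interior)
    show "(F has_vector_derivative - (t * sqrt (1 - t\<^sup>2) ^ m)) (at t)" if "t \<in> {-1<..<0}" for t
      using F'[of t] that by (simp add: has_real_derivative_iff_has_vector_derivative)
  qed (auto intro: cF)
  then have 2: "((\<lambda>t. \<bar>t\<bar> * sqrt (1 - t\<^sup>2) ^ m) has_integral 1 / (m + 2)) {-1..0}"
    by (subst has_integral_cong[of _ _ "\<lambda>t. - (t * sqrt (1 - t\<^sup>2) ^ m)"]) (auto simp: F01)
  from has_integral_combine[OF _ _ 2 1] show ?thesis by simp
qed

text \<open>The slice of the ball at height t of the coordinate i is a ball of one dimension less,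
  of radius sqrt (1 - t^2).\<close>

lemma PiM_coordinate_moment:
  assumes A: "finite A" and i: "i \<in> A"
  shows "(\<integral>\<^sup>+f. indicator {..1} (l2 A f) * ennreal \<bar>f i\<bar> \<partial>Pi\<^sub>M A (\<lambda>_. lborel)) =
    ennreal (unit_ball_vol (card A - 1) * (2 / (card A + 1)))"
proof -
  interpret product_sigma_finite "\<lambda>_. lborel :: real measure" by standard
  define A' where "A' = A - {i}"
  have A': "finite A'" "i \<notin> A'" "A = insert i A'" "card A = Suc (card A')"
    using A i card.remove[OF A i] by (auto simp: A'_def)
  let ?P = "Pi\<^sub>M A' (\<lambda>_. lborel :: real measure)" and ?m = "card A'"
  define w where "w = unit_ball_vol (real ?m)"
  have w: "0 \<le> w" by (simp add: w_def)
  have nn: "0 \<le> (\<Sum>i\<in>A'. (f i)\<^sup>2)" for f :: "_ \<Rightarrow> real" by (intro sum_nonneg) auto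
  have "(\<integral>\<^sup>+f. indicator {..1} (l2 A f) * ennreal \<bar>f i\<bar> \<partial>Pi\<^sub>M A (\<lambda>_. lborel)) =
      (\<integral>\<^sup>+t. (\<integral>\<^sup>+f. indicator {..1} (l2 A (f(i := t))) * ennreal \<bar>(f(i := t)) i\<bar> \<partial>?P) \<partial>lborel)"
    unfolding A'(3) using A' by (intro product_nn_integral_insert_rev) measurable
  also have "\<dots> = (\<integral>\<^sup>+t. ennreal (w * (\<bar>t\<bar> * sqrt (1 - t\<^sup>2) ^ ?m)) * indicator {-1..1} t \<partial>lborel)"
  proof (rule nn_integral_cong_AE)
    show "AE t in lborel. (\<integral>\<^sup>+f. indicator {..1} (l2 A (f(i := t))) * ennreal \<bar>(f(i := t)) i\<bar> \<partial>?P)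
      = ennreal (w * (\<bar>t\<bar> * sqrt (1 - t\<^sup>2) ^ ?m)) * indicator {-1..1} t"
      \<comment> \<open>At t = 1 and t = -1 the slice has radius 0, outside the scope of the volume
        formula.\<close>
      using AE_lborel_singleton[of 1] AE_lborel_singleton[of "-1"]
    proof eventually_elim
      case (elim t)
      have l2_upd: "l2 A (f(i := t)) = sqrt (t\<^sup>2 + (\<Sum>i\<in>A'. (f i)\<^sup>2))" for f
      proof -
        have "(\<Sum>j\<in>A'. ((f(i := t)) j)\<^sup>2) = (\<Sum>j\<in>A'. (f j)\<^sup>2)"
          using A'(2) by (intro sum.cong) auto
        then show ?thesis using A'(1,2) by (simp add: A'(3))
      qed
      show ?case
      proof (cases "\<bar>t\<bar> < 1")
        case True
        then have t: "t\<^sup>2 < 1" by (simp add: abs_square_less_1)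
        have "l2 A (f(i := t)) \<le> 1 \<longleftrightarrow> l2 A' f \<le> sqrt (1 - t\<^sup>2)" for f
          unfolding l2_upd by (simp add: algebra_simps)
        then have "(\<integral>\<^sup>+f. indicator {..1} (l2 A (f(i := t))) * ennreal \<bar>(f(i := t)) i\<bar> \<partial>?P)
          = (\<integral>\<^sup>+f. ennreal \<bar>t\<bar> * indicator {f \<in> space ?P. l2 A' f \<le> sqrt (1 - t\<^sup>2)} f \<partial>?P)"
          by (intro nn_integral_cong) (auto simp: indicator_def)
        also have "\<dots> = ennreal \<bar>t\<bar> * emeasure ?P {f \<in> space ?P. l2 A' f \<le> sqrt (1 - t\<^sup>2)}"
          by (subst nn_integral_cmult) auto
        also have "\<dots> = ennreal \<bar>t\<bar> * ennreal (w * sqrt (1 - t\<^sup>2) ^ ?m)"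
          using t by (subst emeasure_PiM_ball[OF A'(1)]) (auto simp: w_def)
        finally show ?thesis
          using True w t by (auto simp: ennreal_mult[symmetric] mult_ac abs_le_iff abs_less_iff)
      next
        case False
        then have "1 < \<bar>t\<bar>" using elim by auto
        then have t: "t \<notin> {-1..1}" "1 < t\<^sup>2" using one_less_power[of "\<bar>t\<bar>" 2] by auto
        have "indicator {..1} (l2 A (f(i := t))) = (0::ennreal)" for f
        proof -
          have "1 < l2 A (f(i := t))" unfolding l2_upd using t(2) nn[of f] by simp
          then show ?thesis by (simp only: indicator_simps(2) atMost_iff not_le)
        qed
        then show ?thesis using t(1) by simp
      qed
    qed
  qed
  also have "\<dots> = ennreal (w * (2 / (?m + 2)))"
  proof (rule nn_integral_has_integral_lebesgue')
    show "0 \<le> w * (\<bar>t\<bar> * sqrt (1 - t\<^sup>2) ^ ?m)" if "t \<in> {-1..1}" for t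
      using that w by (auto simp: abs_square_le_1 abs_le_iff)
    show "((\<lambda>t. w * (\<bar>t\<bar> * sqrt (1 - t\<^sup>2) ^ ?m)) has_integral w * (2 / (?m + 2))) {-1..1}"
      using has_integral_mult_right[OF has_integral_slices[of ?m], of w] by simp
  qed
  finally show ?thesis by (simp add: A'(4) w_def add.commute)
qed

section \<open>Moments of the cylinder over a ball\<close>

definition orth_part :: "'a::euclidean_space \<Rightarrow> 'a \<Rightarrow> 'a" where
  "orth_part b z = z - (z \<bullet> b) *\<^sub>R b"

text \<open>A solid set in the ambient space whose projection along b is the unit ball of the
  hyperplane orthogonal to b. Averages over that ball thus become Lebesgue integrals on the given
  type, at the price of a factor 2 from the axis.\<close>

definition cylinder :: "'a::euclidean_space \<Rightarrow> 'a set" where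
  "cylinder b = {z. \<bar>z \<bullet> b\<bar> \<le> 1 \<and> norm (orth_part b z) \<le> 1}"

lemma norm_orth_part:
  assumes "b \<in> Basis"
  shows "norm (orth_part b z) = l2 (Basis - {b}) (\<lambda>c. z \<bullet> c)"
proof -
  have "orth_part b z \<bullet> orth_part b z = z \<bullet> z - (z \<bullet> b)\<^sup>2"
    using assms by (simp add: orth_part_def inner_diff_left inner_diff_right inner_commute power2_eq_square)
  also have "z \<bullet> z = (\<Sum>c\<in>Basis. (z \<bullet> c)\<^sup>2)"
    by (simp add: euclidean_inner[of z z] power2_eq_square)
  also have "\<dots> = (z \<bullet> b)\<^sup>2 + (\<Sum>c\<in>Basis - {b}. (z \<bullet> c)\<^sup>2)"
    using assms by (subst sum.remove[of _ b]) auto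
  finally show ?thesis by (simp add: norm_eq_sqrt_inner)
qed

lemma cylinder_measurable [measurable]: "cylinder b \<in> sets borel"
  unfolding cylinder_def orth_part_def by measurable

lemma cylinder_nn_integral:
  fixes b :: "'a::euclidean_space" and \<phi> :: "('a \<Rightarrow> real) \<Rightarrow> ennreal"
  assumes b: "b \<in> Basis" and [measurable]: "\<phi> \<in> borel_measurable (Pi\<^sub>M (Basis - {b}) (\<lambda>_. lborel))"
  shows "(\<integral>\<^sup>+z. indicator (cylinder b) z * \<phi> (restrict (\<lambda>c. z \<bullet> c) (Basis - {b})) \<partial>lborel) =
    2 * (\<integral>\<^sup>+f. indicator {..1} (l2 (Basis - {b}) f) * \<phi> f \<partial>Pi\<^sub>M (Basis - {b}) (\<lambda>_. lborel))"
proof -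
  interpret product_sigma_finite "\<lambda>_. lborel :: real measure" by standard
  define A where "A = Basis - {b}"
  have A: "finite A" "b \<notin> A" and BA: "Basis = insert b A" using b by (auto simp: A_def)
  note [measurable] = assms(2)[folded A_def]
  let ?s = "\<lambda>f. \<Sum>c\<in>Basis. f c *\<^sub>R c" and ?P = "Pi\<^sub>M A (\<lambda>_. lborel :: real measure)"
  have coord: "?s f \<bullet> c = f c" if "c \<in> Basis" for f and c :: 'a
    using that by (simp add: inner_sum_left inner_Basis if_distrib[of "\<lambda>x. _ * x"] sum.delta cong: if_cong)
  have "(\<integral>\<^sup>+z. indicator (cylinder b) z * \<phi> (restrict (\<lambda>c. z \<bullet> c) A) \<partial>lborel) =
     (\<integral>\<^sup>+f. indicator (cylinder b) (?s f) * \<phi> (restrict (\<lambda>c. ?s f \<bullet> c) A) \<partial>Pi\<^sub>M Basis (\<lambda>_. lborel))"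
    by (subst lborel_eq, subst nn_integral_distr) measurable
  also have "\<dots> = (\<integral>\<^sup>+f. indicator {-1..1} (f b) * (indicator {..1} (l2 A f) * \<phi> (restrict f A)) \<partial>Pi\<^sub>M Basis (\<lambda>_. lborel))"
  proof (rule nn_integral_cong)
    fix f
    have r: "restrict (\<lambda>c. ?s f \<bullet> c) A = restrict f A"
      using coord by (auto simp: A_def restrict_def)
    have "(\<Sum>c\<in>A. (?s f \<bullet> c)\<^sup>2) = (\<Sum>c\<in>A. (f c)\<^sup>2)"
      using coord by (intro sum.cong) (auto simp: A_def)
    then have "norm (orth_part b (?s f)) = l2 A f"
      using norm_orth_part[OF b, of "?s f"] by (simp add: A_def)
    then have "?s f \<in> cylinder b \<longleftrightarrow> f b \<in> {-1..1} \<and> l2 A f \<in> {..1}"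
      using coord[OF b, of f] by (auto simp: cylinder_def)
    then show "indicator (cylinder b) (?s f) * \<phi> (restrict (\<lambda>c. ?s f \<bullet> c) A) =
        indicator {-1..1} (f b) * (indicator {..1} (l2 A f) * \<phi> (restrict f A))"
      unfolding r by (auto simp: indicator_def)
  qed
  also have "\<dots> = (\<integral>\<^sup>+t. (\<integral>\<^sup>+f. indicator {-1..1} ((f(b := t)) b) *
      (indicator {..1} (l2 A (f(b := t))) * \<phi> (restrict (f(b := t)) A)) \<partial>?P) \<partial>lborel)"
    unfolding BA using A by (intro product_nn_integral_insert_rev) measurable
  also have "\<dots> = (\<integral>\<^sup>+(t::real). indicator {-1..1} t * (\<integral>\<^sup>+f. indicator {..1} (l2 A f) * \<phi> f \<partial>?P) \<partial>lborel)"
  proof (rule nn_integral_cong)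
    fix t :: real
    have "(\<integral>\<^sup>+f. indicator {-1..1} ((f(b := t)) b) * (indicator {..1} (l2 A (f(b := t))) * \<phi> (restrict (f(b := t)) A)) \<partial>?P)
      = (\<integral>\<^sup>+f. indicator {-1..1} t * (indicator {..1} (l2 A f) * \<phi> f) \<partial>?P)"
    proof (rule nn_integral_cong)
      fix f assume "f \<in> space ?P"
      then have "restrict (f(b := t)) A = f"
        using A(2) by (auto simp: space_PiM PiE_def extensional_def restrict_def)
      moreover have "(\<Sum>c\<in>A. ((f(b := t)) c)\<^sup>2) = (\<Sum>c\<in>A. (f c)\<^sup>2)"
        using A(2) by (intro sum.cong) auto
      ultimately show "indicator {-1..1} ((f(b := t)) b) * (indicator {..1} (l2 A (f(b := t))) * \<phi> (restrict (f(b := t)) A))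
          = indicator {-1..1} t * (indicator {..1} (l2 A f) * \<phi> f)" by simp
    qed
    also have "\<dots> = indicator {-1..1} t * (\<integral>\<^sup>+f. indicator {..1} (l2 A f) * \<phi> f \<partial>?P)"
      by (rule nn_integral_cmult) measurable
    finally show "(\<integral>\<^sup>+f. indicator {-1..1} ((f(b := t)) b) * (indicator {..1} (l2 A (f(b := t))) * \<phi> (restrict (f(b := t)) A)) \<partial>?P)
      = indicator {-1..1} t * (\<integral>\<^sup>+f. indicator {..1} (l2 A f) * \<phi> f \<partial>?P)" .
  qed
  also have "\<dots> = 2 * (\<integral>\<^sup>+f. indicator {..1} (l2 A f) * \<phi> f \<partial>?P)"
    by (subst nn_integral_multc) auto
  finally show ?thesis by (simp add: A_def)
qed

lemma cylinder_radial_moment: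
  fixes b :: "'a::euclidean_space"
  assumes b: "b \<in> Basis" and n: "DIM('a) = n + 1"
  shows "(\<integral>\<^sup>+z. indicator (cylinder b) z * ennreal (norm (orth_part b z)) \<partial>lborel) =
    ennreal (2 * (unit_ball_vol n * (n / (real n + 1))))"
proof -
  have card: "card (Basis - {b}) = n" using n b by simp
  have "(\<integral>\<^sup>+z. indicator (cylinder b) z * ennreal (norm (orth_part b z)) \<partial>lborel) =
    (\<integral>\<^sup>+z. indicator (cylinder b) z * ennreal (l2 (Basis - {b}) (restrict (\<lambda>c. z \<bullet> c) (Basis - {b}))) \<partial>lborel)"
    by (intro nn_integral_cong) (simp add: norm_orth_part[OF b])
  also have "\<dots> = 2 * ennreal (unit_ball_vol n * (n / (real n + 1)))"
    using cylinder_nn_integral[OF b, of "\<lambda>f. ennreal (l2 (Basis - {b}) f)"] PiM_radial_moment[of "Basis - {b}"]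
    by (simp add: card add.commute)
  also have "\<dots> = ennreal (2 * (unit_ball_vol n * (n / (real n + 1))))"
    by (subst ennreal_mult) auto
  finally show ?thesis .
qed

lemma cylinder_coordinate_moment:
  fixes b :: "'a::euclidean_space"
  assumes b: "b \<in> Basis" and c: "c \<in> Basis" "c \<noteq> b" and n: "DIM('a) = n + 1"
  shows "(\<integral>\<^sup>+z. indicator (cylinder b) z * ennreal \<bar>z \<bullet> c\<bar> \<partial>lborel) =
    ennreal (2 * (unit_ball_vol (n - 1) * (2 / (real n + 1))))"
proof -
  have card: "card (Basis - {b}) = n" using n b by simp
  have "1 \<le> n" using c b card by (metis DiffI One_nat_def Suc_leI card_gt_0_iff empty_iff finite_Basis finite_Diff singletonD)
  then have n1: "real n - 1 = real (n - 1)" by simp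
  have "(\<integral>\<^sup>+z. indicator (cylinder b) z * ennreal \<bar>z \<bullet> c\<bar> \<partial>lborel) =
    (\<integral>\<^sup>+z. indicator (cylinder b) z * ennreal \<bar>restrict (\<lambda>c. z \<bullet> c) (Basis - {b}) c\<bar> \<partial>lborel)"
    using c by simp
  also have "\<dots> = 2 * ennreal (unit_ball_vol (n - 1) * (2 / (real n + 1)))"
    using cylinder_nn_integral[OF b, of "\<lambda>f. ennreal \<bar>f c\<bar>"] PiM_coordinate_moment[of "Basis - {b}" c] c
    by (simp add: card n1 add.commute)
  also have "\<dots> = ennreal (2 * (unit_ball_vol (n - 1) * (2 / (real n + 1))))"
    by (subst ennreal_mult) auto
  finally show ?thesis .
qed

text \<open>The Householder reflection. For u = 0 it is the identity, so
  \<open>reflection (a - b)\<close> takes a to b also when a = b.\<close>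

definition reflection :: "'a::euclidean_space \<Rightarrow> 'a \<Rightarrow> 'a" where
  "reflection u x = x - (2 * (x \<bullet> u) / (u \<bullet> u)) *\<^sub>R u"

lemma reflection:
  shows "orthogonal_transformation (reflection u)"
    and "reflection u x \<bullet> y = x \<bullet> reflection u y"
    and "norm a = norm b \<Longrightarrow> reflection (a - b) a = b"
    and "x \<bullet> u = 0 \<Longrightarrow> reflection u x = x"
proof -
  show sym: "reflection u x \<bullet> y = x \<bullet> reflection u y" for x y
    by (simp add: reflection_def inner_diff_left inner_diff_right inner_commute)
  have lin: "linear (reflection u)"
    by (rule linearI) (simp_all add: reflection_def inner_add_left algebra_simps add_divide_distrib)
  have "reflection u (reflection u x) = x" for x
    by (cases "u = 0") (simp_all add: reflection_def inner_diff_left algebra_simps)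
  then show "orthogonal_transformation (reflection u)"
    using lin sym by (simp add: orthogonal_transformation_def)
  show "x \<bullet> u = 0 \<Longrightarrow> reflection u x = x" by (simp add: reflection_def)
  assume ab: "norm a = norm b"
  show "reflection (a - b) a = b"
  proof (cases "a = b")
    case False
    have "(norm (a - b))\<^sup>2 = (norm a)\<^sup>2 + (norm b)\<^sup>2 - 2 * (a \<bullet> b)"
      by (simp add: power2_norm_eq_inner inner_diff_left inner_diff_right inner_commute)
    also have "\<dots> = 2 * (a \<bullet> (a - b))"
      using ab by (simp add: inner_diff_right dot_square_norm)
    finally have eq: "2 * (a \<bullet> (a - b)) = (a - b) \<bullet> (a - b)"
      by (simp add: dot_square_norm)
    have q: "2 * (a \<bullet> (a - b)) / ((a - b) \<bullet> (a - b)) = 1"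
      unfolding eq using False by (intro divide_self) simp
    show ?thesis unfolding reflection_def q by simp
  qed (simp add: reflection_def)
qed

text \<open>A reflection that takes w to |w| c, with c another basis vector, fixes b and preserves
  the cylinder; this reduces w to a coordinate.\<close>

lemma cylinder_linear_moment:
  fixes b :: "'a::euclidean_space"
  assumes b: "b \<in> Basis" and w: "w \<bullet> b = 0" and n: "DIM('a) = n + 1" "n \<ge> 1"
  shows "(\<integral>\<^sup>+z. indicator (cylinder b) z * ennreal \<bar>w \<bullet> z\<bar> \<partial>lborel) =
    ennreal (norm w * (2 * (unit_ball_vol (n - 1) * (2 / (real n + 1)))))"
proof -
  have "Basis - {b} \<noteq> {}"
    using n b by (metis Suc_eq_plus1 card.empty card_Suc_Diff1 finite_Basis not_one_le_zero One_nat_def nat.inject)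
  then obtain c where c: "c \<in> Basis" "c \<noteq> b" by blast
  have cb: "c \<bullet> b = 0" using b c by (simp add: inner_Basis)
  let ?v = "norm w *\<^sub>R c"
  let ?T = "reflection (w - ?v)"
  have T: "orthogonal_transformation ?T" by (rule reflection)
  have Tw: "?T w = ?v" using c by (intro reflection) simp
  have Tb: "?T b = b" using w cb by (intro reflection) (simp add: inner_diff_right inner_commute)
  have lin: "linear ?T" and nT: "norm (?T x) = norm x" for x
    using T by (auto simp: orthogonal_transformation)
  have T_meas[measurable]: "?T \<in> borel_measurable borel"
    using lin by (intro borel_measurable_continuous_onI linear_continuous_on linear_conv_bounded_linear[THEN iffD1])
  have cyl: "?T z \<in> cylinder b \<longleftrightarrow> z \<in> cylinder b" for z
  proof -
    have "?T z \<bullet> b = z \<bullet> b" using reflection(2)[of "w - ?v" z b] Tb by simp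
    moreover from this have "orth_part b (?T z) = ?T (orth_part b z)"
      by (simp add: orth_part_def linear_diff[OF lin] linear_scale[OF lin] Tb)
    ultimately show ?thesis by (simp add: cylinder_def nT)
  qed
  have "(\<integral>\<^sup>+z. indicator (cylinder b) z * ennreal \<bar>w \<bullet> z\<bar> \<partial>lborel) =
      (\<integral>\<^sup>+z. indicator (cylinder b) z * ennreal \<bar>w \<bullet> z\<bar> \<partial>distr lborel borel ?T)"
    by (simp add: lborel_distr_orthogonal[OF T])
  also have "\<dots> = (\<integral>\<^sup>+z. indicator (cylinder b) (?T z) * ennreal \<bar>w \<bullet> ?T z\<bar> \<partial>lborel)"
    by (subst nn_integral_distr) measurable
  also have "\<dots> = (\<integral>\<^sup>+z. ennreal (norm w) * (indicator (cylinder b) z * ennreal \<bar>z \<bullet> c\<bar>) \<partial>lborel)"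
  proof (rule nn_integral_cong)
    fix z
    have "w \<bullet> ?T z = norm w * (z \<bullet> c)"
      using reflection(2)[of "w - ?v" w z] Tw by (simp add: inner_commute)
    then show "indicator (cylinder b) (?T z) * ennreal \<bar>w \<bullet> ?T z\<bar> = ennreal (norm w) * (indicator (cylinder b) z * ennreal \<bar>z \<bullet> c\<bar>)"
      using cyl[of z] by (auto simp: indicator_def abs_mult ennreal_mult)
  qed
  also have "\<dots> = ennreal (norm w) * ennreal (2 * (unit_ball_vol (n - 1) * (2 / (real n + 1))))"
    by (subst nn_integral_cmult) (auto simp: cylinder_coordinate_moment[OF b c n(1)])
  also have "\<dots> = ennreal (norm w * (2 * (unit_ball_vol (n - 1) * (2 / (real n + 1)))))"
    using n by (subst ennreal_mult) auto
  finally show ?thesis .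
qed

section \<open>The critical constant\<close>

lemma poly_antiderivative: "\<exists>Q. pderiv Q = (P :: real poly) \<and> poly Q 0 = c"
proof -
  have monom: "pderiv (monom (a / real (Suc i)) (Suc i)) = monom a i" for a :: real and i
    by (simp add: pderiv_monom del: of_nat_Suc)
  define Q where "Q = (\<Sum>i\<le>degree P. monom (coeff P i / real (Suc i)) (Suc i)) + [:c:]"
  have "pderiv Q = (\<Sum>i\<le>degree P. monom (coeff P i) i)"
    using higher_pderiv_sum[of 1 "\<lambda>i. monom (coeff P i / real (Suc i)) (Suc i)" "{..degree P}"]
    by (simp add: Q_def pderiv_add monom pderiv_pCons del: of_nat_Suc)
  moreover have "poly Q 0 = c" by (simp add: Q_def poly_sum poly_monom)
  ultimately show ?thesis by (auto simp: poly_as_sum_of_monoms)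
qed

text \<open>Approximate the second derivative and integrate twice from 0; on [-1, 1] integration
  does not enlarge the error. The value at 0 is kept exact because the kernel identity is evaluated
  there.\<close>

lemma poly_C2_approx:
  fixes \<phi> :: "real \<Rightarrow> real"
  assumes \<phi>: "\<And>s. (\<phi> has_real_derivative \<phi>' s) (at s)" "\<And>s. (\<phi>' has_real_derivative \<phi>'' s) (at s)"
    and cont: "continuous_on {-1..1} \<phi>''" and \<delta>: "0 < \<delta>"
  obtains P where "\<And>s. s \<in> {-1..1} \<Longrightarrow> \<bar>\<phi> s - poly P s\<bar> \<le> \<delta>"
    "\<And>s. s \<in> {-1..1} \<Longrightarrow> \<bar>\<phi>' s - poly (pderiv P) s\<bar> \<le> \<delta>"
    "\<And>s. s \<in> {-1..1} \<Longrightarrow> \<bar>\<phi>'' s - poly (pderiv (pderiv P)) s\<bar> \<le> \<delta>" "poly P 0 = \<phi> 0"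
proof -
  obtain P2 where P2: "\<And>s. s \<in> {-1..1} \<Longrightarrow> \<bar>\<phi>'' s - poly P2 s\<bar> < \<delta>"
    using poly_approx[OF cont \<delta>] by blast
  obtain P1 where P1: "pderiv P1 = P2" "poly P1 0 = \<phi>' 0" using poly_antiderivative by blast
  obtain P where P: "pderiv P = P1" "poly P 0 = \<phi> 0" using poly_antiderivative by blast
  have step: "\<bar>f s\<bar> \<le> \<delta>" if "f 0 = 0" and f: "\<And>s. (f has_real_derivative f' s) (at s)"
      and b: "\<And>s. s \<in> {-1..1} \<Longrightarrow> \<bar>f' s\<bar> \<le> \<delta>" and s: "s \<in> {-1..1}" for f f' :: "real \<Rightarrow> real" and s
  proof -
    have "norm (f s - f 0) \<le> \<delta> * norm (s - 0)"
      by (rule field_differentiable_bound[of "{-1..1}" f f'])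
         (use f b s in \<open>auto intro: has_field_derivative_at_within\<close>)
    also have "\<dots> \<le> \<delta>" using s \<delta> by (simp add: abs_le_iff mult_left_le)
    finally show ?thesis using that(1) by simp
  qed
  have 2: "\<bar>\<phi>'' s - poly P2 s\<bar> \<le> \<delta>" if "s \<in> {-1..1}" for s using P2[OF that] by simp
  have 1: "\<bar>\<phi>' s - poly P1 s\<bar> \<le> \<delta>" if "s \<in> {-1..1}" for s
    by (rule step[where f="\<lambda>s. \<phi>' s - poly P1 s" and f'="\<lambda>s. \<phi>'' s - poly P2 s"])
       (use P1 2 that DERIV_diff[OF \<phi>(2) poly_DERIV[of P1]] in auto)
  have 0: "\<bar>\<phi> s - poly P s\<bar> \<le> \<delta>" if "s \<in> {-1..1}" for s
    by (rule step[where f="\<lambda>s. \<phi> s - poly P s" and f'="\<lambda>s. \<phi>' s - poly P1 s"])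
       (use P 1 that DERIV_diff[OF \<phi>(1) poly_DERIV[of P]] in auto)
  show ?thesis using that[of P] 0 1 2 P P1 by simp
qed

text \<open>Integrating \<open>1 / \<epsilon> * exp (- \<bar>s\<bar> / \<epsilon>)\<close> twice gives a solution of \<open>\<phi> - \<epsilon>\<^sup>2 \<phi>'' = \<bar>s\<bar>\<close>.\<close>

lemma double_exponential_derivatives:
  fixes \<epsilon> :: real
  assumes \<epsilon>: "0 < \<epsilon>"
  shows "((\<lambda>s. \<bar>s\<bar> + \<epsilon> * exp (- \<bar>s\<bar> / \<epsilon>)) has_real_derivative sgn s * (1 - exp (- \<bar>s\<bar> / \<epsilon>))) (at s)"
    and "((\<lambda>s. sgn s * (1 - exp (- \<bar>s\<bar> / \<epsilon>))) has_real_derivative exp (- \<bar>s\<bar> / \<epsilon>) / \<epsilon>) (at s)"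
proof -
  let ?f = "\<lambda>s. s + \<epsilon> * exp (- s / \<epsilon>)" and ?f' = "\<lambda>s. 1 - exp (- s / \<epsilon>)" and ?f'' = "\<lambda>s. exp (- s / \<epsilon>) / \<epsilon>"
  have d: "(?f has_real_derivative ?f' s) (at s)" "(?f' has_real_derivative ?f'' s) (at s)" for s
    using \<epsilon> by (auto intro!: derivative_eq_intros simp: field_simps)
  have dm: "((\<lambda>s. ?f (- s)) has_real_derivative - ?f' (- s)) (at s)"
    "((\<lambda>s. - ?f' (- s)) has_real_derivative ?f'' (- s)) (at s)" for s
    using \<epsilon> by (auto intro!: derivative_eq_intros simp: field_simps)
  \<comment> \<open>Two branches that agree at s, with equal derivatives there, combine from the
    left and the right.\<close>
  have glue: "(h has_real_derivative D) (at s)"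
    if "h1 s = h2 s" "(h1 has_real_derivative D) (at s)" "(h2 has_real_derivative D) (at s)"
      "\<And>t. t \<le> s \<Longrightarrow> h t = h1 t" "\<And>t. s \<le> t \<Longrightarrow> h t = h2 t" for h h1 h2 :: "real \<Rightarrow> real" and D s
  proof -
    have "(h has_real_derivative D) (at s within {..s})"
      by (rule has_field_derivative_transform_within[OF has_field_derivative_at_within[OF that(2)] zero_less_one])
         (use that in auto)
    moreover have "(h has_real_derivative D) (at s within {s..})"
      by (rule has_field_derivative_transform_within[OF has_field_derivative_at_within[OF that(3)] zero_less_one])
         (use that in auto)
    moreover have "{..s} \<union> {s..} = UNIV" by auto
    ultimately show ?thesis
      unfolding has_field_derivative_iff
      using Lim_within_Un[of "\<lambda>y. (h y - h s) / (y - s)" D s "{..s}" "{s..}"] by simp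
  qed
  consider "s < 0" | "0 < s" | "s = 0" by linarith
  then have "((\<lambda>s. \<bar>s\<bar> + \<epsilon> * exp (- \<bar>s\<bar> / \<epsilon>)) has_real_derivative sgn s * (1 - exp (- \<bar>s\<bar> / \<epsilon>))) (at s) \<and>
    ((\<lambda>s. sgn s * (1 - exp (- \<bar>s\<bar> / \<epsilon>))) has_real_derivative exp (- \<bar>s\<bar> / \<epsilon>) / \<epsilon>) (at s)"
  proof cases
    case 1
    have "((\<lambda>s. \<bar>s\<bar> + \<epsilon> * exp (- \<bar>s\<bar> / \<epsilon>)) has_real_derivative - ?f' (- s)) (at s)"
      "((\<lambda>s. sgn s * (1 - exp (- \<bar>s\<bar> / \<epsilon>))) has_real_derivative ?f'' (- s)) (at s)"
      by (rule has_field_derivative_transform_within_open[OF dm(1), of "{..<0}"]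
               has_field_derivative_transform_within_open[OF dm(2), of "{..<0}"]; use 1 in simp)+
    then show ?thesis using 1 by simp
  next
    case 2
    have "((\<lambda>s. \<bar>s\<bar> + \<epsilon> * exp (- \<bar>s\<bar> / \<epsilon>)) has_real_derivative ?f' s) (at s)"
      "((\<lambda>s. sgn s * (1 - exp (- \<bar>s\<bar> / \<epsilon>))) has_real_derivative ?f'' s) (at s)"
      by (rule has_field_derivative_transform_within_open[OF d(1), of "{0<..}"]
               has_field_derivative_transform_within_open[OF d(2), of "{0<..}"]; use 2 in simp)+
    then show ?thesis using 2 by simp
  next
    case 3
    have "((\<lambda>s. \<bar>s\<bar> + \<epsilon> * exp (- \<bar>s\<bar> / \<epsilon>)) has_real_derivative 0) (at 0)"
      by (rule glue[of "\<lambda>s. ?f (- s)" _ ?f]) (use dm(1)[of 0] d(1)[of 0] in auto)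
    moreover have "((\<lambda>s. sgn s * (1 - exp (- \<bar>s\<bar> / \<epsilon>))) has_real_derivative ?f'' 0) (at 0)"
      by (rule glue[of "\<lambda>s. - ?f' (- s)" _ ?f']) (use dm(2)[of 0] d(2)[of 0] in \<open>auto simp: sgn_if\<close>)
    ultimately show ?thesis using 3 by simp
  qed
  then show "((\<lambda>s. \<bar>s\<bar> + \<epsilon> * exp (- \<bar>s\<bar> / \<epsilon>)) has_real_derivative sgn s * (1 - exp (- \<bar>s\<bar> / \<epsilon>))) (at s)"
    "((\<lambda>s. sgn s * (1 - exp (- \<bar>s\<bar> / \<epsilon>))) has_real_derivative exp (- \<bar>s\<bar> / \<epsilon>) / \<epsilon>) (at s)"
    by blast+
qed

text \<open>Compares the distance with its sine, up to a term whose kernel integral is of order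
  eps^2. Up to pi / 2 the constant 1 suffices, as sin + cos \<ge> 1; beyond, the left side is at
  most pi < 4 and 1 - cos d is at least 1.\<close>

lemma sub_sin_le:
  fixes d :: real
  assumes "0 \<le> d" "d \<le> pi"
  shows "d - sin d \<le> 4 * (1 - cos d)"
proof (cases "d \<le> pi / 2")
  case True
  define h where "h t = (1 - cos t) - (t - sin t)" for t :: real
  have "h 0 \<le> h d"
  proof (rule DERIV_nonneg_imp_nondecreasing[OF assms(1)])
    fix t :: real assume t: "0 \<le> t" "t \<le> d"
    have "(h has_real_derivative sin t - (1 - cos t)) (at t)"
      unfolding h_def by (auto intro!: derivative_eq_intros)
    moreover have "0 \<le> sin t - (1 - cos t)"
    proof -
      have st: "0 \<le> sin t" "0 \<le> cos t" using t True by (auto intro: sin_ge_zero cos_ge_zero)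
      have "1 = (sin t)\<^sup>2 + (cos t)\<^sup>2" by simp
      also have "\<dots> \<le> (sin t + cos t)\<^sup>2" using st by (simp add: power2_sum del: sin_cos_squared_add)
      finally have "1 \<le> sin t + cos t" using st by (intro power2_le_imp_le[of 1]) auto
      then show ?thesis by simp
    qed
    ultimately show "\<exists>y. (h has_real_derivative y) (at t) \<and> 0 \<le> y" by blast
  qed
  then have "d - sin d \<le> 1 - cos d" by (simp add: h_def)
  also have "\<dots> \<le> 4 * (1 - cos d)" using cos_le_one[of d] by simp
  finally show ?thesis .
next
  case False
  then have "cos d \<le> 0" using assms cos_monotone_0_pi_le[of "pi / 2" d] by simp
  moreover have "0 \<le> sin d" using assms by (intro sin_ge_zero)
  ultimately have "d - sin d \<le> 4" "4 * 1 \<le> 4 * (1 - cos d)" using assms pi_less_4 by auto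
  then show ?thesis by simp
qed

context helmholtz
begin

section \<open>Moments of the kernel\<close>

lemma k_integral_mono:
  assumes y: "y \<in> sphere 0 1" and g: "continuous_on (sphere 0 1) g" and h: "continuous_on (sphere 0 1) h"
    and le: "\<And>x. x \<in> sphere 0 1 \<Longrightarrow> g x \<le> h x"
  shows "(LINT x|M. k x y * g x) \<le> (LINT x|M. k x y * h x)"
proof (rule integral_mono_AE)
  show "AE x in M. k x y * g x \<le> k x y * h x"
    using k_nonneg[OF y] AE_space
  proof eventually_elim
    case (elim x)
    then show ?case using le[of x] by (simp add: mult_left_mono)
  qed
qed (intro k_mult_continuous_integrable y g h)+

lemma k_integral_bound:
  assumes y: "y \<in> sphere 0 1" and g: "continuous_on (sphere 0 1) g"
    and le: "\<And>x. x \<in> sphere 0 1 \<Longrightarrow> \<bar>g x\<bar> \<le> B"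
  shows "\<bar>LINT x|M. k x y * g x\<bar> \<le> B"
proof -
  have "(LINT x|M. k x y * g x) \<le> (LINT x|M. k x y * B)"
    by (rule k_integral_mono[OF y g]) (use le in \<open>auto simp: abs_le_iff\<close>)
  moreover have "(LINT x|M. k x y * - B) \<le> (LINT x|M. k x y * g x)"
    by (rule k_integral_mono[OF y _ g]) (use le in \<open>auto simp: abs_le_iff minus_le_iff\<close>)
  ultimately show ?thesis by (simp add: k_mass[OF y] abs_le_iff)
qed

text \<open>x \<bullet> p is an eigenfunction of the Laplacian with eigenvalue - n, n being the
  dimension of the sphere, so its kernel integral is exactly 1 / (1 + n eps^2).\<close>

lemma k_one_sub_inner:
  assumes p: "p \<in> sphere 0 1"
  shows "(LINT x|M. k x p * (1 - x \<bullet> p)) \<le> (real DIM('a) - 1) * \<epsilon>\<^sup>2"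
proof -
  let ?m = "real DIM('a) - 1"
  have m: "0 \<le> ?m" using DIM_positive[where 'a='a] by simp
  have int: "integrable M (\<lambda>x. k x p * (x \<bullet> p))"
    by (intro k_mult_continuous_integrable p continuous_intros)
  have "p \<bullet> p = 1" using p by (simp add: dot_square_norm)
  then have "(LINT x|M. k x p * ((x \<bullet> p) + \<epsilon>\<^sup>2 * (?m * (x \<bullet> p)))) = 1"
    using k_zonal[OF p, of "[([:0, 1:], p)]"] p by (simp add: pderiv_pCons inner_commute)
  moreover have "(LINT x|M. k x p * ((x \<bullet> p) + \<epsilon>\<^sup>2 * (?m * (x \<bullet> p)))) = (1 + \<epsilon>\<^sup>2 * ?m) * (LINT x|M. k x p * (x \<bullet> p))"
    unfolding integral_mult_right_zero[symmetric] by (simp add: algebra_simps)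
  ultimately have eq: "(1 + \<epsilon>\<^sup>2 * ?m) * (LINT x|M. k x p * (x \<bullet> p)) = 1" by simp
  have le: "(LINT x|M. k x p * (x \<bullet> p)) \<le> 1"
  proof -
    have "\<bar>x \<bullet> p\<bar> \<le> 1" if "x \<in> sphere 0 1" for x
      using Cauchy_Schwarz_ineq2[of x p] that p by simp
    moreover have "continuous_on (sphere 0 1) (\<lambda>x. x \<bullet> p)" by (intro continuous_intros)
    ultimately show ?thesis using k_integral_bound[OF p, of "\<lambda>x. x \<bullet> p" 1] by (simp add: abs_le_iff)
  qed
  have "(LINT x|M. k x p * (1 - x \<bullet> p)) = (LINT x|M. k x p) - (LINT x|M. k x p * (x \<bullet> p))"
    using int k_integrable[OF p] by (simp add: right_diff_distrib)
  also have "\<dots> = \<epsilon>\<^sup>2 * ?m * (LINT x|M. k x p * (x \<bullet> p))"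
    using eq by (simp add: k_mass[OF p] algebra_simps)
  also have "\<dots> \<le> \<epsilon>\<^sup>2 * ?m * 1" using le m by (intro mult_left_mono) auto
  finally show ?thesis by (simp add: mult.commute)
qed

text \<open>Carries the kernel identity from polynomials to C2 functions of e \<bullet> x, since the
  test function for |s| is not a polynomial. The unit mass controls the error of a C2
  approximation.\<close>

lemma k_ridge:
  assumes p: "p \<in> sphere 0 1" and e: "norm e = 1" "p \<bullet> e = 0"
    and \<phi>: "\<And>s. (\<phi> has_real_derivative \<phi>' s) (at s)" "\<And>s. (\<phi>' has_real_derivative \<phi>'' s) (at s)"
    and cont: "continuous_on UNIV \<phi>''"
  shows "(LINT x|M. k x p * (\<phi> (e \<bullet> x) - \<epsilon>\<^sup>2 * ((1 - (e \<bullet> x)\<^sup>2) * \<phi>'' (e \<bullet> x) - (real DIM('a) - 1) * (e \<bullet> x) * \<phi>' (e \<bullet> x)))) = \<phi> 0"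
    (is "(LINT x|M. k x p * ?L \<phi> \<phi>' \<phi>'' x) = _")
proof -
  let ?m = "real DIM('a) - 1"
  have m: "0 \<le> ?m" using DIM_positive[where 'a='a] by simp
  have cL: "continuous_on (sphere 0 1) (?L f f' f'')"
    if "continuous_on UNIV f" "continuous_on UNIV f'" "continuous_on UNIV f''" for f f' f'' :: "real \<Rightarrow> real"
    by (intro continuous_intros continuous_on_compose2[OF that(1)] continuous_on_compose2[OF that(2)]
          continuous_on_compose2[OF that(3)]) auto
  have cphi: "continuous_on UNIV \<phi>" "continuous_on UNIV \<phi>'"
    using \<phi> by (meson DERIV_isCont continuous_at_imp_continuous_on)+
  \<comment> \<open>A C2 error \<open>\<delta>\<close> of the profile changes the operator by at
    most \<open>C * \<delta>\<close>.\<close>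
  define C where "C = 1 + \<epsilon>\<^sup>2 * (1 + ?m)"
  have C: "0 < C" using m by (auto simp: C_def intro!: add_pos_nonneg)
  have "\<bar>(LINT x|M. k x p * ?L \<phi> \<phi>' \<phi>'' x) - \<phi> 0\<bar> \<le> r" if r: "0 < r" for r
  proof -
    define \<delta> where "\<delta> = r / C"
    have \<delta>: "0 < \<delta>" "C * \<delta> = r" using r C by (auto simp: \<delta>_def)
    obtain P where P: "\<And>s. s \<in> {-1..1} \<Longrightarrow> \<bar>\<phi> s - poly P s\<bar> \<le> \<delta>"
      "\<And>s. s \<in> {-1..1} \<Longrightarrow> \<bar>\<phi>' s - poly (pderiv P) s\<bar> \<le> \<delta>"
      "\<And>s. s \<in> {-1..1} \<Longrightarrow> \<bar>\<phi>'' s - poly (pderiv (pderiv P)) s\<bar> \<le> \<delta>" "poly P 0 = \<phi> 0"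
      using poly_C2_approx[OF \<phi> continuous_on_subset[OF cont] \<delta>(1)] by blast
    let ?LP = "?L (poly P) (poly (pderiv P)) (poly (pderiv (pderiv P)))"
    have cP: "continuous_on (sphere 0 1) ?LP" by (intro cL continuous_intros)
    \<comment> \<open>As e is orthogonal to p, the value at the pole is
      \<open>poly P 0\<close>.\<close>
    have "(LINT x|M. k x p * ?LP x) = \<phi> 0"
      using k_zonal[OF p, of "[(P, e)]"] e P(4) by (simp add: inner_commute[of e p])
    then have "(LINT x|M. k x p * ?L \<phi> \<phi>' \<phi>'' x) - \<phi> 0 = (LINT x|M. k x p * ?L \<phi> \<phi>' \<phi>'' x) - (LINT x|M. k x p * ?LP x)"
      by simp
    also have "\<dots> = (LINT x|M. k x p * ?L \<phi> \<phi>' \<phi>'' x - k x p * ?LP x)"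
      by (rule Bochner_Integration.integral_diff[symmetric])
         (intro k_mult_continuous_integrable p cL cphi cont cP)+
    also have "\<dots> = (LINT x|M. k x p * (?L \<phi> \<phi>' \<phi>'' x - ?LP x))"
      by (simp only: right_diff_distrib)
    also have "\<bar>\<dots>\<bar> \<le> r"
    proof (rule k_integral_bound[OF p])
      show "continuous_on (sphere 0 1) (\<lambda>x. ?L \<phi> \<phi>' \<phi>'' x - ?LP x)"
        by (rule continuous_on_diff[OF cL[OF cphi cont] cP])
      fix x :: 'a assume x: "x \<in> sphere 0 1"
      define s where "s = e \<bullet> x"
      have s: "s \<in> {-1..1}" "\<bar>s\<bar> \<le> 1"
        using Cauchy_Schwarz_ineq2[of e x] x e by (auto simp: s_def abs_le_iff)
      have s2: "0 \<le> 1 - s\<^sup>2" "1 - s\<^sup>2 \<le> 1" using s(2) by (auto simp: abs_square_le_1)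
      have eq: "?L \<phi> \<phi>' \<phi>'' x - ?LP x = (\<phi> s - poly P s) - \<epsilon>\<^sup>2 * ((1 - s\<^sup>2) * (\<phi>'' s - poly (pderiv (pderiv P)) s)
          - ?m * (s * (\<phi>' s - poly (pderiv P) s)))"
        unfolding s_def by (simp add: algebra_simps)
      have "\<bar>(1 - s\<^sup>2) * (\<phi>'' s - poly (pderiv (pderiv P)) s)\<bar> \<le> 1 * \<delta>"
        unfolding abs_mult using P(3)[OF s(1)] s2 by (intro mult_mono) auto
      moreover have "\<bar>s * (\<phi>' s - poly (pderiv P) s)\<bar> \<le> 1 * \<delta>"
        unfolding abs_mult using P(2)[OF s(1)] s(2) by (intro mult_mono) auto
      then have "\<bar>?m * (s * (\<phi>' s - poly (pderiv P) s))\<bar> \<le> ?m * \<delta>"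
        unfolding abs_mult[of ?m] using m by (simp add: mult_left_mono)
      ultimately have "\<bar>(1 - s\<^sup>2) * (\<phi>'' s - poly (pderiv (pderiv P)) s) - ?m * (s * (\<phi>' s - poly (pderiv P) s))\<bar> \<le> (1 + ?m) * \<delta>"
        unfolding distrib_right by linarith
      then have "\<bar>\<epsilon>\<^sup>2 * ((1 - s\<^sup>2) * (\<phi>'' s - poly (pderiv (pderiv P)) s) - ?m * (s * (\<phi>' s - poly (pderiv P) s)))\<bar> \<le> \<epsilon>\<^sup>2 * ((1 + ?m) * \<delta>)"
        unfolding abs_mult[of "\<epsilon>\<^sup>2"] by (simp add: mult_left_mono)
      then have "\<bar>?L \<phi> \<phi>' \<phi>'' x - ?LP x\<bar> \<le> \<delta> + \<epsilon>\<^sup>2 * ((1 + ?m) * \<delta>)"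
        unfolding eq using P(1)[OF s(1)] by linarith
      also have "\<dots> = r" unfolding \<delta>(2)[symmetric] C_def by (simp add: algebra_simps)
      finally show "\<bar>?L \<phi> \<phi>' \<phi>'' x - ?LP x\<bar> \<le> r" .
    qed
    finally show ?thesis .
  qed
  then have "\<bar>(LINT x|M. k x p * ?L \<phi> \<phi>' \<phi>'' x) - \<phi> 0\<bar> \<le> 0"
    by (rule field_le_epsilon[of _ 0, simplified])
  then show ?thesis by simp
qed

text \<open>On the line \<open>double_exponential_derivatives\<close> solves the equation for |s|
  exactly, with value eps at 0. Curvature adds a nonnegative remainder, which gives the upper bound;
  its kernel integral of order eps^2 gives the lower one.\<close>

lemma k_abs_inner_unit:
  assumes p: "p \<in> sphere 0 1" and e: "norm e = 1" "p \<bullet> e = 0" and \<epsilon>1: "\<epsilon> \<le> 1"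
  shows "(LINT x|M. k x p * \<bar>e \<bullet> x\<bar>) \<le> \<epsilon>"
    and "\<epsilon> - 3 * (real DIM('a) - 1) * \<epsilon>\<^sup>2 \<le> (LINT x|M. k x p * \<bar>e \<bullet> x\<bar>)"
proof -
  let ?m = "real DIM('a) - 1"
  let ?E = "\<lambda>x. exp (- \<bar>e \<bullet> x\<bar> / \<epsilon>)"
  \<comment> \<open>The curvature remainder: 1 - s^2 instead of 1 before the second derivative, and
    the first-order term.\<close>
  let ?g = "\<lambda>x. \<epsilon> * (e \<bullet> x)\<^sup>2 * ?E x + \<epsilon>\<^sup>2 * ?m * (\<bar>e \<bullet> x\<bar> * (1 - ?E x))"
  have m: "0 \<le> ?m" using DIM_positive[where 'a='a] by simp
  have E: "0 \<le> ?E x" "?E x \<le> 1" for x using eps by auto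
  have cg: "continuous_on (sphere 0 1) ?g" using eps by (intro continuous_intros) auto
  have ce: "continuous_on (sphere 0 1) (\<lambda>x. \<bar>e \<bullet> x\<bar>)" by (intro continuous_intros)
  have "(LINT x|M. k x p * (\<bar>e \<bullet> x\<bar> + ?g x)) = \<epsilon>"
  proof -
    have "(LINT x|M. k x p * (\<bar>e \<bullet> x\<bar> + ?g x)) = (LINT x|M. k x p * ((\<bar>e \<bullet> x\<bar> + \<epsilon> * ?E x)
      - \<epsilon>\<^sup>2 * ((1 - (e \<bullet> x)\<^sup>2) * (?E x / \<epsilon>) - ?m * (e \<bullet> x) * (sgn (e \<bullet> x) * (1 - ?E x)))))"
    proof (rule Bochner_Integration.integral_cong)
      fix x
      have gen: "y + (\<epsilon> * s\<^sup>2 * E + \<epsilon>\<^sup>2 * m * (y * (1 - E))) =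
          (y + \<epsilon> * E) - \<epsilon>\<^sup>2 * ((1 - s\<^sup>2) * (E / \<epsilon>) - m * s * (g * (1 - E)))" if "s * g = y" for y s E g m :: real
        unfolding that[symmetric] using eps by (simp add: field_simps power2_eq_square)
      have "(e \<bullet> x) * sgn (e \<bullet> x) = \<bar>e \<bullet> x\<bar>" by (simp add: abs_sgn)
      from gen[OF this] show "k x p * (\<bar>e \<bullet> x\<bar> + ?g x) = k x p * ((\<bar>e \<bullet> x\<bar> + \<epsilon> * ?E x)
        - \<epsilon>\<^sup>2 * ((1 - (e \<bullet> x)\<^sup>2) * (?E x / \<epsilon>) - ?m * (e \<bullet> x) * (sgn (e \<bullet> x) * (1 - ?E x))))"
        by (simp only:)
    qed simp
    also have "\<dots> = \<bar>0\<bar> + \<epsilon> * exp (- \<bar>0\<bar> / \<epsilon>)"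
      using eps by (intro k_ridge[OF p e double_exponential_derivatives[OF eps]] continuous_intros) auto
    finally show ?thesis by simp
  qed
  moreover have "(LINT x|M. k x p * (\<bar>e \<bullet> x\<bar> + ?g x)) = (LINT x|M. k x p * \<bar>e \<bullet> x\<bar>) + (LINT x|M. k x p * ?g x)"
    using Bochner_Integration.integral_add[OF k_mult_continuous_integrable[OF p ce] k_mult_continuous_integrable[OF p cg]]
    by (simp only: distrib_left)
  ultimately have eq: "(LINT x|M. k x p * \<bar>e \<bullet> x\<bar>) = \<epsilon> - (LINT x|M. k x p * ?g x)" by simp
  have "(LINT x|M. k x p * 0) \<le> (LINT x|M. k x p * ?g x)"
    using eps m E by (intro k_integral_mono[OF p _ cg]) (auto intro!: add_nonneg_nonneg mult_nonneg_nonneg)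
  then show "(LINT x|M. k x p * \<bar>e \<bullet> x\<bar>) \<le> \<epsilon>" using eq by simp
  have "(LINT x|M. k x p * ?g x) \<le> (LINT x|M. k x p * (2 * \<epsilon> * (1 - x \<bullet> p) + \<epsilon>\<^sup>2 * ?m))"
  proof (rule k_integral_mono[OF p cg])
    show "continuous_on (sphere 0 1) (\<lambda>x. 2 * \<epsilon> * (1 - x \<bullet> p) + \<epsilon>\<^sup>2 * ?m)" by (intro continuous_intros)
    fix x :: 'a assume x: "x \<in> sphere 0 1"
    have b: "\<bar>e \<bullet> x\<bar> \<le> 1" "\<bar>x \<bullet> p\<bar> \<le> 1"
      using Cauchy_Schwarz_ineq2[of e x] Cauchy_Schwarz_ineq2[of x p] x e p by auto
    \<comment> \<open>Only the part of x orthogonal to p is seen by e, and its squared length is (1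
      + x \<bullet> p) (1 - x \<bullet> p).\<close>
    have "(e \<bullet> x)\<^sup>2 \<le> 2 * (1 - x \<bullet> p)"
    proof -
      let ?r = "x - (x \<bullet> p) *\<^sub>R p"
      have pp: "p \<bullet> p = 1" and xx: "x \<bullet> x = 1" using p x by (simp_all add: dot_square_norm)
      have "(e \<bullet> x)\<^sup>2 = (e \<bullet> ?r)\<^sup>2" using e(2) by (simp add: inner_diff_right inner_commute)
      also have "\<dots> \<le> (e \<bullet> e) * (?r \<bullet> ?r)" by (rule Cauchy_Schwarz_ineq)
      also have "\<dots> = 1 - (x \<bullet> p)\<^sup>2"
        using e(1) by (simp add: inner_diff_left inner_diff_right inner_commute[of p x] pp xx dot_square_norm[of e] power2_eq_square)
      also have "\<dots> = (1 + x \<bullet> p) * (1 - x \<bullet> p)" by (simp add: algebra_simps power2_eq_square)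
      also have "\<dots> \<le> 2 * (1 - x \<bullet> p)" using b(2) by (intro mult_right_mono) (auto simp: abs_le_iff)
      finally show ?thesis .
    qed
    then have "(e \<bullet> x)\<^sup>2 * ?E x \<le> 2 * (1 - x \<bullet> p) * 1"
      using E b(2) by (intro mult_mono) (auto simp: abs_le_iff)
    then have "\<epsilon> * ((e \<bullet> x)\<^sup>2 * ?E x) \<le> \<epsilon> * (2 * (1 - x \<bullet> p))" using eps by simp
    moreover have "\<bar>e \<bullet> x\<bar> * (1 - ?E x) \<le> 1 * 1" using b(1) E by (intro mult_mono) auto
    then have "\<epsilon>\<^sup>2 * ?m * (\<bar>e \<bullet> x\<bar> * (1 - ?E x)) \<le> \<epsilon>\<^sup>2 * ?m * 1"
      using m by (intro mult_left_mono) auto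
    ultimately show "?g x \<le> 2 * \<epsilon> * (1 - x \<bullet> p) + \<epsilon>\<^sup>2 * ?m" by (simp add: mult_ac)
  qed
  also have "\<dots> = (LINT x|M. 2 * \<epsilon> * (k x p * (1 - x \<bullet> p)) + \<epsilon>\<^sup>2 * ?m * k x p)"
    by (rule Bochner_Integration.integral_cong) (auto simp: algebra_simps)
  also have "\<dots> = 2 * \<epsilon> * (LINT x|M. k x p * (1 - x \<bullet> p)) + \<epsilon>\<^sup>2 * ?m * (LINT x|M. k x p)"
  proof -
    have "integrable M (\<lambda>x. k x p * (1 - x \<bullet> p))" by (intro k_mult_continuous_integrable p continuous_intros)
    then show ?thesis
      using k_integrable[OF p] by (subst Bochner_Integration.integral_add) simp_all
  qed
  \<comment> \<open>The constant 3 in the claim is 2 from the quadratic remainder, by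
    \<open>k_one_sub_inner\<close> and eps \<le> 1, plus 1 from the first-order one.\<close>
  also have "\<dots> \<le> 2 * 1 * (?m * \<epsilon>\<^sup>2) + \<epsilon>\<^sup>2 * ?m"
  proof -
    have "(LINT x|M. k x p * 0) \<le> (LINT x|M. k x p * (1 - x \<bullet> p))"
    proof (rule k_integral_mono[OF p])
      show "0 \<le> 1 - x \<bullet> p" if "x \<in> sphere 0 1" for x
        using Cauchy_Schwarz_ineq2[of x p] that p by simp
    qed (intro continuous_intros)+
    then have "2 * \<epsilon> * (LINT x|M. k x p * (1 - x \<bullet> p)) \<le> 2 * 1 * (?m * \<epsilon>\<^sup>2)"
      using \<epsilon>1 eps k_one_sub_inner[OF p] by (intro mult_mono) auto
    then show ?thesis by (simp add: k_mass[OF p])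
  qed
  finally have "(LINT x|M. k x p * ?g x) \<le> 3 * ?m * \<epsilon>\<^sup>2" by (simp add: algebra_simps)
  then show "\<epsilon> - 3 * ?m * \<epsilon>\<^sup>2 \<le> (LINT x|M. k x p * \<bar>e \<bullet> x\<bar>)" using eq by simp
qed

lemma k_abs_inner:
  assumes p: "p \<in> sphere 0 1" and e: "p \<bullet> e = 0" and \<epsilon>1: "\<epsilon> \<le> 1"
  shows "(LINT x|M. k x p * \<bar>e \<bullet> x\<bar>) \<in> {(\<epsilon> - 3 * (real DIM('a) - 1) * \<epsilon>\<^sup>2) * norm e .. \<epsilon> * norm e}"
proof (cases "e = 0")
  case False
  let ?u = "e /\<^sub>R norm e"
  have u: "norm ?u = 1" "p \<bullet> ?u = 0" using False e by auto
  have "k x p * \<bar>e \<bullet> x\<bar> = norm e * (k x p * \<bar>?u \<bullet> x\<bar>)" for x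
    using False by (simp add: abs_mult)
  then have "(LINT x|M. k x p * \<bar>e \<bullet> x\<bar>) = norm e * (LINT x|M. k x p * \<bar>?u \<bullet> x\<bar>)"
    by (simp only: integral_mult_right_zero)
  then show ?thesis
    using k_abs_inner_unit[OF p u \<epsilon>1] False by (simp add: mult.commute mult_left_mono)
qed simp

text \<open>
  Averaging the previous estimate over all \<open>e \<bottom> p\<close>, which are parametrised by the images of
  the \<open>orth_part b z\<close>, \<open>z \<in> cylinder b\<close>, under a reflection that takes
  \<open>b\<close> to \<open>p\<close>.
\<close>

lemma k_sin_dist:
  assumes p: "p \<in> sphere 0 1" and \<epsilon>1: "\<epsilon> \<le> 1" and n: "DIM('a) = n + 1" "n \<ge> 2"
    and small: "3 * real n * \<epsilon> \<le> 1"
  shows "k_const n * (LINT x|M. k x p * sqrt (1 - (x \<bullet> p)\<^sup>2)) \<in> {\<epsilon> - 3 * real n * \<epsilon>\<^sup>2 .. \<epsilon>}"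
proof -
  obtain b :: 'a where b: "b \<in> Basis" using nonempty_Basis by blast
  define R where "R = reflection (b - p)"
  have R: "orthogonal_transformation R" unfolding R_def by (rule reflection)
  have Rsym: "R x \<bullet> y = x \<bullet> R y" for x y unfolding R_def by (rule reflection)
  have Rb: "R b = p" unfolding R_def using b p by (intro reflection) simp
  have nR: "norm (R x) = norm x" and linR: "linear R" for x using R by (auto simp: orthogonal_transformation)
  define e where "e z = R (orth_part b z)" for z
  have ob: "orth_part b z \<bullet> b = 0" for z using b by (simp add: orth_part_def inner_diff_left)
  have osym: "orth_part b z \<bullet> w = z \<bullet> orth_part b w" for z w
    by (simp add: orth_part_def inner_diff_left inner_diff_right inner_commute)
  have pe: "p \<bullet> e z = 0" for z
    using Rsym[of b "e z"] by (metis R Rb e_def inner_commute ob orthogonal_transformation_def)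
  have ne: "norm (e z) = norm (orth_part b z)" for z by (simp add: e_def nR)
  \<comment> \<open>Both \<open>R\<close> and the projection are self-adjoint. So for fixed x this
    is linear in z, and the norm of the functional is the sine of the distance from x to p.\<close>
  have ex: "e z \<bullet> x = orth_part b (R x) \<bullet> z" for x z
    by (simp only: e_def Rsym osym inner_commute[of z])
  have cont_e: "continuous_on UNIV e"
    unfolding e_def orth_part_def
    by (intro continuous_on_compose2[OF linear_continuous_on[OF linR[unfolded linear_conv_bounded_linear], of UNIV]] continuous_intros) auto
  have [measurable]: "e \<in> borel_measurable borel" by (rule borel_measurable_continuous_onI[OF cont_e])
  have k_meas[measurable]: "(\<lambda>x. k x p) \<in> borel_measurable M" using k_integrable[OF p] by auto
  have [measurable]: "(\<lambda>x. x) \<in> borel_measurable M" by (rule sphere_measure_borel) simp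
  interpret L: sigma_finite_measure "lborel :: 'a measure" by (rule sigma_finite_lborel)
  interpret V: pair_sigma_finite M "lborel :: 'a measure" ..
  define A where "A = 2 * (unit_ball_vol n * (n / (real n + 1)))"
  define \<kappa> where "\<kappa> = 2 * (unit_ball_vol (n - 1) * (2 / (real n + 1)))"
  have A: "0 < A" using n by (simp add: A_def unit_ball_vol_pos)
  have \<kappa>: "0 < \<kappa>" using n by (simp add: \<kappa>_def unit_ball_vol_pos)
  \<comment> \<open>The origin of \<open>k_const\<close>: the ratio of the linear to the radial
    moment, that is, the mean of |e \<bullet> v| over unit e orthogonal to p, for a unit vector v
    orthogonal to p.\<close>
  have kn: "\<kappa> = k_const n * A"
  proof -
    have "n - 2 + 1 = n - 1" "n - 1 + 1 = n" "real (n - 1) = real n - 1" using n by auto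
    then have "unit_sphere_area (n - 2) = (real n - 1) * unit_ball_vol (real n - 1)"
      "unit_sphere_area (n - 1) = real n * unit_ball_vol (real n)"
      unfolding unit_sphere_area_def by (simp_all only:)
    moreover have "2 * (r * (2 / (x + 1))) = 2 / (x - 1) * ((x - 1) * r / (x * q)) * (2 * (q * (x / (x + 1))))"
      if "1 < x" "q \<noteq> 0" for x r q :: real
      using that by (simp add: divide_simps)
    moreover have "unit_ball_vol (real n) \<noteq> 0" using unit_ball_vol_pos[of "real n"] by linarith
    ultimately show ?thesis
      using n unfolding k_const_def A_def \<kappa>_def by simp
  qed
  define a where "a = (LINT x|M. k x p * sqrt (1 - (x \<bullet> p)\<^sup>2))"
  have inner1: "\<bar>x \<bullet> p\<bar> \<le> 1" if "x \<in> sphere 0 1" for x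
    using Cauchy_Schwarz_ineq2[of x p] that p by simp
  have norm_o: "norm (orth_part b (R x)) = sqrt (1 - (x \<bullet> p)\<^sup>2)" if x: "x \<in> sphere 0 1" for x
  proof -
    have "orth_part b (R x) \<bullet> orth_part b (R x) = R x \<bullet> R x - (R x \<bullet> b)\<^sup>2"
      using b by (simp add: orth_part_def inner_diff_left inner_diff_right inner_commute power2_eq_square)
    also have "R x \<bullet> R x = 1" using x nR[of x] by (simp add: dot_square_norm)
    also have "R x \<bullet> b = x \<bullet> p" by (simp add: Rsym Rb)
    finally show ?thesis by (simp add: norm_eq_sqrt_inner)
  qed
  \<comment> \<open>Integrating over x first brings in the bounds for each fixed e; integrating over
    z first produces the sine of the distance.\<close>
  let ?I = "\<integral>\<^sup>+z. (\<integral>\<^sup>+x. indicator (cylinder b) z * ennreal (k x p * \<bar>e z \<bullet> x\<bar>) \<partial>M) \<partial>lborel"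
  have "?I = (\<integral>\<^sup>+x. (\<integral>\<^sup>+z. indicator (cylinder b) z * ennreal (k x p * \<bar>e z \<bullet> x\<bar>) \<partial>lborel) \<partial>M)"
    by (rule V.Fubini') (simp add: case_prod_unfold)
  also have "\<dots> = (\<integral>\<^sup>+x. ennreal \<kappa> * ennreal (k x p * sqrt (1 - (x \<bullet> p)\<^sup>2)) \<partial>M)"
  proof (rule nn_integral_cong_AE)
    show "AE x in M. (\<integral>\<^sup>+z. indicator (cylinder b) z * ennreal (k x p * \<bar>e z \<bullet> x\<bar>) \<partial>lborel)
        = ennreal \<kappa> * ennreal (k x p * sqrt (1 - (x \<bullet> p)\<^sup>2))"
      using k_nonneg[OF p] AE_space
    proof eventually_elim
      case (elim x)
      then have x: "x \<in> sphere 0 1" by simp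
      have "(\<integral>\<^sup>+z. indicator (cylinder b) z * ennreal (k x p * \<bar>e z \<bullet> x\<bar>) \<partial>lborel)
          = (\<integral>\<^sup>+z. ennreal (k x p) * (indicator (cylinder b) z * ennreal \<bar>orth_part b (R x) \<bullet> z\<bar>) \<partial>lborel)"
        using elim by (intro nn_integral_cong) (simp add: ex ennreal_mult mult_ac)
      also have "\<dots> = ennreal (k x p) * ennreal (norm (orth_part b (R x)) * \<kappa>)"
        using n by (subst nn_integral_cmult) (auto simp: cylinder_linear_moment[OF b ob n(1)] \<kappa>_def)
      also have "\<dots> = ennreal \<kappa> * ennreal (k x p * sqrt (1 - (x \<bullet> p)\<^sup>2))"
        using elim \<kappa> inner1[OF x] by (simp add: norm_o[OF x] ennreal_mult[symmetric] mult_ac abs_square_le_1)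
      finally show ?case .
    qed
  qed
  also have "\<dots> = ennreal \<kappa> * ennreal a"
  proof -
    have c: "continuous_on (sphere 0 1) (\<lambda>x. sqrt (1 - (x \<bullet> p)\<^sup>2))" by (intro continuous_intros)
    have "(\<integral>\<^sup>+x. ennreal (k x p * sqrt (1 - (x \<bullet> p)\<^sup>2)) \<partial>M) = ennreal a"
      unfolding a_def
    proof (rule nn_integral_eq_integral)
      show "integrable M (\<lambda>x. k x p * sqrt (1 - (x \<bullet> p)\<^sup>2))" by (rule k_mult_continuous_integrable[OF p c])
      show "AE x in M. 0 \<le> k x p * sqrt (1 - (x \<bullet> p)\<^sup>2)"
        using k_nonneg[OF p] AE_space
      proof eventually_elim
        case (elim x)
        then show ?case using inner1[of x] by (simp add: abs_square_le_1)
      qed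
    qed
    then show ?thesis by (subst nn_integral_cmult) auto
  qed
  finally have I: "?I = ennreal \<kappa> * ennreal a" .
  have inner: "(\<integral>\<^sup>+x. indicator (cylinder b) z * ennreal (k x p * \<bar>e z \<bullet> x\<bar>) \<partial>M)
      = indicator (cylinder b) z * ennreal (LINT x|M. k x p * \<bar>e z \<bullet> x\<bar>)" for z
  proof -
    have "(\<integral>\<^sup>+x. ennreal (k x p * \<bar>e z \<bullet> x\<bar>) \<partial>M) = ennreal (LINT x|M. k x p * \<bar>e z \<bullet> x\<bar>)"
    proof (rule nn_integral_eq_integral)
      show "integrable M (\<lambda>x. k x p * \<bar>e z \<bullet> x\<bar>)"
        by (intro k_mult_continuous_integrable p continuous_intros)
      show "AE x in M. 0 \<le> k x p * \<bar>e z \<bullet> x\<bar>"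
        using k_nonneg[OF p] by eventually_elim simp
    qed
    then show ?thesis by (subst nn_integral_cmult) auto
  qed
  let ?lo = "\<epsilon> - 3 * real n * \<epsilon>\<^sup>2"
  \<comment> \<open>\<open>ennreal\<close> cuts off at 0, so the lower bound has to be nonnegative;
    this is the purpose of \<open>small\<close>.\<close>
  have lo: "0 \<le> ?lo"
  proof -
    have "3 * real n * \<epsilon> * \<epsilon> \<le> 1 * \<epsilon>" using small eps by (intro mult_right_mono) auto
    then show ?thesis by (simp add: power2_eq_square)
  qed
  have dim_n: "real DIM('a) - 1 = real n" using n by simp
  note range = k_abs_inner[OF p pe \<epsilon>1, unfolded dim_n ne]
  have [measurable]: "orth_part b \<in> borel_measurable borel" unfolding orth_part_def by measurable
  have mom: "(\<integral>\<^sup>+z. indicator (cylinder b) z * ennreal (c * norm (orth_part b z)) \<partial>lborel) = ennreal (c * A)"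
    if c: "0 \<le> c" for c
  proof -
    have "(\<integral>\<^sup>+z. indicator (cylinder b) z * ennreal (c * norm (orth_part b z)) \<partial>lborel)
        = (\<integral>\<^sup>+z. ennreal c * (indicator (cylinder b) z * ennreal (norm (orth_part b z))) \<partial>lborel)"
      using c by (intro nn_integral_cong) (simp add: ennreal_mult mult_ac)
    also have "\<dots> = ennreal c * ennreal A"
      by (subst nn_integral_cmult) (auto simp: cylinder_radial_moment[OF b n(1)] A_def)
    finally show ?thesis using c A by (simp add: ennreal_mult)
  qed
  have "?I \<le> (\<integral>\<^sup>+z. indicator (cylinder b) z * ennreal (\<epsilon> * norm (orth_part b z)) \<partial>lborel)"
    unfolding inner by (intro nn_integral_mono mult_left_mono ennreal_leI) (use range in auto)
  then have up: "ennreal \<kappa> * ennreal a \<le> ennreal (\<epsilon> * A)" using mom[of \<epsilon>] eps I by simp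
  have "(\<integral>\<^sup>+z. indicator (cylinder b) z * ennreal (?lo * norm (orth_part b z)) \<partial>lborel) \<le> ?I"
    unfolding inner by (intro nn_integral_mono mult_left_mono ennreal_leI) (use range in auto)
  then have down: "ennreal (?lo * A) \<le> ennreal \<kappa> * ennreal a" using mom[OF lo] I by simp
  have a0: "0 \<le> a"
  proof -
    have "(LINT x|M. k x p * 0) \<le> a"
      unfolding a_def by (rule k_integral_mono[OF p]) (use inner1 in \<open>auto intro!: continuous_intros simp: abs_square_le_1\<close>)
    then show ?thesis by simp
  qed
  have "\<kappa> * a \<le> \<epsilon> * A" "?lo * A \<le> \<kappa> * a"
    using up down a0 \<kappa> A eps by (simp_all add: ennreal_mult[symmetric] ennreal_le_iff mult_nonneg_nonneg)
  then have "k_const n * a * A \<le> \<epsilon> * A" "?lo * A \<le> k_const n * a * A"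
    by (simp_all add: kn mult_ac)
  then show ?thesis using A by (simp add: a_def)
qed

text \<open>With d the distance, sin d \<le> d \<le> sin d + 4 (1 - cos d), and the last term
  integrates to order eps^2. Dividing by eps leaves an error of order eps.\<close>

lemma gamma_eps_bounds:
  assumes p: "p \<in> sphere 0 1" and \<epsilon>1: "\<epsilon> \<le> 1" and n: "DIM('a) = n + 1" "n \<ge> 2"
    and small: "3 * real n * \<epsilon> \<le> 1"
  shows "1 / gamma_eps n \<epsilon> K p \<in> {1 - 3 * real n * \<epsilon> .. 1 + 4 * real n * k_const n * \<epsilon>}"
proof -
  have inner1: "-1 \<le> x \<bullet> p" "x \<bullet> p \<le> 1" if "x \<in> sphere 0 1" for x
    using Cauchy_Schwarz_ineq2[of x p] that p by (auto simp: abs_le_iff)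
  have kn: "0 \<le> k_const n" using n by (simp add: k_const_def unit_sphere_area_def)
  have c_acos: "continuous_on (sphere 0 1) (\<lambda>x. arccos (x \<bullet> p))"
    using inner1 by (intro continuous_intros) auto
  have c_sin: "continuous_on (sphere 0 1) (\<lambda>x. sqrt (1 - (x \<bullet> p)\<^sup>2))" by (intro continuous_intros)
  define I where "I = (LINT x|M. k x p * arccos (x \<bullet> p))"
  have "(LINT x|M. geodesic_dist x p / \<epsilon> * K x p) = (LINT x|M. K x p * (arccos (x \<bullet> p) / \<epsilon>))"
    by (rule Bochner_Integration.integral_cong) (use p dim in \<open>auto simp: geodesic_dist_eq_arccos\<close>)
  also have "\<dots> = (LINT x|M. k x p * (arccos (x \<bullet> p) / \<epsilon>))"
    by (intro integral_k_eq p integrable_sphere_continuous continuous_intros c_acos) (use eps in auto)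
  also have "\<dots> = I / \<epsilon>" by (simp add: I_def)
  finally have J: "(LINT x|M. geodesic_dist x p / \<epsilon> * K x p) = I / \<epsilon>" .
  have g: "1 / gamma_eps n \<epsilon> K p = k_const n * (I / \<epsilon>)" unfolding gamma_eps_def J by simp
  define a where "a = (LINT x|M. k x p * sqrt (1 - (x \<bullet> p)\<^sup>2))"
  have a: "k_const n * a \<in> {\<epsilon> - 3 * real n * \<epsilon>\<^sup>2 .. \<epsilon>}"
    unfolding a_def by (rule k_sin_dist[OF p \<epsilon>1 n small])
  have sin: "sin (arccos (x \<bullet> p)) = sqrt (1 - (x \<bullet> p)\<^sup>2)" "cos (arccos (x \<bullet> p)) = x \<bullet> p"
    "0 \<le> arccos (x \<bullet> p)" "arccos (x \<bullet> p) \<le> pi" if "x \<in> sphere 0 1" for x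
    using inner1[OF that] by (auto simp: sin_arccos arccos_lbound arccos_ubound)
  have "a \<le> I"
    unfolding a_def I_def
  proof (rule k_integral_mono[OF p c_sin c_acos])
    show "sqrt (1 - (x \<bullet> p)\<^sup>2) \<le> arccos (x \<bullet> p)" if "x \<in> sphere 0 1" for x
      using sin_x_le_x[of "arccos (x \<bullet> p)"] sin[OF that] by simp
  qed
  have "I \<le> (LINT x|M. k x p * (sqrt (1 - (x \<bullet> p)\<^sup>2) + 4 * (1 - x \<bullet> p)))"
    unfolding I_def
  proof (rule k_integral_mono[OF p c_acos])
    show "continuous_on (sphere 0 1) (\<lambda>x. sqrt (1 - (x \<bullet> p)\<^sup>2) + 4 * (1 - x \<bullet> p))" by (intro continuous_intros)
    show "arccos (x \<bullet> p) \<le> sqrt (1 - (x \<bullet> p)\<^sup>2) + 4 * (1 - x \<bullet> p)" if "x \<in> sphere 0 1" for x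
      using sub_sin_le[of "arccos (x \<bullet> p)"] sin[OF that] by simp
  qed
  also have "\<dots> = a + 4 * (LINT x|M. k x p * (1 - x \<bullet> p))"
  proof -
    have i: "integrable M (\<lambda>x. k x p * sqrt (1 - (x \<bullet> p)\<^sup>2))" "integrable M (\<lambda>x. k x p * (4 * (1 - x \<bullet> p)))"
      by (intro k_mult_continuous_integrable p continuous_intros)+
    have "(LINT x|M. k x p * (4 * (1 - x \<bullet> p))) = 4 * (LINT x|M. k x p * (1 - x \<bullet> p))"
      unfolding integral_mult_right_zero[symmetric] by (simp only: mult.left_commute)
    then show ?thesis
      unfolding distrib_left[of "k _ p"] a_def using Bochner_Integration.integral_add[OF i] by simp
  qed
  also have "\<dots> \<le> a + 4 * (real n * \<epsilon>\<^sup>2)" using k_one_sub_inner[OF p] n by simp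
  finally have "I \<le> a + 4 * (real n * \<epsilon>\<^sup>2)" .
  then have "k_const n * I \<le> k_const n * (a + 4 * (real n * \<epsilon>\<^sup>2))" using kn by (rule mult_left_mono)
  then have 1: "k_const n * I \<le> \<epsilon> + 4 * real n * k_const n * \<epsilon>\<^sup>2" using a by (simp add: algebra_simps)
  have "k_const n * a \<le> k_const n * I" using \<open>a \<le> I\<close> kn by (rule mult_left_mono)
  then have 2: "\<epsilon> - 3 * real n * \<epsilon>\<^sup>2 \<le> k_const n * I" using a by simp
  have "k_const n * I / \<epsilon> \<le> (\<epsilon> + 4 * real n * k_const n * \<epsilon>\<^sup>2) / \<epsilon>" "(\<epsilon> - 3 * real n * \<epsilon>\<^sup>2) / \<epsilon> \<le> k_const n * I / \<epsilon>"
    using 1 2 eps by (simp_all add: divide_right_mono)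
  then show ?thesis using eps by (simp add: g add_divide_distrib diff_divide_distrib power2_eq_square)
qed

end

lemma gamma_crit_eq_1:
  fixes K :: "real \<Rightarrow> 'a::euclidean_space \<Rightarrow> 'a \<Rightarrow> real"
  assumes n: "n \<ge> 2" "DIM('a) = n + 1" and K: "\<And>\<epsilon>. \<epsilon> > 0 \<Longrightarrow> helmholtz_kernel \<epsilon> (K \<epsilon>)"
    and p: "p \<in> sphere 0 1"
  shows "gamma_crit n K p = 1"
proof -
  let ?g = "\<lambda>\<epsilon>. 1 / gamma_eps n \<epsilon> (K \<epsilon>) p"
  have ev: "\<forall>\<^sub>F \<epsilon> in at_right 0. ?g \<epsilon> \<in> {1 - 3 * real n * \<epsilon> .. 1 + 4 * real n * k_const n * \<epsilon>}"
  proof (rule eventually_mono[OF eventually_at_right_real[of 0 "1 / (3 * real n)"]])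
    fix \<epsilon> :: real assume \<epsilon>: "\<epsilon> \<in> {0<..<1 / (3 * real n)}"
    then have small: "3 * real n * \<epsilon> \<le> 1" using n by (simp add: field_simps)
    moreover have "1 * \<epsilon> \<le> 3 * real n * \<epsilon>" using n \<epsilon> by (intro mult_right_mono) auto
    ultimately have "\<epsilon> \<le> 1" by simp
    interpret helmholtz \<epsilon> "K \<epsilon>"
      by standard (use \<epsilon> n K in auto)
    show "?g \<epsilon> \<in> {1 - 3 * real n * \<epsilon> .. 1 + 4 * real n * k_const n * \<epsilon>}"
      by (rule gamma_eps_bounds[OF p \<open>\<epsilon> \<le> 1\<close> n(2,1) small])
  qed (use n in simp)
  have "(?g \<longlongrightarrow> 1) (at_right 0)"
  proof (rule tendsto_sandwich)
    show "((\<lambda>\<epsilon>. 1 - 3 * real n * \<epsilon>) \<longlongrightarrow> 1) (at_right 0)" "((\<lambda>\<epsilon>. 1 + 4 * real n * k_const n * \<epsilon>) \<longlongrightarrow> 1) (at_right 0)"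
      by (auto intro!: tendsto_eq_intros)
  qed (use ev in \<open>auto elim: eventually_mono\<close>)
  from tendsto_inverse[OF this] have "((\<lambda>\<epsilon>. gamma_eps n \<epsilon> (K \<epsilon>) p) \<longlongrightarrow> 1) (at_right 0)" by simp
  then show ?thesis unfolding gamma_crit_def by (intro tendsto_Lim) simp
qed

section \<open>Gamma-convergence\<close>

text \<open>Each competing field has bounded divergence, so its integral over a set is continuous in
  L1; a supremum of continuous functionals is lower semicontinuous.\<close>

lemma Per_lower_semicontinuous:
  fixes \<Omega> :: "'a::euclidean_space set"
  assumes \<Omega>: "\<Omega> \<in> sets sphere_measure" and W: "\<And>\<epsilon>. 0 < \<epsilon> \<Longrightarrow> W \<epsilon> \<in> sets sphere_measure"
    and conv: "L1_converges W \<Omega>"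
  shows "Per \<Omega> \<le> Liminf (at_right 0) (\<lambda>\<epsilon>. Per (W \<epsilon>))"
  unfolding Per_def[of \<Omega>] total_variation_def
proof (rule SUP_least)
  let ?M = "sphere_measure :: 'a measure"
  interpret finite_measure ?M by (rule finite_measure_sphere)
  fix X :: "'a \<Rightarrow> 'a"
  assume X: "X \<in> {X. smooth_vector_field X \<and> (\<forall>x\<in>sphere 0 1. norm (X x) \<le> 1)}"
  then have "C1_sphere X" by (auto simp: smooth_vector_field_def smooth_fun_on_imp_C1_sphere)
  then have cont: "continuous_on (sphere 0 1) (sphere_div X)" by (rule sphere_div_continuous)
  then have int: "integrable ?M (sphere_div X)" by (rule integrable_sphere_continuous)
  have "compact (sphere_div X ` sphere 0 1)" using cont by (intro compact_continuous_image) auto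
  then obtain B where B: "\<And>x. x \<in> sphere 0 1 \<Longrightarrow> norm (sphere_div X x) \<le> B"
    by (meson bounded_iff compact_imp_bounded imageI)
  let ?I = "\<lambda>A. LINT x|?M. indicator A x * sphere_div X x"
  have intA: "integrable ?M (\<lambda>x. indicator A x * sphere_div X x)" if "A \<in> sets ?M" for A
    using integrable_mult_indicator[OF that int] by simp
  have bound: "\<bar>?I (W \<epsilon>) - ?I \<Omega>\<bar> \<le> B * measure ?M (sym_diff \<Omega> (W \<epsilon>))" if \<epsilon>: "0 < \<epsilon>" for \<epsilon>
  proof -
    have SD[measurable]: "sym_diff \<Omega> (W \<epsilon>) \<in> sets ?M" using \<Omega> W[OF \<epsilon>] by auto
    have "?I (W \<epsilon>) - ?I \<Omega> = (LINT x|?M. indicator (W \<epsilon>) x * sphere_div X x - indicator \<Omega> x * sphere_div X x)"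
      using intA \<Omega> W[OF \<epsilon>] by simp
    also have "norm \<dots> \<le> (LINT x|?M. B * indicator (sym_diff \<Omega> (W \<epsilon>)) x)"
    proof (rule Bochner_Integration.integral_norm_bound_integral)
      show "integrable ?M (\<lambda>x. indicator (W \<epsilon>) x * sphere_div X x - indicator \<Omega> x * sphere_div X x)"
        using intA \<Omega> W[OF \<epsilon>] by simp
      show "integrable ?M (\<lambda>x. B * indicator (sym_diff \<Omega> (W \<epsilon>)) x)"
        by (intro integrable_mult_right integrable_real_indicator) (auto simp: less_top[symmetric])
      show "norm (indicator (W \<epsilon>) x * sphere_div X x - indicator \<Omega> x * sphere_div X x) \<le> B * indicator (sym_diff \<Omega> (W \<epsilon>)) x"
        if "x \<in> space ?M" for x
        using B[of x] that by (auto simp: indicator_def)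
    qed
    finally show ?thesis using SD sets.sets_into_space[OF SD] by (simp add: Int_absorb1 Int_absorb2)
  qed
  have "((\<lambda>\<epsilon>. ?I (W \<epsilon>) - ?I \<Omega>) \<longlongrightarrow> 0) (at_right 0)"
  proof (rule Lim_null_comparison)
    show "\<forall>\<^sub>F \<epsilon> in at_right 0. norm (?I (W \<epsilon>) - ?I \<Omega>) \<le> B * measure ?M (sym_diff \<Omega> (W \<epsilon>))"
      using bound by (intro eventually_at_rightI[of 0 1]) auto
    show "((\<lambda>\<epsilon>. B * measure ?M (sym_diff \<Omega> (W \<epsilon>))) \<longlongrightarrow> 0) (at_right 0)"
      using tendsto_mult_left[OF conv[unfolded L1_converges_def], of B] by simp
  qed
  then have "((\<lambda>\<epsilon>. ?I (W \<epsilon>)) \<longlongrightarrow> ?I \<Omega>) (at_right 0)" by (simp add: LIM_zero_iff)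
  then have "((\<lambda>\<epsilon>. ereal (?I (W \<epsilon>))) \<longlongrightarrow> ereal (?I \<Omega>)) (at_right 0)" by (rule tendsto_ereal)
  then have "ereal (?I \<Omega>) = Liminf (at_right 0) (\<lambda>\<epsilon>. ereal (?I (W \<epsilon>)))"
    by (intro lim_imp_Liminf[symmetric]) auto
  also have "\<dots> \<le> Liminf (at_right 0) (\<lambda>\<epsilon>. Per (W \<epsilon>))"
    unfolding Per_def total_variation_def using X by (intro Liminf_mono always_eventually allI SUP_upper)
  finally show "ereal (?I \<Omega>) \<le> Liminf (at_right 0) (\<lambda>\<epsilon>. Per (W \<epsilon>))" .
qed

context helmholtz
begin

lemma energy_eq: "energy \<gamma> \<epsilon> K \<Omega> = Per \<Omega> - ereal (\<gamma> * nonlocal \<Omega>)"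
  by (simp add: energy_def nonlocal_def)

text \<open>Holds at every fixed eps because the nonlocal term never exceeds the perimeter. If the
  perimeter is infinite, subtracting the real nonlocal term leaves it so.\<close>

lemma energy_lower_bound:
  assumes "\<Omega> \<in> sets M" "0 < \<gamma>" "\<gamma> < 1"
  shows "ereal (1 - \<gamma>) * Per \<Omega> \<le> energy \<gamma> \<epsilon> K \<Omega>"
proof (cases "Per \<Omega>")
  case (real r)
  then have "nonlocal \<Omega> \<le> r" using nonlocal_le_Per[OF assms(1)] by simp
  then have "\<gamma> * nonlocal \<Omega> \<le> \<gamma> * r" using assms by simp
  then show ?thesis by (simp add: energy_eq real algebra_simps)
next
  case MInf
  then show ?thesis using nonlocal_le_Per[OF assms(1)] by simp
qed (simp add: energy_eq)

lemma nonlocal_nonneg: "\<Omega> \<in> sets M \<Longrightarrow> 0 \<le> nonlocal \<Omega>"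
proof -
  assume \<Omega>: "\<Omega> \<in> sets M"
  have "0 \<le> (LINT y|M. \<bar>indicator \<Omega> y - smoothed \<Omega> y\<bar>)" by simp
  then show ?thesis using eps by (simp add: nonlocal_eq(2)[OF \<Omega>] zero_le_mult_iff)
qed

end

text \<open>For the lower bound a nearly optimal field is fixed before eps tends to 0. The bound B
  on its divergence then stays constant, and the error of order B eps disappears.\<close>

lemma nonlocal_tendsto_Per:
  fixes K :: "real \<Rightarrow> 'a::euclidean_space \<Rightarrow> 'a \<Rightarrow> real"
  assumes K: "\<And>\<epsilon>. 0 < \<epsilon> \<Longrightarrow> helmholtz \<epsilon> (K \<epsilon>)" and \<Omega>: "\<Omega> \<in> sets sphere_measure"
    and r: "Per \<Omega> = ereal r"
  shows "((\<lambda>\<epsilon>. helmholtz.nonlocal \<epsilon> (K \<epsilon>) \<Omega>) \<longlongrightarrow> r) (at_right 0)"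
proof (rule order_tendstoI)
  let ?N = "\<lambda>\<epsilon>. helmholtz.nonlocal \<epsilon> (K \<epsilon>) \<Omega>"
  have le: "?N \<epsilon> \<le> r" and nn: "0 \<le> ?N \<epsilon>" if "0 < \<epsilon>" for \<epsilon>
    using helmholtz.nonlocal_le_Per[OF K[OF that] \<Omega>] helmholtz.nonlocal_nonneg[OF K[OF that] \<Omega>] r by auto
  show "\<forall>\<^sub>F \<epsilon> in at_right 0. ?N \<epsilon> < a" if "r < a" for a
    using le that by (intro eventually_at_rightI[of 0 1]) (auto intro: le_less_trans)
  fix a assume a: "a < r"
  then have "ereal a < Per \<Omega>" by (simp add: r)
  then obtain X where X: "smooth_vector_field X" "\<And>x. x \<in> sphere 0 1 \<Longrightarrow> norm (X x) \<le> 1"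
    and aX: "a < (LINT x|sphere_measure. indicator \<Omega> x * sphere_div X x)"
    unfolding Per_def total_variation_def less_SUP_iff by auto
  have "C1_sphere X" using X(1) by (auto simp: smooth_vector_field_def smooth_fun_on_imp_C1_sphere)
  then have "compact (sphere_div X ` sphere 0 1)"
    by (intro compact_continuous_image sphere_div_continuous) auto
  then obtain B where B: "\<And>x. x \<in> sphere 0 1 \<Longrightarrow> \<bar>sphere_div X x\<bar> \<le> B"
    by (metis (no_types, lifting) bounded_iff compact_imp_bounded imageI real_norm_def)
  define v where "v = (LINT x|sphere_measure. indicator \<Omega> x * sphere_div X x)"
  have low: "v - 2 * \<bar>B\<bar> * r * \<epsilon> \<le> ?N \<epsilon>" if \<epsilon>: "0 < \<epsilon>" for \<epsilon>
  proof -
    have "v \<le> (1 + 2 * B * \<epsilon>) * ?N \<epsilon>"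
      unfolding v_def by (rule helmholtz.variation_le_nonlocal[OF K[OF \<epsilon>] X B \<Omega>])
    also have "\<dots> = ?N \<epsilon> + B * (2 * \<epsilon> * ?N \<epsilon>)" by (simp add: algebra_simps)
    also have "B * (2 * \<epsilon> * ?N \<epsilon>) \<le> \<bar>B\<bar> * (2 * \<epsilon> * r)"
      using \<epsilon> le[OF \<epsilon>] nn[OF \<epsilon>] by (intro mult_mono) auto
    finally show ?thesis by (simp add: algebra_simps)
  qed
  have "((\<lambda>\<epsilon>. v - 2 * \<bar>B\<bar> * r * \<epsilon>) \<longlongrightarrow> v) (at_right 0)"
    by (auto intro!: tendsto_eq_intros)
  then have "\<forall>\<^sub>F \<epsilon> in at_right 0. a < v - 2 * \<bar>B\<bar> * r * \<epsilon>"
    using aX by (intro order_tendstoD(1)[of _ v]) (auto simp: v_def)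
  moreover have "\<forall>\<^sub>F \<epsilon> in at_right 0. (0::real) < \<epsilon>" by (simp add: eventually_at_right_less)
  ultimately show "\<forall>\<^sub>F \<epsilon> in at_right 0. a < ?N \<epsilon>"
    by eventually_elim (use low in fastforce)
qed

theorem theorem2:
  fixes n :: nat and \<gamma> :: real
    and K :: "real \<Rightarrow> 'a::euclidean_space \<Rightarrow> 'a \<Rightarrow> real" and p :: 'a
  assumes "n \<ge> 2" and "DIM('a) = n + 1"
    and "\<And>\<epsilon>. \<epsilon> > 0 \<Longrightarrow> helmholtz_kernel \<epsilon> (K \<epsilon>)"
    and "p \<in> sphere 0 1"
    and "0 < \<gamma>" and "\<gamma> < gamma_crit n K p"
  shows "Gamma_converges_L1 (\<lambda>\<epsilon>. energy \<gamma> \<epsilon> (K \<epsilon>)) (limit_energy \<gamma> (gamma_crit n K p))"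
proof -
  have crit: "gamma_crit n K p = 1" by (rule gamma_crit_eq_1[OF assms(1-4)])
  with assms have \<gamma>: "0 < \<gamma>" "\<gamma> < 1" by auto
  have H: "helmholtz \<epsilon> (K \<epsilon>)" if "0 < \<epsilon>" for \<epsilon>
    by standard (use that assms in auto)
  have pos: "\<forall>\<^sub>F \<epsilon> in at_right 0. (0::real) < \<epsilon>" by (simp add: eventually_at_right_less)
  show ?thesis
    unfolding Gamma_converges_L1_def crit
  proof (intro conjI ballI allI impI)
    fix \<Omega> :: "'a set" and W :: "real \<Rightarrow> 'a set"
    assume \<Omega>: "\<Omega> \<in> sets sphere_measure"
      and W: "(\<forall>\<epsilon>>0. W \<epsilon> \<in> sets sphere_measure) \<and> L1_converges W \<Omega>"
    \<comment> \<open>For infinite perimeter both sides are infinite, since the factor 1 -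
      \<open>\<gamma>\<close> is positive.\<close>
    have "limit_energy \<gamma> 1 \<Omega> \<le> ereal (1 - \<gamma>) * Per \<Omega>"
      using \<gamma> by (auto simp: limit_energy_def finite_perimeter_def not_less)
    also have "\<dots> \<le> ereal (1 - \<gamma>) * Liminf (at_right 0) (\<lambda>\<epsilon>. Per (W \<epsilon>))"
      using \<gamma> W by (intro ereal_mult_left_mono Per_lower_semicontinuous[OF \<Omega>]) auto
    also have "\<dots> = Liminf (at_right 0) (\<lambda>\<epsilon>. ereal (1 - \<gamma>) * Per (W \<epsilon>))"
      using \<gamma> by (intro Liminf_ereal_mult_left[symmetric]) auto
    also have "\<dots> \<le> Liminf (at_right 0) (\<lambda>\<epsilon>. energy \<gamma> \<epsilon> (K \<epsilon>) (W \<epsilon>))"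
    proof (rule Liminf_mono)
      show "\<forall>\<^sub>F \<epsilon> in at_right 0. ereal (1 - \<gamma>) * Per (W \<epsilon>) \<le> energy \<gamma> \<epsilon> (K \<epsilon>) (W \<epsilon>)"
        using pos
      proof eventually_elim
        case (elim \<epsilon>)
        then show ?case using helmholtz.energy_lower_bound[OF H[OF elim] _ \<gamma>] W by blast
      qed
    qed
    finally show "limit_energy \<gamma> 1 \<Omega> \<le> Liminf (at_right 0) (\<lambda>\<epsilon>. energy \<gamma> \<epsilon> (K \<epsilon>) (W \<epsilon>))" .
  next
    fix \<Omega> :: "'a set" assume \<Omega>: "\<Omega> \<in> sets sphere_measure"
    have "Limsup (at_right 0) (\<lambda>\<epsilon>. energy \<gamma> \<epsilon> (K \<epsilon>) \<Omega>) \<le> limit_energy \<gamma> 1 \<Omega>"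
    proof (cases "finite_perimeter \<Omega>")
      case True
      \<comment> \<open>The perimeter lies above a real number, namely the nonlocal term at eps = 1,
        so finite perimeter means a real value.\<close>
      have "Per \<Omega> \<noteq> - \<infinity>"
        using helmholtz.nonlocal_le_Per[OF H[OF zero_less_one] \<Omega>] by auto
      then obtain r where r: "Per \<Omega> = ereal r"
        using True by (cases "Per \<Omega>") (auto simp: finite_perimeter_def)
      have "((\<lambda>\<epsilon>. ereal (r - \<gamma> * helmholtz.nonlocal \<epsilon> (K \<epsilon>) \<Omega>)) \<longlongrightarrow> ereal (r - \<gamma> * r)) (at_right 0)"
        by (intro tendsto_ereal tendsto_intros nonlocal_tendsto_Per[OF H \<Omega> r])
      moreover have "\<forall>\<^sub>F \<epsilon> in at_right 0. ereal (r - \<gamma> * helmholtz.nonlocal \<epsilon> (K \<epsilon>) \<Omega>) = energy \<gamma> \<epsilon> (K \<epsilon>) \<Omega>"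
        using pos by eventually_elim (simp add: helmholtz.energy_eq[OF H] r)
      ultimately have "((\<lambda>\<epsilon>. energy \<gamma> \<epsilon> (K \<epsilon>) \<Omega>) \<longlongrightarrow> ereal (r - \<gamma> * r)) (at_right 0)"
        by (rule Lim_transform_eventually)
      then have "Limsup (at_right 0) (\<lambda>\<epsilon>. energy \<gamma> \<epsilon> (K \<epsilon>) \<Omega>) = ereal (r - \<gamma> * r)"
        by (intro lim_imp_Limsup) auto
      also have "\<dots> = limit_energy \<gamma> 1 \<Omega>"
        using True by (simp add: limit_energy_def r left_diff_distrib)
      finally show ?thesis by simp
    qed (simp add: limit_energy_def)
    then show "\<exists>W. (\<forall>\<epsilon>>0. W \<epsilon> \<in> sets sphere_measure) \<and> L1_converges W \<Omega> \<and>
        Limsup (at_right 0) (\<lambda>\<epsilon>. energy \<gamma> \<epsilon> (K \<epsilon>) (W \<epsilon>)) \<le> limit_energy \<gamma> 1 \<Omega>"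
      using \<Omega> by (intro exI[of _ "\<lambda>_. \<Omega>"]) (simp add: L1_converges_def)
  qed
qed

end
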